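(* Let $N>2M\ge 2$ be integers, let $K$ be the $N$-gon, and let $z\in\mathbb{R}^N$ be a typical point such that $\mathrm{PH}_0(z)$ has exactly $M$ points. Let $P=(\mathrm{PH}_0(z),\mathrm{PH}_1(z))$ and $\mathbf{data}_P=\{w\in\mathbb{R}^N:\mathrm{PH}_0(w)=\mathrm{PH}_0(z),\ \mathrm{PH}_1(w)=\mathrm{PH}_1(z)\}$. Then the connected component of $\mathbf{data}_P$ containing $z$ is homeomorphic to the geometric realization of the poset $\mathbf{Str}(N,M)$.
   Context: The $N$-gon $K$ has vertices $\mathbb{Z}/N$ and edges $[i,i+1]$. For $w\in\mathbb{R}^N$, $K_r(w)$ is the subcomplex of vertices $i$ with $w_i\le r$ and edges with $\max\{w_i,w_{i+1}\}\le r$; $\mathrm{PH}_0(w),\mathrm{PH}_1(w)$ are the persistence diagrams (multisets of (birth, death) pairs) in degrees $0,1$ of the filtration $r\mapsto K_r(w)$. A point $z\in\mathbb{R}^N$ is typical if its coordinates are pairwise distinct. Circular cellular strings: a circular symbol string of length $N$ is $s=s_1\cdots s_N$ with each $s_i\in\{0,1,X\}$, indices read cyclically modulo $N$; $0,1$ are called bits. A block of $s$ is a maximal cyclic run of consecutive equal symbols. $s$ is a circular cellular string of rank $M$ if it has exactly $M$ blocks of symbol $0$, exactly $M$ blocks of symbol $1$, and every block of symbol $X$ is cyclically preceded and followed by blocks of different bits (one of symbol $0$ and one of symbol $1$). Its dimension is its number of symbols $X$. $\mathbf{Str}(N,M)$ is the set of such strings, partially ordered by $s'<s$ iff $s$ is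 obtained from $s'$ by replacing some (at least one) of the bits of $s'$ by $X$. The geometric realization of a poset is the geometric realization of its order complex (nerve). *)

theory Defs
  imports "HOL-Analysis.Analysis" "HOL-Library.Function_Algebras" "HOL-Library.Multiset"
begin

text \<open>A point of R^N is a function nat => real vanishing outside {0..<N};
  coordinate i corresponds to the vertex i of Z/N. The topology is the
  (product) topology of nat => real, which on this finite-dimensional
  subspace is the Euclidean one.\<close>

definition RN :: "nat \<Rightarrow> (nat \<Rightarrow> real) set" where
  "RN N = {w. \<forall>i\<ge>N. w i = 0}"

definition typical :: "nat \<Rightarrow> (nat \<Rightarrow> real) \<Rightarrow> bool" where
  "typical N z \<longleftrightarrow> inj_on z {0..<N}"

text \<open>Vertices of K_r(w); edge number e is [e, e+1 mod N].\<close>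
definition Kverts :: "nat \<Rightarrow> (nat \<Rightarrow> real) \<Rightarrow> real \<Rightarrow> nat set" where
  "Kverts N w r = {i. i < N \<and> w i \<le> r}"

definition Kedges :: "nat \<Rightarrow> (nat \<Rightarrow> real) \<Rightarrow> real \<Rightarrow> nat set" where
  "Kedges N w r = {e. e < N \<and> max (w e) (w ((e + 1) mod N)) \<le> r}"

definition scaleF :: "real \<Rightarrow> (nat \<Rightarrow> real) \<Rightarrow> (nat \<Rightarrow> real)" where
  "scaleF c f = (\<lambda>i. c * f i)"

abbreviation fdim :: "(nat \<Rightarrow> real) set \<Rightarrow> nat" where
  "fdim \<equiv> vector_space.dim scaleF"

definition C0 :: "nat \<Rightarrow> (nat \<Rightarrow> real) \<Rightarrow> real \<Rightarrow> (nat \<Rightarrow> real) set" where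
  "C0 N w r = {c. \<forall>i. c i \<noteq> 0 \<longrightarrow> i \<in> Kverts N w r}"

definition C1 :: "nat \<Rightarrow> (nat \<Rightarrow> real) \<Rightarrow> real \<Rightarrow> (nat \<Rightarrow> real) set" where
  "C1 N w r = {c. \<forall>e. c e \<noteq> 0 \<longrightarrow> e \<in> Kedges N w r}"

text \<open>Boundary map: d[e, e+1] = (e+1) - e.\<close>
definition bdry :: "nat \<Rightarrow> (nat \<Rightarrow> real) \<Rightarrow> (nat \<Rightarrow> real)" where
  "bdry N c = (\<lambda>v. if v < N then c ((v + N - 1) mod N) - c v else 0)"

definition B0 :: "nat \<Rightarrow> (nat \<Rightarrow> real) \<Rightarrow> real \<Rightarrow> (nat \<Rightarrow> real) set" where
  "B0 N w r = bdry N ` C1 N w r"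

definition Z1 :: "nat \<Rightarrow> (nat \<Rightarrow> real) \<Rightarrow> real \<Rightarrow> (nat \<Rightarrow> real) set" where
  "Z1 N w r = {c \<in> C1 N w r. bdry N c = (\<lambda>_. 0)}"

text \<open>Rank of the map H_k(K_s(w)) -> H_k(K_t(w)) induced by inclusion (s \<le> t).
  Degree 0: image is (C0(K_s) + B0(K_t)) / B0(K_t).
  Degree 1: there are no 2-simplices, so H_1 = Z_1 and the map is the inclusion
  Z1(K_s) \<subseteq> Z1(K_t); its image has dimension dim Z1(K_s).\<close>
definition hrank :: "nat \<Rightarrow> nat \<Rightarrow> (nat \<Rightarrow> real) \<Rightarrow> real \<Rightarrow> real \<Rightarrow> nat" where
  "hrank k N w s t =
     (if k = 0 then fdim {a + b | a b. a \<in> C0 N w s \<and> b \<in> B0 N w t} - fdim (B0 N w t)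
      else if k = 1 then fdim (Z1 N w s)
      else 0)"

text \<open>The persistence diagram in degree k: the multiset of (birth, death) pairs
  (death possibly infinite), off the diagonal, whose rank function equals the
  rank function of the persistence module: rank(H_k(K_s) -> H_k(K_t)) is the
  number of points with birth \<le> s and death > t.\<close>
definition PH :: "nat \<Rightarrow> nat \<Rightarrow> (nat \<Rightarrow> real) \<Rightarrow> (real \<times> ereal) multiset" where
  "PH k N w = (THE D. (\<forall>p \<in># D. ereal (fst p) < snd p) \<and>
      (\<forall>s t. s \<le> t \<longrightarrow>
         hrank k N w s t = size (filter_mset (\<lambda>p. fst p \<le> s \<and> ereal t < snd p) D)))"

definition dataP :: "nat \<Rightarrow> (nat \<Rightarrow> real) \<Rightarrow> (nat \<Rightarrow> real) set" where
  "dataP N z = {w \<in> RN N. PH 0 N w = PH 0 N z \<and> PH 1 N w = PH 1 N z}"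

datatype sym = S0 | S1 | SX

definition cat :: "sym list \<Rightarrow> nat \<Rightarrow> sym" where
  "cat s i = s ! (i mod length s)"

definition nblocks :: "sym list \<Rightarrow> sym \<Rightarrow> nat" where
  "nblocks s a = (if s \<noteq> [] \<and> (\<forall>i < length s. s ! i = a) then 1
     else card {i. i < length s \<and> s ! i = a \<and> cat s (i + length s - 1) \<noteq> a})"

definition xblocks_ok :: "sym list \<Rightarrow> bool" where
  "xblocks_ok s \<longleftrightarrow> (\<forall>i < length s. \<forall>k < length s.
      (s ! i = SX \<and> cat s (i + length s - 1) \<noteq> SX \<and> (\<forall>l \<le> k. cat s (i + l) = SX)
        \<and> cat s (i + k + 1) \<noteq> SX)
      \<longrightarrow> cat s (i + length s - 1) \<noteq> cat s (i + k + 1))"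

definition Str :: "nat \<Rightarrow> nat \<Rightarrow> sym list set" where
  "Str N M = {s. length s = N \<and> nblocks s S0 = M \<and> nblocks s S1 = M \<and> xblocks_ok s}"

definition str_less :: "sym list \<Rightarrow> sym list \<Rightarrow> bool" where
  "str_less s' s \<longleftrightarrow> length s' = length s \<and> s' \<noteq> s \<and>
     (\<forall>i < length s. s' ! i = s ! i \<or> (s' ! i \<noteq> SX \<and> s ! i = SX))"

text \<open>Points are finitely supported convex weightings of elements of P whose
  support is a chain (a simplex of the order complex); topologised as a
  subspace of 'a => real (product topology; Euclidean on R^P for finite P).\<close>
definition poset_realization :: "'a set \<Rightarrow> ('a \<Rightarrow> 'a \<Rightarrow> bool) \<Rightarrow> ('a \<Rightarrow> real) set" where
  "poset_realization P lt = {f. (\<forall>x. 0 \<le> f x) \<and> finite {x. f x \<noteq> 0} \<and> {x. f x \<noteq> 0} \<subseteq> P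
     \<and> (\<forall>x \<in> {x. f x \<noteq> 0}. \<forall>y \<in> {x. f x \<noteq> 0}. x = y \<or> lt x y \<or> lt y x)
     \<and> sum f {x. f x \<noteq> 0} = 1}"

end

theory Submission
  imports Defs
begin

text \<open>
  A vector whose cyclic sequence of alternating local minima and maxima has values \<open>v\<close> is
  \<open>zigzag v \<circ> \<theta>\<close> for a monotone sequence of phases \<open>\<theta>\<close> with
  \<open>\<theta> (i + N) = \<theta> i + 2 M\<close> that meets every integer, where \<open>zigzag v\<close> interpolates \<open>v\<close> linearly.
  Its diagrams depend on \<open>v\<close> only, and they confine \<open>v\<close> to a finite set, so the component of \<open>z\<close>
  consists of all vectors with the same \<open>v\<close> up to even shifts. Sending \<open>0\<close>, \<open>1\<close>, \<open>X\<close> to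
  \<open>0\<close>, \<open>1\<close>, \<open>1/2\<close> and extending linearly identifies the realization of the string poset with the same
  kind of space for the 2-periodic \<open>v\<close> with values 0 and 1.

  The two spaces are quotients of one space of phases by the shifts by \<open>2 M\<close> and by \<open>2\<close>, so the former
  is an \<open>M\<close>-fold cover of the latter, and a homeomorphism has to be found elsewhere. Deleting one
  occurrence of each integer from \<open>\<theta>\<close> leaves an arbitrary monotone sequence \<open>x\<close> with
  \<open>x (j + d) = x j + 2 M\<close>, where \<open>d = N - 2 M\<close>. Such sequences form a line times a simplex, and a shift
  of phases by \<open>2 r\<close> is a translation of the line combined with the rotation by \<open>2 r\<close> of the vertices
  of the simplex. As an even rotation is isotopic to the identity, both quotients are a circle times
  the simplex.
\<close>

section \<open>Phases and zigzags\<close>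

text \<open>The delicate point is the isotopy. An even power of the cyclic rotation of the vertices
  of a simplex is an even permutation for every \<open>d\<close>, while a single rotation reverses
  orientation when \<open>d\<close> is even; hence only even shifts can be absorbed in general. The
  straight path of linear maps from the identity to the double index shift is singular at
  \<open>s = 1/2\<close> when 4 divides \<open>d\<close>, because then the imaginary unit, whose
  square is -1, is a \<open>d\<close>-th root of unity. \<open>twist\<close> bends this path by a
  multiple of the single shift that vanishes at both ends. Its maps are invertible but do not
  preserve the simplex; \<open>swirl\<close> repairs this by rescaling every ray with the gauge
  \<open>slope\<close>. \<open>spiral\<close> runs through the isotopy while climbing the line by
  one period, so that its two ends are glued by the identity of the simplex. The glueing is then the
  same for all periods, and both spaces appear as quotients of one compact space with the same
  fibres; no formula for the homeomorphism is written down. The relevant even period is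
  \<open>2 * M\<close> for a typical \<open>z\<close> and 2 for strings.\<close>

lemma int_threshold:
  fixes P :: "int \<Rightarrow> bool"
  assumes "P a" and "\<not> P b" and step: "\<And>i. P i \<Longrightarrow> P (i + 1)"
  obtains c where "\<And>i. P i \<longleftrightarrow> c \<le> i"
proof -
  have up: "P j" if "P i" "i \<le> j" for i j
    using that(2) by (induction rule: int_ge_induct) (use that(1) step in auto)
  have ba: "b < a" using up assms by (meson not_le)
  define k where "k = (LEAST m::nat. P (b + int m))"
  have ex: "P (b + int (nat (a - b)))" using ba assms(1) by simp
  have Pk: "P (b + int k)" unfolding k_def by (rule LeastI[where k="nat (a-b)"]) (rule ex)
  have k0: "k > 0" using Pk assms(2) by (cases k) auto
  have "\<not> P (b + int (k - 1))" using k0 not_less_Least[of "k-1" "\<lambda>m. P (b + int m)"] unfolding k_def by auto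
  then have nP: "\<not> P (b + int k - 1)" using k0 by (simp add: of_nat_diff algebra_simps)
  have "P i \<longleftrightarrow> b + int k \<le> i" for i
  proof
    assume "P i"
    show "b + int k \<le> i"
    proof (rule ccontr)
      assume "\<not> b + int k \<le> i"
      then have "i \<le> b + int k - 1" by simp
      with up[OF \<open>P i\<close>] nP show False by blast
    qed
  qed (use up Pk in blast)
  then show ?thesis by (rule that)
qed

lemma int_primitive:
  fixes \<delta> :: "int \<Rightarrow> int"
  obtains K where "\<And>i. K (i + 1) = K i + \<delta> i" and "K a = c"
proof -
  define F where "F i = (\<Sum>j\<in>{0..<i}. \<delta> j) - (\<Sum>j\<in>{i..<0}. \<delta> j)" for i
  have F: "F (i + 1) = F i + \<delta> i" for i
  proof (cases "i \<ge> 0")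
    case True
    then have "{0..<i+1} = insert i {0..<i}" "{i+1..<0} = {}" "{i..<0} = {}" by auto
    then show ?thesis by (simp add: F_def)
  next
    case False
    then have "{i..<0} = insert i {i+1..<0}" "{0..<i+1} = {}" "{0..<i} = {}" by auto
    then show ?thesis by (simp add: F_def)
  qed
  show ?thesis by (rule that[of "\<lambda>i. F i - F a + c"]) (simp_all add: F)
qed

lemma int_step_mono:
  fixes f :: "int \<Rightarrow> 'a::order"
  assumes "\<And>i. f i \<le> f (i + 1)" and "i \<le> j"
  shows "f i \<le> f j"
  using assms(2) by (induction rule: int_ge_induct) (auto intro: order_trans assms(1))

lemma int_period_mult:
  fixes f :: "int \<Rightarrow> 'a::ring_1"
  assumes "\<And>i. f (i + n) = f i + l"
  shows "f (i + q * n) = f i + of_int q * l"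
proof (induction q rule: int_induct[where k=0])
  case (step1 q)
  have "f (i + (q + 1) * n) = f ((i + q * n) + n)" by (simp add: algebra_simps)
  then show ?case by (simp only: assms step1) (simp add: algebra_simps)
next
  case (step2 q)
  have "f (i + q * n) = f ((i + (q - 1) * n) + n)" by (simp add: algebra_simps)
  then have "f (i + q * n) = f (i + (q - 1) * n) + l" by (simp only: assms)
  then show ?case using step2 by (simp add: algebra_simps)
qed simp

section \<open>Quasi-periodic monotone sequences and phases\<close>

definition quasi_periodic :: "int \<Rightarrow> int \<Rightarrow> (int \<Rightarrow> real) set" where
  "quasi_periodic n l = {x. (\<forall>i. x i \<le> x (i + 1)) \<and> (\<forall>i. x (i + n) = x i + of_int l)}"

lemma quasi_periodicD:
  assumes "x \<in> quasi_periodic n l"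
  shows "i \<le> j \<Longrightarrow> x i \<le> x j" and "x (i + n) = x i + of_int l"
    and "x (i + q * n) = x i + of_int (q * l)"
  using assms int_step_mono[of x i j] int_period_mult[of x n "of_int l" i q]
  by (auto simp: quasi_periodic_def)

lemma linear_unbounded:
  fixes c :: real and l :: int
  assumes "l > 0"
  obtains q :: int where "c \<le> of_int (q * l)"
proof -
  have "c \<le> of_int \<bar>\<lceil>c\<rceil>\<bar>" by linarith
  also have "\<bar>\<lceil>c\<rceil>\<bar> * 1 \<le> \<bar>\<lceil>c\<rceil>\<bar> * l" using assms by (intro mult_left_mono) auto
  then have "real_of_int \<bar>\<lceil>c\<rceil>\<bar> \<le> of_int (\<bar>\<lceil>c\<rceil>\<bar> * l)" by linarith
  finally show ?thesis by (rule that)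
qed

lemma quasi_periodic_unbounded:
  assumes "x \<in> quasi_periodic n l" "l > 0"
  obtains i j where "c \<le> x i" "x j < c"
proof -
  obtain q where q: "c - x 0 \<le> of_int (q * l)" using linear_unbounded[OF assms(2)] .
  obtain r where r: "x 0 - c + 1 \<le> of_int (r * l)" using linear_unbounded[OF assms(2)] .
  show ?thesis
    using that[of "0 + q * n" "0 + (- r) * n"] quasi_periodicD(3)[OF assms(1), of 0 q]
      quasi_periodicD(3)[OF assms(1), of 0 "- r"] q r by simp
qed

text \<open>For positive \<open>l\<close> the last condition says that no integer is jumped over, so
  that every integer is a value (\<open>phases_first_hit\<close>, \<open>phasesI_hits\<close>). The
  local form with the floor can be checked step by step.\<close>

definition phases :: "int \<Rightarrow> int \<Rightarrow> (int \<Rightarrow> real) set" where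
  "phases n l = {\<theta> \<in> quasi_periodic n l. \<forall>i. \<theta> (i + 1) \<le> of_int \<lfloor>\<theta> i\<rfloor> + 1}"

lemma phases_quasi_periodic: "\<theta> \<in> phases n l \<Longrightarrow> \<theta> \<in> quasi_periodic n l"
  by (simp add: phases_def)

lemma phases_step:
  assumes "\<theta> \<in> phases n l"
  shows "\<theta> i \<le> \<theta> (i + 1)" "\<theta> (i + 1) \<le> of_int \<lfloor>\<theta> i\<rfloor> + 1"
  using assms by (auto simp: phases_def quasi_periodic_def)

lemma phases_floor_step:
  assumes "\<theta> \<in> phases n l"
  shows "\<lfloor>\<theta> (i + 1)\<rfloor> = \<lfloor>\<theta> i\<rfloor> \<or> \<lfloor>\<theta> (i + 1)\<rfloor> = \<lfloor>\<theta> i\<rfloor> + 1"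
  using phases_step[OF assms, of i] by linarith

text \<open>At the first index whose floor reaches \<open>k\<close> the previous floor is below
  \<open>k\<close>, and the step bound leaves no room above \<open>k\<close>.\<close>

lemma phases_first_hit:
  assumes \<theta>: "\<theta> \<in> phases n l" and "l > 0"
  obtains a where "\<theta> a = of_int k" and "\<And>i. k \<le> \<lfloor>\<theta> i\<rfloor> \<longleftrightarrow> a \<le> i"
proof -
  note qp = phases_quasi_periodic[OF \<theta>]
  obtain i j where "of_int k \<le> \<theta> i" "\<theta> j < of_int k"
    using quasi_periodic_unbounded[OF qp \<open>l > 0\<close>] .
  then have ij: "k \<le> \<lfloor>\<theta> i\<rfloor>" "\<not> k \<le> \<lfloor>\<theta> j\<rfloor>" by linarith+
  have up: "k \<le> \<lfloor>\<theta> (i + 1)\<rfloor>" if "k \<le> \<lfloor>\<theta> i\<rfloor>" for i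
    using phases_floor_step[OF \<theta>, of i] that by linarith
  obtain c where c: "\<And>i. k \<le> \<lfloor>\<theta> i\<rfloor> \<longleftrightarrow> c \<le> i"
    using int_threshold[of "\<lambda>i. k \<le> \<lfloor>\<theta> i\<rfloor>", OF ij up] by blast
  have "\<not> k \<le> \<lfloor>\<theta> (c - 1)\<rfloor>" "k \<le> \<lfloor>\<theta> c\<rfloor>" using c by auto
  with phases_step(2)[OF \<theta>, of "c - 1"] have "\<theta> c = of_int k" by (simp; linarith)
  then show ?thesis using that c by blast
qed

lemma phasesI_hits:
  assumes qp: "\<theta> \<in> quasi_periodic n l" and hits: "\<And>k::int. \<exists>i. \<theta> i = of_int k"
  shows "\<theta> \<in> phases n l"
proof -
  have "\<theta> (i + 1) \<le> of_int \<lfloor>\<theta> i\<rfloor> + 1" for i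
  proof -
    obtain j where j: "\<theta> j = of_int (\<lfloor>\<theta> i\<rfloor> + 1)" using hits by blast
    then have "\<theta> i < \<theta> j" by linarith
    then have "i + 1 \<le> j" using quasi_periodicD(1)[OF qp, of j i] by linarith
    then have "\<theta> (i + 1) \<le> \<theta> j" by (rule quasi_periodicD(1)[OF qp])
    then show ?thesis using j by simp
  qed
  then show ?thesis using qp by (simp add: phases_def)
qed

lemma quasi_periodic_shift:
  "x \<in> quasi_periodic n l \<Longrightarrow> (\<lambda>i. x i + c) \<in> quasi_periodic n l"
  by (simp add: quasi_periodic_def algebra_simps)

lemma phases_shift:
  "\<theta> \<in> phases n l \<Longrightarrow> (\<lambda>i. \<theta> i + of_int m) \<in> phases n l"
  using quasi_periodic_shift[of \<theta> n l "of_int m"] by (simp add: phases_def algebra_simps)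

section \<open>Piecewise linear interpolation and its rigidity\<close>

definition zigzag :: "(int \<Rightarrow> real) \<Rightarrow> real \<Rightarrow> real" where
  "zigzag v x = v \<lfloor>x\<rfloor> + (x - of_int \<lfloor>x\<rfloor>) * (v (\<lfloor>x\<rfloor> + 1) - v \<lfloor>x\<rfloor>)"

text \<open>Minima sit at even and maxima at odd indices. Fixing this parity is the reason why
  phases are determined up to even shifts only.\<close>

definition alternating :: "int \<Rightarrow> (int \<Rightarrow> real) \<Rightarrow> bool" where
  "alternating l v \<longleftrightarrow> (\<forall>k. v (k + l) = v k) \<and>
     (\<forall>k. if even k then v k < v (k + 1) else v (k + 1) < v k)"

lemma zigzag_of_int [simp]: "zigzag v (of_int k) = v k"
  by (simp add: zigzag_def)

text \<open>The formula of a segment remains valid at its right end, where the floor has already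
  jumped; this lets adjacent pieces be glued.\<close>

lemma zigzag_on_segment:
  assumes "of_int k \<le> x" "x \<le> of_int k + 1"
  shows "zigzag v x = v k + (x - of_int k) * (v (k + 1) - v k)"
proof (cases "x = of_int k + 1")
  case True
  then have "x = of_int (k + 1)" by simp
  then show ?thesis by (simp only: zigzag_of_int) simp
next
  case False
  then have "\<lfloor>x\<rfloor> = k" using assms by linarith
  then show ?thesis by (simp add: zigzag_def)
qed

lemma zigzag_shift: "zigzag (\<lambda>k. v (k + m)) x = zigzag v (x + of_int m)"
  by (simp add: zigzag_def algebra_simps)

lemma zigzag_periodic:
  assumes "\<And>k. v (k + l) = v k"
  shows "zigzag v (x + of_int l) = zigzag v x"
  using zigzag_shift[of v l x] assms by simp

lemma zigzag_segment_less_iff: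
  assumes "alternating l v" "of_int k \<le> x" "x \<le> of_int k + 1" "of_int k \<le> y" "y \<le> of_int k + 1"
  shows "even k \<Longrightarrow> zigzag v x < zigzag v y \<longleftrightarrow> x < y"
    and "odd k \<Longrightarrow> zigzag v x < zigzag v y \<longleftrightarrow> y < x"
proof -
  have *: "zigzag v y - zigzag v x = (y - x) * (v (k + 1) - v k)"
    using zigzag_on_segment[OF assms(2,3), of v] zigzag_on_segment[OF assms(4,5), of v]
    by (simp add: algebra_simps)
  have **: "zigzag v x < zigzag v y \<longleftrightarrow> 0 < (y - x) * (v (k + 1) - v k)"
    using * by linarith
  show "even k \<Longrightarrow> zigzag v x < zigzag v y \<longleftrightarrow> x < y"
    "odd k \<Longrightarrow> zigzag v x < zigzag v y \<longleftrightarrow> y < x"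
    using assms(1)[unfolded alternating_def, THEN conjunct2, rule_format, of k]
    unfolding ** zero_less_mult_iff by auto
qed

lemma zigzag_segment_inj:
  assumes "alternating l v" "of_int k \<le> x" "x \<le> of_int k + 1" "of_int k \<le> y" "y \<le> of_int k + 1"
    and "zigzag v x = zigzag v y"
  shows "x = y"
  using zigzag_segment_less_iff[OF assms(1-5)] zigzag_segment_less_iff[OF assms(1,4,5,2,3)] assms(6)
  by (cases "even k") (auto simp: not_less_iff_gr_or_eq)

lemma continuous_on_zigzag: "continuous_on UNIV (zigzag v)"
proof -
  have *: "continuous_on {of_int a..of_int a + real n} (zigzag v)" for a n
  proof (induction n)
    case 0
    then show ?case by simp
  next
    case (Suc n)
    have "continuous_on {of_int (a + int n)..of_int (a + int n) + 1}
        (\<lambda>x. v (a + int n) + (x - of_int (a + int n)) * (v (a + int n + 1) - v (a + int n)))"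
      by (intro continuous_intros)
    then have "continuous_on {of_int (a + int n)..of_int (a + int n) + 1} (zigzag v)"
      by (rule continuous_on_eq) (rule zigzag_on_segment[symmetric], auto)
    then have "continuous_on ({of_int a..of_int a + real n} \<union>
        {of_int (a + int n)..of_int (a + int n) + 1}) (zigzag v)"
      by (intro continuous_on_closed_Un Suc.IH closed_atLeastAtMost)
    then show ?case
      by (rule continuous_on_subset) auto
  qed
  have "isCont (zigzag v) x" for x
  proof -
    have "continuous_on {of_int (\<lfloor>x\<rfloor> - 1)..of_int (\<lfloor>x\<rfloor> - 1) + real 3} (zigzag v)"
      by (rule *)
    then have "continuous_on {of_int (\<lfloor>x\<rfloor> - 1)<..<of_int (\<lfloor>x\<rfloor> - 1) + real 3} (zigzag v)"
      by (rule continuous_on_subset) auto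
    moreover have "x \<in> {of_int (\<lfloor>x\<rfloor> - 1)<..<of_int (\<lfloor>x\<rfloor> - 1) + real 3}"
      by (simp; linarith)
    ultimately show ?thesis by (simp add: continuous_on_eq_continuous_at del: greaterThanLessThan_iff)
  qed
  then show ?thesis by (simp add: continuous_on_eq_continuous_at)
qed

text \<open>After \<open>i\<close> the phase is constant up to some \<open>c - 1\<close>. The next
  phase is strictly larger but still in the closed unit segment of \<open>\<theta> i\<close>, on
  which the direction of \<open>zigzag v\<close> is the parity of the left end.\<close>

lemma zigzag_next_change:
  assumes \<theta>: "\<theta> \<in> phases n l" and "n > 0" "l > 0" and v: "alternating l v"
  obtains j where "i \<le> j" and "\<And>m. i \<le> m \<Longrightarrow> m \<le> j \<Longrightarrow> zigzag v (\<theta> m) = zigzag v (\<theta> i)"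
    and "if even \<lfloor>\<theta> i\<rfloor> then zigzag v (\<theta> j) < zigzag v (\<theta> (j + 1))
         else zigzag v (\<theta> (j + 1)) < zigzag v (\<theta> j)"
proof -
  note qp = phases_quasi_periodic[OF \<theta>]
  have "\<theta> i < \<theta> (i + n)" using quasi_periodicD(2)[OF qp, of i] \<open>l > 0\<close> by simp
  moreover have "\<theta> i < \<theta> (m + 1)" if "\<theta> i < \<theta> m" for m
    using phases_step(1)[OF \<theta>, of m] that by linarith
  ultimately obtain c where c: "\<And>m. \<theta> i < \<theta> m \<longleftrightarrow> c \<le> m"
    using int_threshold[of "\<lambda>m. \<theta> i < \<theta> m" "i + n" i] by blast
  have ic: "i < c" using c[of i] by auto
  have const: "\<theta> m = \<theta> i" if "i \<le> m" "m \<le> c - 1" for m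
    using c[of m] that quasi_periodicD(1)[OF qp that(1)] by linarith
  have cc: "\<theta> i < \<theta> c" using c[of c] by simp
  have "\<theta> c \<le> of_int \<lfloor>\<theta> i\<rfloor> + 1"
    using phases_step(2)[OF \<theta>, of "c - 1"] const[of "c - 1"] ic by simp
  then have "if even \<lfloor>\<theta> i\<rfloor> then zigzag v (\<theta> i) < zigzag v (\<theta> c)
         else zigzag v (\<theta> c) < zigzag v (\<theta> i)"
    using zigzag_segment_less_iff[OF v, of "\<lfloor>\<theta> i\<rfloor>" "\<theta> i" "\<theta> c"]
      zigzag_segment_less_iff[OF v, of "\<lfloor>\<theta> i\<rfloor>" "\<theta> c" "\<theta> i"] cc by simp linarith
  then have 1: "if even \<lfloor>\<theta> i\<rfloor> then zigzag v (\<theta> (c - 1)) < zigzag v (\<theta> (c - 1 + 1))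
         else zigzag v (\<theta> (c - 1 + 1)) < zigzag v (\<theta> (c - 1))"
    using const[of "c - 1"] ic by simp
  have 2: "zigzag v (\<theta> m) = zigzag v (\<theta> i)" if "i \<le> m" "m \<le> c - 1" for m
    using const[OF that] by simp
  have 3: "i \<le> c - 1" using ic by simp
  show ?thesis by (rule that[OF 3 2 1])
qed

text \<open>Time and direction of the next strict change can be read off the common values, and
  \<open>zigzag_next_change\<close> identifies the direction with the parity.\<close>

lemma zigzag_floor_parity:
  assumes "\<theta> \<in> phases n l" "\<theta>' \<in> phases n l" "n > 0" "l > 0" "alternating l v" "alternating l v'"
    and eq: "\<And>i. zigzag v (\<theta> i) = zigzag v' (\<theta>' i)"
  shows "even \<lfloor>\<theta> i\<rfloor> \<longleftrightarrow> even \<lfloor>\<theta>' i\<rfloor>"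
proof -
  obtain j where j: "i \<le> j" "\<And>m. i \<le> m \<Longrightarrow> m \<le> j \<Longrightarrow> zigzag v (\<theta> m) = zigzag v (\<theta> i)"
    "if even \<lfloor>\<theta> i\<rfloor> then zigzag v (\<theta> j) < zigzag v (\<theta> (j + 1))
         else zigzag v (\<theta> (j + 1)) < zigzag v (\<theta> j)"
    using zigzag_next_change[OF assms(1,3,4,5), where i=i] by blast
  obtain j' where j': "i \<le> j'" "\<And>m. i \<le> m \<Longrightarrow> m \<le> j' \<Longrightarrow> zigzag v' (\<theta>' m) = zigzag v' (\<theta>' i)"
    "if even \<lfloor>\<theta>' i\<rfloor> then zigzag v' (\<theta>' j') < zigzag v' (\<theta>' (j' + 1))
         else zigzag v' (\<theta>' (j' + 1)) < zigzag v' (\<theta>' j')"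
    using zigzag_next_change[OF assms(2,3,4,6), where i=i] by blast
  have "j = j'"
  proof (rule linorder_cases[of j j'])
    assume "j < j'"
    then show ?thesis using j'(2)[of "j + 1"] j'(2)[of j] j(1,3) eq by (auto split: if_splits)
  next
    assume "j' < j"
    then show ?thesis using j(2)[of "j' + 1"] j(2)[of j'] j'(1,3) eq by (auto split: if_splits)
  qed
  then show ?thesis using j(3) j'(3) eq by (auto split: if_splits)
qed

text \<open>The direction of the next change of the values after time \<open>i\<close> is the parity of
  \<open>\<lfloor>\<theta> i\<rfloor>\<close>, so the values determine all these floors as soon as they determine one.\<close>

lemma zigzag_rigid:
  assumes \<theta>: "\<theta> \<in> phases n l" and \<theta>': "\<theta>' \<in> phases n l" and nl: "n > 0" "l > 0"
    and v: "alternating l v" and v': "alternating l v'"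
    and eq: "\<And>i. zigzag v (\<theta> i) = zigzag v' (\<theta>' i)"
  obtains m where "even m" "\<And>i. \<theta>' i = \<theta> i + of_int m" "\<And>k. v' (k + m) = v k"
proof -
  define m where "m = \<lfloor>\<theta>' 0\<rfloor> - \<lfloor>\<theta> 0\<rfloor>"
  note par = zigzag_floor_parity[OF \<theta> \<theta>' nl v v' eq]
  have m: "even m" using par[of 0] unfolding m_def by auto
  have fl: "\<lfloor>\<theta>' i\<rfloor> = \<lfloor>\<theta> i\<rfloor> + m" for i
  proof (induction i rule: int_induct[where k=0])
    case base show ?case by (simp add: m_def)
  next
    case (step1 i)
    then show ?case
      using phases_floor_step[OF \<theta>, of i] phases_floor_step[OF \<theta>', of i] par[of "i + 1"] m by presburger
  next
    case (step2 i)
    then show ?case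
      using phases_floor_step[OF \<theta>, of "i - 1"] phases_floor_step[OF \<theta>', of "i - 1"] par[of "i - 1"] m
      by (simp; presburger)
  qed
  \<comment> \<open>Since the floors differ by \<open>m\<close> throughout, \<open>\<theta>\<close>
    reaches \<open>k\<close> at the very index where \<open>\<theta>'\<close> reaches
    \<open>k + m\<close>. Both phases are integral there, so the common value is \<open>v k\<close>
    and also \<open>v' (k + m)\<close>.\<close>
  have vv: "v' (k + m) = v k" for k
  proof -
    obtain a where a: "\<theta> a = of_int k" "\<And>i. k \<le> \<lfloor>\<theta> i\<rfloor> \<longleftrightarrow> a \<le> i"
      using phases_first_hit[OF \<theta> nl(2)] by metis
    obtain b where b: "\<theta>' b = of_int (k + m)" "\<And>i. k + m \<le> \<lfloor>\<theta>' i\<rfloor> \<longleftrightarrow> b \<le> i"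
      using phases_first_hit[OF \<theta>' nl(2)] by metis
    have "a \<le> i \<longleftrightarrow> b \<le> i" for i using a(2)[of i] b(2)[of i] fl[of i] by simp
    then have "a = b" by (meson order_antisym order_refl)
    then show ?thesis using eq[of a] a(1) b(1) by (metis zigzag_of_int)
  qed
  have "\<theta>' i = \<theta> i + of_int m" for i
  proof -
    have eqi: "zigzag v (\<theta>' i - of_int m) = zigzag v (\<theta> i)"
      using eq[of i] zigzag_shift[of v' m "\<theta>' i - of_int m"] vv by simp
    have seg: "of_int \<lfloor>\<theta> i\<rfloor> \<le> \<theta>' i - of_int m" "\<theta>' i - of_int m \<le> of_int \<lfloor>\<theta> i\<rfloor> + 1"
      "of_int \<lfloor>\<theta> i\<rfloor> \<le> \<theta> i" "\<theta> i \<le> of_int \<lfloor>\<theta> i\<rfloor> + 1"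
      using fl[of i] by linarith+
    have "\<theta>' i - of_int m = \<theta> i" by (rule zigzag_segment_inj[OF v seg eqi])
    then show ?thesis by simp
  qed
  then show ?thesis using that m vv by blast
qed

section \<open>Inserting the integers into a monotone sequence\<close>

definition merges :: "(int \<Rightarrow> real) \<Rightarrow> (int \<Rightarrow> real) \<Rightarrow> bool" where
  "merges x \<theta> \<longleftrightarrow> (\<forall>i t. \<theta> i \<le> t \<longleftrightarrow> x (i - \<lfloor>t\<rfloor>) \<le> t)"

lemma mergesD: "merges x \<theta> \<Longrightarrow> \<theta> i \<le> t \<longleftrightarrow> x (i - \<lfloor>t\<rfloor>) \<le> t"
  by (simp add: merges_def)

lemma mergesD': "merges x \<theta> \<Longrightarrow> x j \<le> t \<longleftrightarrow> \<theta> (j + \<lfloor>t\<rfloor>) \<le> t"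
  by (simp add: merges_def)

lemma real_eq_by_upper_bounds: "(\<And>t::real. a \<le> t \<longleftrightarrow> b \<le> t) \<Longrightarrow> a = b"
  by (meson order_antisym order_refl)

lemma merges_unique: "merges x \<theta> \<Longrightarrow> merges x \<theta>' \<Longrightarrow> \<theta> = \<theta>'"
  by (rule ext, rule real_eq_by_upper_bounds) (simp add: mergesD[of x])

lemma merges_inj: "merges x \<theta> \<Longrightarrow> merges x' \<theta> \<Longrightarrow> x = x'"
  by (rule ext, rule real_eq_by_upper_bounds) (simp add: mergesD'[of _ \<theta>])

text \<open>Adding \<open>m\<close> to all values also renumbers the inserted integers by
  \<open>m\<close>, and the index shift of \<open>x\<close> compensates for this. A shift of phases
  therefore rotates the indices of \<open>x\<close>.\<close>

lemma merges_shift: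
  assumes "merges x \<theta>"
  shows "merges (\<lambda>j. x (j + m) + of_int m) (\<lambda>i. \<theta> i + of_int m)"
  unfolding merges_def
proof (intro allI)
  fix i t
  have "\<theta> i + of_int m \<le> t \<longleftrightarrow> \<theta> i \<le> t - of_int m" by linarith
  also have "\<dots> \<longleftrightarrow> x (i - \<lfloor>t - of_int m\<rfloor>) \<le> t - of_int m" by (rule mergesD[OF assms])
  finally show "\<theta> i + of_int m \<le> t \<longleftrightarrow> x (i - \<lfloor>t\<rfloor> + m) + of_int m \<le> t"
    by (simp add: algebra_simps)
qed

lemma merges_phases:
  assumes m: "merges x \<theta>" and x: "x \<in> quasi_periodic d l"
  shows "\<theta> \<in> phases (d + l) l"
proof -
  have 1: "\<theta> i \<le> \<theta> (i + 1)" for i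
  proof -
    have "x (i + 1 - \<lfloor>\<theta> (i + 1)\<rfloor>) \<le> \<theta> (i + 1)" using mergesD[OF m] by blast
    then have "x (i - \<lfloor>\<theta> (i + 1)\<rfloor>) \<le> \<theta> (i + 1)"
      using quasi_periodicD(1)[OF x, of "i - \<lfloor>\<theta> (i + 1)\<rfloor>" "i + 1 - \<lfloor>\<theta> (i + 1)\<rfloor>"] by simp
    then show ?thesis using mergesD[OF m] by blast
  qed
  have 2: "\<theta> (i + (d + l)) = \<theta> i + of_int l" for i
  proof (rule real_eq_by_upper_bounds)
    fix t
    have "\<theta> (i + (d + l)) \<le> t \<longleftrightarrow> x ((i - \<lfloor>t - of_int l\<rfloor>) + d) \<le> t"
      unfolding mergesD[OF m] by (simp add: algebra_simps)
    also have "\<dots> \<longleftrightarrow> x (i - \<lfloor>t - of_int l\<rfloor>) \<le> t - of_int l"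
      unfolding quasi_periodicD(2)[OF x] by linarith
    also have "\<dots> \<longleftrightarrow> \<theta> i + of_int l \<le> t"
      using mergesD[OF m, of i "t - of_int l"] by linarith
    finally show "\<theta> (i + (d + l)) \<le> t \<longleftrightarrow> \<theta> i + of_int l \<le> t" .
  qed
  have 3: "\<theta> (i + 1) \<le> of_int \<lfloor>\<theta> i\<rfloor> + 1" for i
  proof -
    have "x (i - \<lfloor>\<theta> i\<rfloor>) \<le> \<theta> i" using mergesD[OF m] by blast
    then have "x (i + 1 - \<lfloor>of_int \<lfloor>\<theta> i\<rfloor> + 1::real\<rfloor>) \<le> of_int \<lfloor>\<theta> i\<rfloor> + 1" by (simp; linarith)
    then show ?thesis using mergesD[OF m] by blast
  qed
  show ?thesis using 1 2 3 by (simp add: phases_def quasi_periodic_def)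
qed

lemma merges_quasi_periodic:
  assumes m: "merges x \<theta>" and \<theta>: "\<theta> \<in> phases (d + l) l"
  shows "x \<in> quasi_periodic d l"
proof -
  note qp = phases_quasi_periodic[OF \<theta>]
  have 1: "x j \<le> x (j + 1)" for j
  proof -
    have "\<theta> (j + 1 + \<lfloor>x (j + 1)\<rfloor>) \<le> x (j + 1)" using mergesD'[OF m] by blast
    then have "\<theta> (j + \<lfloor>x (j + 1)\<rfloor>) \<le> x (j + 1)"
      using quasi_periodicD(1)[OF qp, of "j + \<lfloor>x (j + 1)\<rfloor>" "j + 1 + \<lfloor>x (j + 1)\<rfloor>"] by simp
    then show ?thesis using mergesD'[OF m] by blast
  qed
  have 2: "x (j + d) = x j + of_int l" for j
  proof (rule real_eq_by_upper_bounds)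
    fix t
    have "x (j + d) \<le> t \<longleftrightarrow> \<theta> ((j + \<lfloor>t - of_int l\<rfloor>) + (d + l)) \<le> t"
      unfolding mergesD'[OF m] by (simp add: algebra_simps)
    also have "\<dots> \<longleftrightarrow> \<theta> (j + \<lfloor>t - of_int l\<rfloor>) \<le> t - of_int l"
      unfolding quasi_periodicD(2)[OF qp] by linarith
    also have "\<dots> \<longleftrightarrow> x j + of_int l \<le> t"
      using mergesD'[OF m, of j "t - of_int l"] by linarith
    finally show "x (j + d) \<le> t \<longleftrightarrow> x j + of_int l \<le> t" .
  qed
  show ?thesis using 1 2 by (simp add: quasi_periodic_def)
qed

text \<open>As \<open>k\<close> grows, the candidate \<open>x (i - k)\<close> falls while the window
  from \<open>k\<close> to \<open>k + 1\<close> rises. Let \<open>c\<close> be the first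
  \<open>k\<close> with the candidate below the upper end of its window: the merged value is that
  candidate, or the inserted integer \<open>c\<close> if the candidate lies below
  \<open>c\<close>.\<close>

lemma merges_exists:
  assumes x: "x \<in> quasi_periodic d l" and "d > 0" "l > 0"
  shows "\<exists>\<theta>. merges x \<theta>"
proof -
  have "\<exists>y. \<forall>t. y \<le> t \<longleftrightarrow> x (i - \<lfloor>t\<rfloor>) \<le> t" for i
  proof -
    have anti: "x (i - k') \<le> x (i - k)" if "k \<le> k'" for k k'
      using quasi_periodicD(1)[OF x] that by simp
    have "x i < of_int \<bar>\<lfloor>x i\<rfloor>\<bar> + 1" by linarith
    then have a: "x (i - \<bar>\<lfloor>x i\<rfloor>\<bar>) < of_int \<bar>\<lfloor>x i\<rfloor>\<bar> + 1"
      using anti[of 0 "\<bar>\<lfloor>x i\<rfloor>\<bar>"] by simp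
    define b where "b = - \<bar>\<lfloor>x i\<rfloor>\<bar> - 1"
    have "of_int b + 1 \<le> x i" unfolding b_def by (simp; linarith)
    then have b: "\<not> x (i - b) < of_int b + 1" using anti[of b 0] unfolding b_def by simp linarith
    have up: "x (i - (k + 1)) < of_int (k + 1) + 1" if "x (i - k) < of_int k + 1" for k
      using anti[of k "k + 1"] that by simp
    obtain c where c: "\<And>k. x (i - k) < of_int k + 1 \<longleftrightarrow> c \<le> k"
      using int_threshold[of "\<lambda>k. x (i - k) < of_int k + 1", OF a b up] by blast
    have "max (of_int c) (x (i - c)) \<le> t \<longleftrightarrow> x (i - \<lfloor>t\<rfloor>) \<le> t" for t
    proof
      assume "max (of_int c) (x (i - c)) \<le> t"
      then have "c \<le> \<lfloor>t\<rfloor>" "x (i - c) \<le> t" by (auto simp: le_floor_iff)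
      then show "x (i - \<lfloor>t\<rfloor>) \<le> t" using anti order_trans by blast
    next
      assume t: "x (i - \<lfloor>t\<rfloor>) \<le> t"
      then have "x (i - \<lfloor>t\<rfloor>) < of_int \<lfloor>t\<rfloor> + 1" by linarith
      then have ct: "c \<le> \<lfloor>t\<rfloor>" using c by blast
      have "x (i - c) < of_int c + 1" using c by blast
      then have "x (i - c) \<le> t" using ct t by (cases "c = \<lfloor>t\<rfloor>") (auto, linarith)
      then show "max (of_int c) (x (i - c)) \<le> t" using ct by (simp add: le_floor_iff)
    qed
    then show ?thesis by blast
  qed
  then have "\<exists>\<theta>. \<forall>i t. \<theta> i \<le> t \<longleftrightarrow> x (i - \<lfloor>t\<rfloor>) \<le> t" by (intro choice allI)
  then show ?thesis by (simp add: merges_def)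
qed

text \<open>The entry \<open>x j\<close> is \<open>\<theta> (j + c)\<close>, where \<open>c\<close>
  is the floor of that value. Because \<open>\<theta>\<close> gains only \<open>l\<close> over
  \<open>d + l\<close> indices, \<open>\<theta> (j + k) - k\<close> drops below 1 eventually, and
  \<open>c\<close> is the first such \<open>k\<close>.\<close>

lemma merges_surj:
  assumes \<theta>: "\<theta> \<in> phases (d + l) l" and "d > 0" "l > 0"
  shows "\<exists>x. merges x \<theta>"
proof -
  note qp = phases_quasi_periodic[OF \<theta>]
  have "\<exists>y. \<forall>t. y \<le> t \<longleftrightarrow> \<theta> (j + \<lfloor>t\<rfloor>) \<le> t" for j
  proof -
    have per: "\<theta> (j + q * (d + l)) = \<theta> j + of_int (q * l)" for q
      by (rule quasi_periodicD(3)[OF qp])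
    obtain q where q: "\<theta> j \<le> of_int (q * d)" using linear_unbounded[OF \<open>d > 0\<close>] .
    then have a: "\<theta> (j + q * (d + l)) < of_int (q * (d + l)) + 1"
      unfolding per by (simp add: algebra_simps)
    obtain r where r: "1 - \<theta> j \<le> of_int (r * d)" using linear_unbounded[OF \<open>d > 0\<close>] .
    then have b: "\<not> \<theta> (j + (- r) * (d + l)) < of_int ((- r) * (d + l)) + 1"
      unfolding per by (simp add: algebra_simps)
    have up: "\<theta> (j + (k + 1)) < of_int (k + 1) + 1" if "\<theta> (j + k) < of_int k + 1" for k
      using phases_step(2)[OF \<theta>, of "j + k"] that by (simp add: add.assoc; linarith)
    obtain c where c: "\<And>k. \<theta> (j + k) < of_int k + 1 \<longleftrightarrow> c \<le> k"
      using int_threshold[of "\<lambda>k. \<theta> (j + k) < of_int k + 1", OF a b up] by blast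
    have "\<not> \<theta> (j + (c - 1)) < of_int (c - 1) + 1" using c[of "c - 1"] by simp
    then have ge: "of_int c \<le> \<theta> (j + c)"
      using quasi_periodicD(1)[OF qp, of "j + (c - 1)" "j + c"] by simp
    have "\<theta> (j + c) \<le> t \<longleftrightarrow> \<theta> (j + \<lfloor>t\<rfloor>) \<le> t" for t
    proof
      assume t: "\<theta> (j + c) \<le> t"
      then have ct: "c \<le> \<lfloor>t\<rfloor>" using ge by linarith
      show "\<theta> (j + \<lfloor>t\<rfloor>) \<le> t"
      proof (cases "c = \<lfloor>t\<rfloor>")
        case False
        then have "\<theta> (j + (\<lfloor>t\<rfloor> - 1)) < of_int (\<lfloor>t\<rfloor> - 1) + 1" using ct c[of "\<lfloor>t\<rfloor> - 1"] by simp
        then have "\<lfloor>\<theta> (j + (\<lfloor>t\<rfloor> - 1))\<rfloor> < \<lfloor>t\<rfloor>" by (simp add: floor_less_iff)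
        then show ?thesis using phases_step(2)[OF \<theta>, of "j + (\<lfloor>t\<rfloor> - 1)"] by simp linarith
      qed (use t in simp)
    next
      assume t: "\<theta> (j + \<lfloor>t\<rfloor>) \<le> t"
      then have "\<theta> (j + \<lfloor>t\<rfloor>) < of_int \<lfloor>t\<rfloor> + 1" by linarith
      then have "c \<le> \<lfloor>t\<rfloor>" using c by blast
      then show "\<theta> (j + c) \<le> t" using t quasi_periodicD(1)[OF qp, of "j + c" "j + \<lfloor>t\<rfloor>"] by simp
    qed
    then show ?thesis by blast
  qed
  then have "\<exists>x. \<forall>j t. x j \<le> t \<longleftrightarrow> \<theta> (j + \<lfloor>t\<rfloor>) \<le> t" by (intro choice allI)
  then obtain x where x: "\<And>j t. x j \<le> t \<longleftrightarrow> \<theta> (j + \<lfloor>t\<rfloor>) \<le> t" by blast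
  have "merges x \<theta>" unfolding merges_def
  proof (intro allI)
    fix i t
    show "\<theta> i \<le> t \<longleftrightarrow> x (i - \<lfloor>t\<rfloor>) \<le> t" using x[of "i - \<lfloor>t\<rfloor>" t] by simp
  qed
  then show ?thesis by blast
qed

definition merge :: "(int \<Rightarrow> real) \<Rightarrow> int \<Rightarrow> real" where
  "merge x = (SOME \<theta>. merges x \<theta>)"

lemma merges_merge:
  assumes "x \<in> quasi_periodic d l" "d > 0" "l > 0"
  shows "merges x (merge x)"
  unfolding merge_def using merges_exists[OF assms] by (rule someI_ex)

text \<open>By \<open>mergesD\<close>, a strict lower bound on the merged value is a strict lower
  bound on one coordinate of \<open>x\<close>, an open condition. For upper bounds the corresponding
  inequality is weak and has to be made strict first.\<close>

lemma continuous_on_merge: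
  assumes "d > 0" "l > 0"
  shows "continuous_on (quasi_periodic d l) (\<lambda>x. merge x i)"
  unfolding continuous_on_def
proof
  fix x assume x: "x \<in> quasi_periodic d l"
  have coord: "((\<lambda>y. y j) \<longlongrightarrow> x j) (at x within quasi_periodic d l)" for j :: int
    using continuous_on_subset[OF continuous_on_product_coordinates[of j] subset_UNIV, of "quasi_periodic d l"]
      x by (simp add: continuous_on_def)
  have ev: "\<forall>\<^sub>F y in at x within quasi_periodic d l. y \<in> quasi_periodic d l"
    by (simp add: eventually_at_filter)
  note mx = mergesD[OF merges_merge[OF x assms]]
  show "((\<lambda>y. merge y i) \<longlongrightarrow> merge x i) (at x within quasi_periodic d l)"
  proof (rule order_tendstoI)
    fix a assume "a < merge x i"
    then have "a < x (i - \<lfloor>a\<rfloor>)" using mx[of i a] by linarith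
    then have "\<forall>\<^sub>F y in at x within quasi_periodic d l. a < y (i - \<lfloor>a\<rfloor>)"
      by (rule order_tendstoD[OF coord])
    with ev show "\<forall>\<^sub>F y in at x within quasi_periodic d l. a < merge y i"
      by eventually_elim (use mergesD[OF merges_merge[OF _ assms], of _ i a] in fastforce)
  next
    fix b assume b: "merge x i < b"
    \<comment> \<open>\<open>b'\<close> lies above \<open>merge x i\<close>, below \<open>b\<close>,
      and has the floor of \<open>merge x i\<close>. So the coordinate that matters at level
      \<open>b'\<close> is at most \<open>merge x i\<close>, hence strictly below \<open>b'\<close>,
      and stays so nearby.\<close>
    define b' where "b' = (merge x i + min b (of_int \<lfloor>merge x i\<rfloor> + 1)) / 2"
    have b': "merge x i < b'" "b' < b" "\<lfloor>b'\<rfloor> = \<lfloor>merge x i\<rfloor>"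
      using b unfolding b'_def by (simp_all add: floor_eq_iff min_def) linarith+
    have "x (i - \<lfloor>b'\<rfloor>) \<le> merge x i" using mx[of i "merge x i"] b'(3) by simp
    then have "x (i - \<lfloor>b'\<rfloor>) < b'" using b'(1) by linarith
    then have "\<forall>\<^sub>F y in at x within quasi_periodic d l. y (i - \<lfloor>b'\<rfloor>) < b'"
      by (rule order_tendstoD[OF coord])
    with ev show "\<forall>\<^sub>F y in at x within quasi_periodic d l. merge y i < b"
      by eventually_elim (use mergesD[OF merges_merge[OF _ assms], of _ i b'] b'(2) in fastforce)
  qed
qed

section \<open>Invertible path from the identity to the double shift\<close>

lemma periodic_sum_shift:
  fixes f :: "int \<Rightarrow> 'a::ab_group_add"
  assumes per: "\<And>j. f (j + d) = f j" and "d > 0"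
  shows "(\<Sum>j\<in>{0..<d}. f (j + m)) = (\<Sum>j\<in>{0..<d}. f j)"
proof -
  have one: "(\<Sum>j\<in>{0..<d}. g (j + 1)) = (\<Sum>j\<in>{0..<d}. g j)"
    if "\<And>j. g (j + d) = g j" for g :: "int \<Rightarrow> 'a"
  proof -
    have "(\<Sum>j\<in>{0..<d}. g (j + 1)) = (\<Sum>j\<in>{1..<d + 1}. g j)"
      by (rule sum.reindex_bij_witness[of _ "\<lambda>j. j - 1" "\<lambda>j. j + 1"]) auto
    also have "{1..<d + 1} = insert d {1..<d}" using \<open>d > 0\<close> by auto
    also have "sum g (insert d {1..<d}) = sum g (insert 0 {1..<d})" using that[of 0] by simp
    also have "insert 0 {1..<d} = {0..<d}" using \<open>d > 0\<close> by auto
    finally show ?thesis .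
  qed
  show ?thesis
  proof (induction m rule: int_induct[where k=0])
    case (step1 m)
    have "(\<Sum>j\<in>{0..<d}. f (j + 1 + m)) = (\<Sum>j\<in>{0..<d}. f (j + m))"
      by (rule one[of "\<lambda>j. f (j + m)"]) (metis per add.assoc add.commute)
    then show ?case using step1 by (simp add: ac_simps)
  next
    case (step2 m)
    have "(\<Sum>j\<in>{0..<d}. f (j + 1 + (m - 1))) = (\<Sum>j\<in>{0..<d}. f (j + (m - 1)))"
      by (rule one[of "\<lambda>j. f (j + (m - 1))"]) (metis per add.assoc add.commute)
    then show ?case using step2 by simp
  qed simp
qed

lemma periodic_mod:
  fixes f :: "int \<Rightarrow> 'a::ring_1"
  assumes "\<And>j. f (j + d) = f j"
  shows "f (j mod d) = f j"
  using int_period_mult[of f d 0 "j mod d" "j div d"] assms by (simp add: mult.commute)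

lemma vector_space_fun: "vector_space (\<lambda>(c::real) (f::'a \<Rightarrow> real) i. c * f i)"
  by unfold_locales (auto simp: fun_eq_iff algebra_simps)

text \<open>The space of all sequences is infinite-dimensional, so the dimension count takes place
  in a finitely spanned invariant subspace: a vector outside the span of the image of a basis would
  give too many independent vectors.\<close>

lemma (in vector_space) linear_injective_imp_surjective_on_span:
  assumes f: "Vector_Spaces.linear scale scale f" and S: "finite S"
    and maps: "f ` span S \<subseteq> span S" and inj: "inj_on f (span S)"
  shows "f ` span S = span S"
proof -
  interpret vector_space_pair scale scale by unfold_locales
  obtain B where B: "B \<subseteq> span S" "independent B" "span S \<subseteq> span B"
    by (rule basis_exists)
  have spB: "span B = span S" using span_minimal[OF B(1) subspace_span] B(3) by (rule subset_antisym)
  have finB: "finite B" using independent_span_bound[OF S B(2)] B(1) by blast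
  have ind: "independent (f ` B)"
    using linear_independent_injective_image[OF f B(2)] inj spB by simp
  have card: "card (f ` B) = card B"
    using inj B(1) by (meson card_image inj_on_subset)
  have "span S \<subseteq> span (f ` B)"
  proof
    fix y assume y: "y \<in> span S"
    show "y \<in> span (f ` B)"
    proof (rule ccontr)
      assume n: "y \<notin> span (f ` B)"
      then have "independent (insert y (f ` B))" using ind by (rule independent_insertI)
      moreover have "insert y (f ` B) \<subseteq> span B" using y maps B(1) spB by auto
      ultimately have "card (insert y (f ` B)) \<le> card B" using independent_span_bound[OF finB] by blast
      moreover have "y \<notin> f ` B" using n span_base by blast
      ultimately show False using card finB by simp
    qed
  qed
  then show ?thesis using maps linear_span_image[OF f, of B] spB by simp
qed

lemma sum_fun_apply: "(\<Sum>k\<in>A. f k) j = (\<Sum>k\<in>A. (f k j :: real))"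
  by (induction A rule: infinite_finite_induct) auto

section \<open>The circulant operators\<close>

definition zero_mean :: "int \<Rightarrow> (int \<Rightarrow> real) set" where
  "zero_mean d = {\<eta>. (\<forall>j. \<eta> (j + d) = \<eta> j) \<and> (\<Sum>j\<in>{0..<d}. \<eta> j) = 0}"

lemma zero_meanD:
  assumes "\<eta> \<in> zero_mean d"
  shows "\<eta> (j + d) = \<eta> j" "(\<Sum>j\<in>{0..<d}. \<eta> j) = 0"
    "d > 0 \<Longrightarrow> (\<Sum>j\<in>{0..<d}. \<eta> (j + m)) = 0"
  using assms periodic_sum_shift[of \<eta> d m] by (auto simp: zero_mean_def)

definition twist :: "int \<Rightarrow> real \<Rightarrow> (int \<Rightarrow> real) \<Rightarrow> int \<Rightarrow> real" where
  "twist d s \<eta> j = (1 - s) * \<eta> j - 4 * cos (pi / (2 * of_int d)) * s * (1 - s) * \<eta> (j + 1) + s * \<eta> (j + 2)"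

text \<open>Used twice: it makes the factor by which \<open>twist\<close> multiplies sums nonzero,
  and it makes the first-order recursion in \<open>twist_inj\<close> contracting. Both
  \<open>4 * s * (1 - s) \<le> 1\<close> and the cosine being below 1 enter.\<close>

lemma twist_coefficient_bound:
  assumes "d > 0" "0 \<le> s" "s \<le> 1"
  shows "\<bar>4 * cos (pi / (2 * real_of_int d)) * s * (1 - s)\<bar> < 1"
proof -
  have a: "0 < pi / (2 * real_of_int d)" "pi / (2 * real_of_int d) \<le> pi / 2"
    using assms(1) by (auto simp: field_simps)
  have c0: "0 \<le> cos (pi / (2 * real_of_int d))" using a by (intro cos_ge_zero) auto
  have c1: "cos (pi / (2 * real_of_int d)) < 1"
    using cos_monotone_0_pi[of 0 "pi / (2 * real_of_int d)"] a pi_gt_zero by simp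
  have s: "0 \<le> 4 * s * (1 - s)" "4 * s * (1 - s) \<le> 1"
    using assms(2,3) zero_le_square[of "2 * s - 1"] by (auto simp: algebra_simps mult_left_le)
  have "cos (pi / (2 * real_of_int d)) * (4 * s * (1 - s)) \<le> cos (pi / (2 * real_of_int d)) * 1"
    by (intro mult_left_mono s c0)
  moreover have "0 \<le> cos (pi / (2 * real_of_int d)) * (4 * s * (1 - s))" by (intro mult_nonneg_nonneg s c0)
  ultimately show ?thesis using c1 by (simp add: algebra_simps)
qed

lemma twist_periodic:
  assumes "\<And>j. \<eta> (j + d) = \<eta> j"
  shows "twist d s \<eta> (j + d) = twist d s \<eta> j"
  using assms[of j] assms[of "j + 1"] assms[of "j + 2"] by (simp add: twist_def ac_simps)

lemma twist_sum:
  assumes per: "\<And>j. \<eta> (j + d) = \<eta> j" and "d > 0"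
  shows "(\<Sum>j\<in>{0..<d}. twist d s \<eta> j) =
    (1 - 4 * cos (pi / (2 * of_int d)) * s * (1 - s)) * (\<Sum>j\<in>{0..<d}. \<eta> j)"
  using periodic_sum_shift[of \<eta> d 1, OF per \<open>d > 0\<close>] periodic_sum_shift[of \<eta> d 2, OF per \<open>d > 0\<close>]
  by (simp add: twist_def sum.distrib sum_subtractf left_diff_distrib flip: sum_distrib_left)

lemma twist_zero_mean: "\<eta> \<in> zero_mean d \<Longrightarrow> d > 0 \<Longrightarrow> twist d s \<eta> \<in> zero_mean d"
  using twist_periodic[of \<eta> d s] twist_sum[of \<eta> d s] by (auto simp: zero_mean_def)

text \<open>On \<open>d\<close>-periodic sequences \<open>twist d s\<close> is a path of invertible circulant operators from the
  identity to the shift by 2. Its symbol has zeros on the unit circle only for \<open>s = 1/2\<close>, and the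
  middle coefficient is chosen such that these are not \<open>d\<close>-th roots of unity.\<close>

lemma twist_inj:
  assumes "d > 0" "0 \<le> s" "s \<le> 1" and per: "\<And>j. \<eta> (j + d) = \<eta> j"
    and zero: "\<And>j. twist d s \<eta> j = 0"
  shows "\<eta> j = 0"
proof (cases "s = 1 / 2")
  case False
  define \<beta> where "\<beta> = - (4 * cos (pi / (2 * real_of_int d)) * s * (1 - s))"
  have rec: "(1 - s) * \<eta> j + \<beta> * \<eta> (j + 1) + s * \<eta> (j + 2) = 0" for j
    using zero[of j] by (simp add: twist_def \<beta>_def)
  define C where "C m = (\<Sum>j\<in>{0..<d}. \<eta> j * \<eta> (j + m))" for m
  have shift: "(\<Sum>j\<in>{0..<d}. \<eta> (j + a) * \<eta> (j + b)) = C (b - a)" for a b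
  proof -
    have "\<eta> (j + d) * \<eta> (j + d + (b - a)) = \<eta> j * \<eta> (j + (b - a))" for j
      using per[of j] per[of "j + (b - a)"] by (simp add: ac_simps)
    from periodic_sum_shift[of "\<lambda>j. \<eta> j * \<eta> (j + (b - a))" d a, OF this \<open>d > 0\<close>]
    show ?thesis by (simp add: C_def)
  qed
  have "(\<Sum>j\<in>{0..<d}. \<eta> j * ((1 - s) * \<eta> j + \<beta> * \<eta> (j + 1) + s * \<eta> (j + 2)))
      = (1 - s) * C 0 + \<beta> * C 1 + s * C 2"
    by (simp add: C_def sum_distrib_left sum.distrib sum_subtractf algebra_simps)
  then have e1: "(1 - s) * C 0 + \<beta> * C 1 + s * C 2 = 0" by (simp add: rec)
  have "(\<Sum>j\<in>{0..<d}. \<eta> (j + 2) * ((1 - s) * \<eta> j + \<beta> * \<eta> (j + 1) + s * \<eta> (j + 2)))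
      = (1 - s) * (\<Sum>j\<in>{0..<d}. \<eta> (j + 0) * \<eta> (j + 2)) + \<beta> * (\<Sum>j\<in>{0..<d}. \<eta> (j + 1) * \<eta> (j + 2))
        + s * (\<Sum>j\<in>{0..<d}. \<eta> (j + 2) * \<eta> (j + 2))"
    by (simp add: sum_distrib_left sum.distrib sum_subtractf algebra_simps)
  then have e2: "(1 - s) * C 2 + \<beta> * C 1 + s * C 0 = 0" unfolding rec shift by simp
  have "(1 - 2 * s) * (C 0 - C 2) = 0" using e1 e2 by (simp add: algebra_simps)
  then have C02: "C 0 = C 2" using False by simp
  have "(\<Sum>j\<in>{0..<d}. (\<eta> j - \<eta> (j + 2))\<^sup>2) = (\<Sum>j\<in>{0..<d}. \<eta> (j + 0) * \<eta> (j + 0))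
      + (\<Sum>j\<in>{0..<d}. \<eta> (j + 2) * \<eta> (j + 2)) - 2 * (\<Sum>j\<in>{0..<d}. \<eta> (j + 0) * \<eta> (j + 2))"
    by (simp add: power2_eq_square sum_distrib_left sum.distrib sum_subtractf algebra_simps)
  then have "(\<Sum>j\<in>{0..<d}. (\<eta> j - \<eta> (j + 2))\<^sup>2) = C 0 + C 0 - 2 * C 2" unfolding shift by simp
  then have "(\<Sum>j\<in>{0..<d}. (\<eta> j - \<eta> (j + 2))\<^sup>2) = 0" using C02 by simp
  then have z: "\<forall>j\<in>{0..<d}. \<eta> j - \<eta> (j + 2) = 0" by (subst (asm) sum_nonneg_eq_0_iff) auto
  have two: "\<eta> (j + 2) = \<eta> j" for j
  proof -
    have "\<eta> (j + 2 + d) = \<eta> (j + 2)" for j using per[of "j + 2"] .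
    then have "\<eta> (j mod d + 2) = \<eta> (j + 2)"
      using periodic_mod[of "\<lambda>j. \<eta> (j + 2)" d j] by (simp add: ac_simps)
    moreover have "\<eta> (j mod d) - \<eta> (j mod d + 2) = 0" using bspec[OF z, of "j mod d"] \<open>d > 0\<close> by simp
    ultimately show ?thesis using periodic_mod[of \<eta> d j, OF per] by simp
  qed
  \<comment> \<open>For a sequence of period 2 the outer coefficients \<open>1 - s\<close> and
    \<open>s\<close> add up to 1, which leaves a first-order relation with ratio of absolute value
    below 1.\<close>
  have one: "\<eta> j = - \<beta> * \<eta> (j + 1)" for j
    using rec[of j] two[of j] by (simp add: algebra_simps)
  have "\<eta> j = \<beta> * \<beta> * \<eta> j" using one[of j] one[of "j + 1"] two[of j] by (simp add: algebra_simps)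
  then have "(1 - \<beta> * \<beta>) * \<eta> j = 0" by (simp add: algebra_simps)
  moreover have "\<beta> * \<beta> < 1"
    using twist_coefficient_bound[OF assms(1-3)] by (simp add: \<beta>_def abs_square_less_1 flip: power2_eq_square)
  ultimately show ?thesis by simp
next
  case True
  define \<phi> where "\<phi> = pi / (2 * real_of_int d)"
  have \<phi>: "0 < \<phi>" "\<phi> \<le> pi / 2" using assms(1) by (auto simp: \<phi>_def field_simps)
  have sin: "sin \<phi> > 0" using \<phi> pi_gt_zero by (intro sin_gt_zero) linarith+
  have rec: "\<eta> (j + 2) = 2 * cos \<phi> * \<eta> (j + 1) - \<eta> j" for j
    using zero[of j] True by (simp add: twist_def \<phi>_def)
  \<comment> \<open>At \<open>s = 1/2\<close> the characteristic roots are \<open>cis \<phi>\<close>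
    and \<open>cis (- \<phi>)\<close>. Splitting off the first root leaves the geometric sequence
    \<open>u\<close>; one period multiplies it by \<open>cis (- (pi / 2))\<close>, which is not 1,
    so periodicity forces \<open>u = 0\<close>. Its imaginary part is
    \<open>- sin \<phi> * \<eta> j\<close>.\<close>
  define u where "u j = complex_of_real (\<eta> (j + 1)) - cis \<phi> * complex_of_real (\<eta> j)" for j
  have step: "u (j + 1) = cis (- \<phi>) * u j" for j
  proof -
    have "sin \<phi> * sin \<phi> = 1 - cos \<phi> * cos \<phi>"
      using sin_cos_squared_add[of \<phi>] by (simp add: power2_eq_square)
    then have "(sin \<phi> * sin \<phi>) * \<eta> j = (1 - cos \<phi> * cos \<phi>) * \<eta> j" by simp
    then show ?thesis using rec[of j] by (simp add: u_def complex_eq_iff algebra_simps)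
  qed
  have "u (j + int k) = cis (- \<phi>) ^ k * u j" for k
  proof (induction k)
    case (Suc k)
    have "u (j + int (Suc k)) = u ((j + int k) + 1)" by (simp add: ac_simps)
    then show ?case using Suc by (simp add: step mult.assoc)
  qed simp
  from this[of "nat d"] have "u (j + d) = cis (- (pi / 2)) * u j"
    using \<open>d > 0\<close> by (simp add: Complex.DeMoivre \<phi>_def)
  moreover have "u (j + d) = u j" using per[of j] per[of "j + 1"] by (simp add: u_def ac_simps)
  ultimately have *: "u j = cis (- (pi / 2)) * u j" by metis
  have "Im (u j) = - Re (u j)" by (subst *) simp
  moreover have "Re (u j) = Im (u j)" by (subst *) simp
  ultimately have "Im (u j) = 0" by linarith
  then show ?thesis using sin by (simp add: u_def)
qed

text \<open>Injectivity gives surjectivity on the finite-dimensional space of all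
  \<open>d\<close>-periodic sequences. The preimage of a zero-mean sequence has zero mean because
  \<open>twist\<close> multiplies the sum over a period by a nonzero factor.\<close>

lemma twist_surj:
  assumes "d > 0" "0 \<le> s" "s \<le> 1" and \<zeta>: "\<zeta> \<in> zero_mean d"
  shows "\<exists>\<xi>\<in>zero_mean d. twist d s \<xi> = \<zeta>"
proof -
  interpret vs: vector_space "\<lambda>(c::real) (f::int \<Rightarrow> real) i. c * f i" by (rule vector_space_fun)
  define b where "b k = (\<lambda>j. if j mod d = k then 1 else 0::real)" for k
  have per: "\<eta> \<in> vs.span (b ` {0..<d}) \<longleftrightarrow> (\<forall>j. \<eta> (j + d) = \<eta> j)" for \<eta>
  proof
    assume "\<eta> \<in> vs.span (b ` {0..<d})"
    then show "\<forall>j. \<eta> (j + d) = \<eta> j"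
      by (induction rule: vs.span_induct_alt) (auto simp: b_def)
  next
    assume p: "\<forall>j. \<eta> (j + d) = \<eta> j"
    have "\<eta> = (\<Sum>k\<in>{0..<d}. (\<lambda>j. \<eta> k * b k j))"
    proof (rule ext)
      fix j
      have "(\<Sum>k\<in>{0..<d}. \<eta> k * b k j) = (\<Sum>k\<in>{0..<d}. if k = j mod d then \<eta> k else 0)"
        by (intro sum.cong) (auto simp: b_def)
      also have "\<dots> = \<eta> (j mod d)" using \<open>d > 0\<close> by simp
      also have "\<dots> = \<eta> j" using p periodic_mod[of \<eta> d j] by simp
      finally show "\<eta> j = (\<Sum>k\<in>{0..<d}. (\<lambda>j. \<eta> k * b k j)) j" by (simp only: sum_fun_apply)
    qed
    moreover have "\<dots> \<in> vs.span (b ` {0..<d})"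
      by (intro vs.span_sum vs.span_scale vs.span_base) auto
    ultimately show "\<eta> \<in> vs.span (b ` {0..<d})" by metis
  qed
  have lin: "Vector_Spaces.linear (\<lambda>c f i. c * f i) (\<lambda>c f i. c * f i) (twist d s)"
    by unfold_locales (auto simp: twist_def fun_eq_iff algebra_simps)
  have "inj_on (twist d s) (vs.span (b ` {0..<d}))"
  proof (rule inj_onI)
    fix x y assume xy: "x \<in> vs.span (b ` {0..<d})" "y \<in> vs.span (b ` {0..<d})" "twist d s x = twist d s y"
    have "twist d s (\<lambda>j. x j - y j) j = twist d s x j - twist d s y j" for j
      by (simp add: twist_def algebra_simps)
    then have "x j - y j = 0" for j
      using xy by (intro twist_inj[OF assms(1-3), of "\<lambda>j. x j - y j"]) (auto simp: per)
    then show "x = y" by auto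
  qed
  moreover have "twist d s ` vs.span (b ` {0..<d}) \<subseteq> vs.span (b ` {0..<d})"
    using twist_periodic by (auto simp: per)
  ultimately have "twist d s ` vs.span (b ` {0..<d}) = vs.span (b ` {0..<d})"
    by (intro vs.linear_injective_imp_surjective_on_span lin) auto
  moreover have "\<zeta> \<in> vs.span (b ` {0..<d})" using \<zeta> by (simp add: per zero_mean_def)
  ultimately obtain \<xi> where \<xi>': "\<xi> \<in> vs.span (b ` {0..<d})" "twist d s \<xi> = \<zeta>"
    by (metis imageE)
  then have \<xi>: "\<And>j. \<xi> (j + d) = \<xi> j" "twist d s \<xi> = \<zeta>" using per[of \<xi>] by blast+
  have "(1 - 4 * cos (pi / (2 * of_int d)) * s * (1 - s)) * (\<Sum>j\<in>{0..<d}. \<xi> j) = 0"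
    using twist_sum[of \<xi> d s, OF \<xi>(1) \<open>d > 0\<close>] \<xi>(2) \<zeta> by (simp add: zero_mean_def)
  then have "(\<Sum>j\<in>{0..<d}. \<xi> j) = 0" using twist_coefficient_bound[OF assms(1-3)] by auto
  then show ?thesis using \<xi> by (auto simp: zero_mean_def)
qed

section \<open>The slope simplex\<close>

text \<open>An asymmetric gauge on zero-mean sequences: its unit ball consists of those
  \<open>\<eta>\<close> for which \<open>j + \<eta> j\<close> is monotone. It is only positively
  homogeneous.\<close>

definition slope :: "int \<Rightarrow> (int \<Rightarrow> real) \<Rightarrow> real" where
  "slope d \<eta> = Max ((\<lambda>j. \<eta> j - \<eta> (j + 1)) ` {0..<d})"

lemma slope_le_iff:
  assumes "d > 0" and per: "\<And>j. \<eta> (j + d) = \<eta> j"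
  shows "slope d \<eta> \<le> c \<longleftrightarrow> (\<forall>j. \<eta> j - \<eta> (j + 1) \<le> c)"
proof -
  have "slope d \<eta> \<le> c \<longleftrightarrow> (\<forall>j\<in>{0..<d}. \<eta> j - \<eta> (j + 1) \<le> c)"
    unfolding slope_def using assms(1) by (subst Max_le_iff) auto
  also have "\<dots> \<longleftrightarrow> (\<forall>j. \<eta> j - \<eta> (j + 1) \<le> c)"
  proof (intro iffI allI)
    fix j assume *: "\<forall>j\<in>{0..<d}. \<eta> j - \<eta> (j + 1) \<le> c"
    have "\<eta> (j + d) - \<eta> (j + d + 1) = \<eta> j - \<eta> (j + 1)" for j
      using per[of j] per[of "j + 1"] by (simp add: ac_simps)
    from periodic_mod[of "\<lambda>j. \<eta> j - \<eta> (j + 1)" d j, OF this]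
    show "\<eta> j - \<eta> (j + 1) \<le> c" using bspec[OF *, of "j mod d"] assms(1) by simp
  qed simp
  finally show ?thesis .
qed

lemma slope_scale:
  assumes "d > 0" "c \<ge> 0"
  shows "slope d (\<lambda>j. c * \<eta> j) = c * slope d \<eta>"
proof -
  have "Max ((\<lambda>x. c * x) ` (\<lambda>j. \<eta> j - \<eta> (j + 1)) ` {0..<d}) = c * slope d \<eta>"
    unfolding slope_def using assms
    by (intro mono_Max_commute[symmetric]) (auto intro!: monoI mult_left_mono)
  then show ?thesis by (simp add: slope_def image_image right_diff_distrib)
qed

lemma slope_shift:
  assumes "d > 0" and per: "\<And>j. \<eta> (j + d) = \<eta> j"
  shows "slope d (\<lambda>j. \<eta> (j + m)) = slope d \<eta>"
proof (rule real_eq_by_upper_bounds)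
  fix t
  have per': "\<eta> (j + d + m) = \<eta> (j + m)" for j using per[of "j + m"] by (simp add: ac_simps)
  have "(\<forall>j. \<eta> (j + m) - \<eta> (j + 1 + m) \<le> t) \<longleftrightarrow> (\<forall>j. \<eta> j - \<eta> (j + 1) \<le> t)"
  proof (intro iffI allI)
    fix j assume *: "\<forall>j. \<eta> (j + m) - \<eta> (j + 1 + m) \<le> t"
    show "\<eta> j - \<eta> (j + 1) \<le> t" using spec[OF *, of "j - m"] by (simp add: algebra_simps)
  next
    fix j assume *: "\<forall>j. \<eta> j - \<eta> (j + 1) \<le> t"
    show "\<eta> (j + m) - \<eta> (j + 1 + m) \<le> t" using spec[OF *, of "j + m"] by (simp add: algebra_simps)
  qed
  then show "slope d (\<lambda>j. \<eta> (j + m)) \<le> t \<longleftrightarrow> slope d \<eta> \<le> t"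
    using slope_le_iff[of d "\<lambda>j. \<eta> (j + m)" t, OF \<open>d > 0\<close> per']
      slope_le_iff[of d \<eta> t, OF \<open>d > 0\<close> per] by simp
qed

text \<open>A sequence descends by at most \<open>slope\<close> per step, so within one period it
  loses at most \<open>d * slope\<close>. Comparing \<open>\<eta> j\<close> with all entries of the
  period after it, respectively before it, and using that they sum to 0 bounds it from both
  sides.\<close>

lemma slope_bounds:
  assumes "d > 0" and \<eta>: "\<eta> \<in> zero_mean d"
  shows "0 \<le> slope d \<eta>" and "\<bar>\<eta> j\<bar> \<le> of_int d * slope d \<eta>"
proof -
  let ?\<mu> = "slope d \<eta>"
  have st: "\<eta> j \<le> \<eta> (j + 1) + ?\<mu>" for j
  proof -
    have "\<forall>j. \<eta> j - \<eta> (j + 1) \<le> ?\<mu>"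
      using slope_le_iff[of d \<eta> ?\<mu>, OF \<open>d > 0\<close>] zero_meanD(1)[OF \<eta>] by blast
    from spec[OF this, of j] show ?thesis by linarith
  qed
  have "(\<Sum>j\<in>{0..<d}. \<eta> j) \<le> (\<Sum>j\<in>{0..<d}. \<eta> (j + 1) + ?\<mu>)" by (intro sum_mono st)
  then have "0 \<le> of_int d * ?\<mu>"
    using zero_meanD(2,3)[OF \<eta>] \<open>d > 0\<close> by (simp add: sum.distrib)
  then show pos: "0 \<le> ?\<mu>" using \<open>d > 0\<close> by (simp add: zero_le_mult_iff)
  have far: "\<eta> j \<le> \<eta> (j + k) + of_int k * ?\<mu>" if "0 \<le> k" for j k
    using that
  proof (induction k rule: int_ge_induct)
    case (step k)
    then show ?case using st[of "j + k"] by (simp add: algebra_simps)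
  qed simp
  have far': "\<eta> j \<le> \<eta> (j + k) + of_int d * ?\<mu>" if "k \<in> {0..<d}" for j k
  proof -
    have "of_int k * ?\<mu> \<le> of_int d * ?\<mu>" using that pos by (intro mult_right_mono) auto
    then show ?thesis using far[of k j] that by simp
  qed
  have "(\<Sum>k\<in>{0..<d}. \<eta> j) \<le> (\<Sum>k\<in>{0..<d}. \<eta> (j + k) + of_int d * ?\<mu>)" by (intro sum_mono far')
  then have "of_int d * \<eta> j \<le> of_int d * (of_int d * ?\<mu>)"
    using zero_meanD(3)[OF \<eta>, of j] \<open>d > 0\<close> by (simp add: sum.distrib add.commute)
  then have up: "\<eta> j \<le> of_int d * ?\<mu>" using \<open>d > 0\<close> by simp
  have "(\<Sum>k\<in>{0..<d}. \<eta> (k + (j - d))) \<le> (\<Sum>k\<in>{0..<d}. \<eta> j + of_int d * ?\<mu>)"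
  proof (intro sum_mono)
    fix k assume k: "k \<in> {0..<d}"
    have "\<eta> (k + (j - d)) \<le> \<eta> j + of_int (d - k) * ?\<mu>" using far[of "d - k" "k + (j - d)"] k by simp
    moreover have "of_int (d - k) * ?\<mu> \<le> of_int d * ?\<mu>" using k pos by (intro mult_right_mono) auto
    ultimately show "\<eta> (k + (j - d)) \<le> \<eta> j + of_int d * ?\<mu>" by linarith
  qed
  then have "0 \<le> of_int d * (\<eta> j + of_int d * ?\<mu>)"
    using zero_meanD(3)[OF \<eta>, of "j - d"] \<open>d > 0\<close> by simp
  then have "0 \<le> \<eta> j + of_int d * ?\<mu>" using \<open>d > 0\<close> by (simp add: zero_le_mult_iff)
  with up show "\<bar>\<eta> j\<bar> \<le> of_int d * ?\<mu>" by linarith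
qed

lemma slope_pos:
  assumes "d > 0" "\<eta> \<in> zero_mean d" "\<eta> \<noteq> (\<lambda>_. 0)"
  shows "slope d \<eta> > 0"
proof (rule ccontr)
  assume "\<not> ?thesis"
  then have "slope d \<eta> = 0" using slope_bounds(1)[OF assms(1,2)] by simp
  then have "\<eta> j = 0" for j using slope_bounds(2)[OF assms(1,2), of j] by simp
  then show False using assms(3) by blast
qed

lemma slope_zero: "d > 0 \<Longrightarrow> slope d (\<lambda>_. 0) = 0"
  by (simp add: slope_def image_constant_conv)

lemma zero_mean_scale: "\<eta> \<in> zero_mean d \<Longrightarrow> (\<lambda>j. c * \<eta> j) \<in> zero_mean d"
  by (auto simp: zero_mean_def simp flip: sum_distrib_left)

lemma zero_mean_diff: "\<eta> \<in> zero_mean d \<Longrightarrow> \<xi> \<in> zero_mean d \<Longrightarrow> (\<lambda>j. \<eta> j - \<xi> j) \<in> zero_mean d"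
  by (auto simp: zero_mean_def sum_subtractf)

section \<open>Radial rescaling to the simplex\<close>

abbreviation twists :: "int \<Rightarrow> nat \<Rightarrow> real \<Rightarrow> (int \<Rightarrow> real) \<Rightarrow> int \<Rightarrow> real" where
  "twists d r s \<equiv> twist d s ^^ r"

lemma twists_zero_mean: "\<eta> \<in> zero_mean d \<Longrightarrow> d > 0 \<Longrightarrow> twists d r s \<eta> \<in> zero_mean d"
  by (induction r) (auto intro: twist_zero_mean)

lemma twists_lincomb:
  "twists d r s (\<lambda>j. a * \<eta> j - b * \<xi> j) = (\<lambda>j. a * twists d r s \<eta> j - b * twists d r s \<xi> j)"
proof (induction r)
  case (Suc r)
  have "twist d s (\<lambda>j. a * \<eta> j - b * \<xi> j) = (\<lambda>j. a * twist d s \<eta> j - b * twist d s \<xi> j)" for \<eta> \<xi>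
    by (rule ext) (simp add: twist_def algebra_simps)
  then show ?case using Suc by simp
qed simp

lemma twists_scale: "twists d r s (\<lambda>j. a * \<eta> j) = (\<lambda>j. a * twists d r s \<eta> j)"
  using twists_lincomb[of r d s a \<eta> 0 \<eta>] by simp

lemma twists_0 [simp]: "twists d r 0 \<eta> = \<eta>"
  by (induction r) (auto simp: twist_def)

lemma twists_1: "twists d r 1 \<eta> = (\<lambda>j. \<eta> (j + 2 * int r))"
  by (induction r) (auto simp: twist_def ac_simps)

lemma twists_eq_0:
  assumes "d > 0" "s \<in> {0..1}" "\<eta> \<in> zero_mean d" "twists d r s \<eta> = (\<lambda>_. 0)"
  shows "\<eta> = (\<lambda>_. 0)"
  using assms(4)
proof (induction r)
  case (Suc r)
  have "twists d r s \<eta> j = 0" for j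
    using twist_inj[of d s "twists d r s \<eta>" j] Suc.prems assms
      zero_meanD(1)[OF twists_zero_mean[OF assms(3,1), of r s]] by (simp add: fun_eq_iff)
  then show ?case using Suc.IH by blast
qed simp

lemma twists_surj:
  assumes "d > 0" "s \<in> {0..1}" "\<zeta> \<in> zero_mean d"
  shows "\<exists>\<xi>\<in>zero_mean d. twists d r s \<xi> = \<zeta>"
  using assms(3)
proof (induction r arbitrary: \<zeta>)
  case (Suc r)
  obtain \<xi> where \<xi>: "\<xi> \<in> zero_mean d" "twist d s \<xi> = \<zeta>"
    using twist_surj[OF assms(1) _ _ Suc.prems, of s] assms(2) by auto
  then show ?case using Suc.IH[OF \<xi>(1)] by auto
qed simp

text \<open>Rescaling the linear map \<open>twists\<close> so that it preserves \<open>slope\<close> makes it a self-homeomorphism of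
  the simplex \<open>{\<eta> \<in> zero_mean d. slope d \<eta> \<le> 1}\<close>. For \<open>\<eta> = 0\<close> the quotient is \<open>0 / 0 = 0\<close>.\<close>

definition swirl :: "int \<Rightarrow> nat \<Rightarrow> real \<Rightarrow> (int \<Rightarrow> real) \<Rightarrow> int \<Rightarrow> real" where
  "swirl d r s \<eta> = (\<lambda>j. slope d \<eta> / slope d (twists d r s \<eta>) * twists d r s \<eta> j)"

definition slope_simplex :: "int \<Rightarrow> (int \<Rightarrow> real) set" where
  "slope_simplex d = {\<eta> \<in> zero_mean d. slope d \<eta> \<le> 1}"

lemma swirl_slope:
  assumes "d > 0" "s \<in> {0..1}" "\<eta> \<in> zero_mean d"
  shows "swirl d r s \<eta> \<in> zero_mean d" "slope d (swirl d r s \<eta>) = slope d \<eta>"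
proof -
  note tz = twists_zero_mean[OF assms(3,1), of r s]
  show "swirl d r s \<eta> \<in> zero_mean d" unfolding swirl_def by (rule zero_mean_scale[OF tz])
  show "slope d (swirl d r s \<eta>) = slope d \<eta>"
  proof (cases "\<eta> = (\<lambda>_. 0)")
    case True
    then have "swirl d r s \<eta> = (\<lambda>_. 0)"
      using twists_scale[of r d s 0 \<eta>] by (simp add: swirl_def)
    then show ?thesis using True by simp
  next
    case False
    then have "slope d (twists d r s \<eta>) > 0"
      using twists_eq_0[OF assms(1,2,3)] slope_pos[OF assms(1) tz] by blast
    then show ?thesis unfolding swirl_def
      using slope_scale[OF assms(1), of "slope d \<eta> / slope d (twists d r s \<eta>)" "twists d r s \<eta>"]
        slope_bounds(1)[OF assms(1,3)] by simp
  qed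
qed

text \<open>Equal images have equal slopes. By linearity and injectivity of \<open>twists\<close>,
  positive multiples of \<open>\<eta>\<close> and \<open>\<eta>'\<close> agree, and comparing slopes
  shows that the multiples are the same.\<close>

lemma swirl_inj:
  assumes "d > 0" "s \<in> {0..1}" "\<eta> \<in> zero_mean d" "\<eta>' \<in> zero_mean d" "swirl d r s \<eta> = swirl d r s \<eta>'"
  shows "\<eta> = \<eta>'"
proof -
  have sl: "slope d \<eta> = slope d \<eta>'" using swirl_slope(2) assms by metis
  show ?thesis
  proof (cases "slope d \<eta> = 0")
    case True
    then show ?thesis using sl slope_pos[OF assms(1,3)] slope_pos[OF assms(1,4)] by force
  next
    case False
    then have nz: "\<eta> \<noteq> (\<lambda>_. 0)" "\<eta>' \<noteq> (\<lambda>_. 0)" using sl slope_zero[OF assms(1)] by auto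
    define a where "a = slope d \<eta> / slope d (twists d r s \<eta>)"
    define a' where "a' = slope d \<eta>' / slope d (twists d r s \<eta>')"
    have tp: "slope d (twists d r s \<eta>) > 0" "slope d (twists d r s \<eta>') > 0"
      using twists_eq_0[OF assms(1,2,3)] twists_eq_0[OF assms(1,2,4)] nz
        slope_pos[OF assms(1) twists_zero_mean[OF assms(3,1)]]
        slope_pos[OF assms(1) twists_zero_mean[OF assms(4,1)]] by blast+
    have a: "a > 0" "a' > 0"
      using slope_pos[OF assms(1,3) nz(1)] slope_pos[OF assms(1,4) nz(2)] tp by (simp_all add: a_def a'_def)
    have "twists d r s (\<lambda>j. a * \<eta> j - a' * \<eta>' j) = (\<lambda>_. 0)"
      unfolding twists_lincomb using assms(5) by (simp add: swirl_def a_def a'_def fun_eq_iff)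
    then have "(\<lambda>j. a * \<eta> j - a' * \<eta>' j) = (\<lambda>_. 0)"
      using twists_eq_0[OF assms(1,2)] zero_mean_diff[OF zero_mean_scale[OF assms(3)] zero_mean_scale[OF assms(4)]]
      by blast
    then have eq: "a * \<eta> j = a' * \<eta>' j" for j by (simp add: fun_eq_iff)
    then have "a * slope d \<eta> = a' * slope d \<eta>'"
      using slope_scale[OF assms(1), of a \<eta>] slope_scale[OF assms(1), of a' \<eta>'] a by simp
    then have "a = a'" using sl False by simp
    then show ?thesis using eq a by auto
  qed
qed

lemma swirl_surj:
  assumes "d > 0" "s \<in> {0..1}" "\<zeta> \<in> zero_mean d"
  obtains \<eta> where "\<eta> \<in> zero_mean d" "swirl d r s \<eta> = \<zeta>"
proof (cases "\<zeta> = (\<lambda>_. 0)")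
  case True
  have "swirl d r s \<zeta> = \<zeta>" using twists_scale[of r d s 0 \<zeta>] True by (simp add: swirl_def)
  then show ?thesis using that assms(3) by blast
next
  case False
  obtain \<xi> where \<xi>: "\<xi> \<in> zero_mean d" "twists d r s \<xi> = \<zeta>" using twists_surj[OF assms] by blast
  have "\<xi> \<noteq> (\<lambda>_. 0)" using \<xi>(2) False twists_scale[of r d s 0 \<xi>] by auto
  then have pos: "slope d \<xi> > 0" "slope d \<zeta> > 0"
    using slope_pos[OF assms(1) \<xi>(1)] slope_pos[OF assms(1,3) False] by blast+
  define c where "c = slope d \<zeta> / slope d \<xi>"
  have c: "c > 0" using pos by (simp add: c_def)
  have "swirl d r s (\<lambda>j. c * \<xi> j) = \<zeta>"
    using pos c slope_scale[OF assms(1), of c] unfolding swirl_def twists_scale \<xi>(2)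
    by (simp add: fun_eq_iff c_def)
  then show ?thesis using that[of "\<lambda>j. c * \<xi> j"] zero_mean_scale[OF \<xi>(1)] by blast
qed

lemma swirl_0 [simp]:
  assumes "d > 0" "\<eta> \<in> zero_mean d"
  shows "swirl d r 0 \<eta> = \<eta>"
  using slope_pos[OF assms] by (cases "\<eta> = (\<lambda>_. 0)") (auto simp: swirl_def)

text \<open>A rotation of the indices preserves \<open>slope\<close>, so the rescaling factor is
  1.\<close>

lemma swirl_1:
  assumes "d > 0" "\<eta> \<in> zero_mean d"
  shows "swirl d r 1 \<eta> = (\<lambda>j. \<eta> (j + 2 * int r))"
  using slope_pos[OF assms] slope_shift[of d \<eta> "2 * int r"] zero_meanD(1)[OF assms(2)] assms(1)
  by (cases "\<eta> = (\<lambda>_. 0)") (auto simp: swirl_def twists_1)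

lemma continuous_on_Max_image:
  fixes f :: "'i \<Rightarrow> 'a::topological_space \<Rightarrow> real"
  assumes "finite I" "I \<noteq> {}" "\<And>i. i \<in> I \<Longrightarrow> continuous_on A (f i)"
  shows "continuous_on A (\<lambda>x. Max ((\<lambda>i. f i x) ` I))"
  using assms
proof (induction I rule: finite_ne_induct)
  case (insert i I)
  have "continuous_on A (\<lambda>x. max (f i x) (Max ((\<lambda>i. f i x) ` I)))"
    using insert by (intro continuous_on_max) auto
  then show ?case using insert.hyps by simp
qed simp

text \<open>Away from the zero sequence this is a quotient of continuous functions with nonzero
  denominator. At the zero sequence the quotient is controlled by \<open>slope_bounds\<close>: every
  coordinate is at most \<open>d * slope d \<eta>\<close>, which tends to 0.\<close>

lemma continuous_on_swirl:
  assumes "d > 0"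
  shows "continuous_on ({0..1} \<times> slope_simplex d) (\<lambda>(s, \<eta>). swirl d r s \<eta> j)"
proof -
  let ?S = "{0..1} \<times> slope_simplex d"
  have co: "continuous_on A (\<lambda>p. snd p i)" for A :: "(real \<times> (int \<Rightarrow> real)) set" and i
    by (rule continuous_on_compose2[OF continuous_on_product_coordinates[of i] continuous_on_snd[OF continuous_on_id]]) auto
  have tw: "continuous_on A (\<lambda>p. twists d r (fst p) (snd p) j)" for A :: "(real \<times> (int \<Rightarrow> real)) set" and j
  proof (induction r arbitrary: j)
    case 0 show ?case using co by simp
  next
    case (Suc r)
    have "twists d (Suc r) s \<eta> j = (1 - s) * twists d r s \<eta> j
        - 4 * cos (pi / (2 * of_int d)) * s * (1 - s) * twists d r s \<eta> (j + 1) + s * twists d r s \<eta> (j + 2)"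
      for s \<eta> unfolding funpow.simps o_apply by (rule twist_def)
    then show ?case by (simp only:) (intro continuous_intros Suc.IH)
  qed
  have sl: "continuous_on A (\<lambda>p. slope d (snd p))"
    and slt: "continuous_on A (\<lambda>p. slope d (twists d r (fst p) (snd p)))"
    for A :: "(real \<times> (int \<Rightarrow> real)) set"
    unfolding slope_def using assms by (intro continuous_on_Max_image continuous_intros co tw; simp)+
  have "((\<lambda>p. swirl d r (fst p) (snd p) j) \<longlongrightarrow> swirl d r s \<eta> j) (at (s, \<eta>) within ?S)"
    if s\<eta>: "(s, \<eta>) \<in> ?S" for s \<eta>
  proof (cases "\<eta> = (\<lambda>_. 0)")
    case False
    have \<eta>: "s \<in> {0..1}" "\<eta> \<in> zero_mean d" using s\<eta> by (auto simp: slope_simplex_def)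
    have "slope d (twists d r s \<eta>) \<noteq> 0"
      using slope_pos[OF assms twists_zero_mean[OF \<eta>(2) assms, of r s]]
        twists_eq_0[OF assms \<eta>] False by force
    then show ?thesis
      using sl[of ?S] slt[of ?S] tw[of ?S j] s\<eta> unfolding swirl_def continuous_on_def
      by (intro tendsto_intros) force+
  next
    case True
    have z: "swirl d r s \<eta> j = 0" using True slope_zero[OF assms] by (simp add: swirl_def)
    have "((\<lambda>p. of_int d * slope d (snd p)) \<longlongrightarrow> of_int d * slope d (snd (s, \<eta>))) (at (s, \<eta>) within ?S)"
      using sl[of ?S] s\<eta> unfolding continuous_on_def by (intro tendsto_intros) blast
    then have lim: "((\<lambda>p. of_int d * slope d (snd p)) \<longlongrightarrow> 0) (at (s, \<eta>) within ?S)"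
      using True slope_zero[OF assms] by simp
    have "\<forall>\<^sub>F p in at (s, \<eta>) within ?S. p \<in> ?S" by (simp add: eventually_at_filter)
    then have "\<forall>\<^sub>F p in at (s, \<eta>) within ?S. norm (swirl d r (fst p) (snd p) j) \<le> of_int d * slope d (snd p)"
    proof eventually_elim
      case (elim p)
      then have p: "fst p \<in> {0..1}" "snd p \<in> zero_mean d" by (auto simp: slope_simplex_def)
      show ?case using slope_bounds(2)[OF assms swirl_slope(1)[OF assms p], of r j]
          swirl_slope(2)[OF assms p, of r] by simp
    qed
    from Lim_null_comparison[OF this lim] show ?thesis using z by simp
  qed
  then show ?thesis by (auto simp: continuous_on_def case_prod_beta)
qed

lemma closed_zero_mean: "closed (zero_mean d)"
proof -
  have "zero_mean d = (\<Inter>j. {\<eta>. \<eta> (j + d) = \<eta> j}) \<inter> {\<eta>. (\<Sum>j\<in>{0..<d}. \<eta> j) = 0}"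
    by (auto simp: zero_mean_def)
  moreover have "closed {\<eta>::int \<Rightarrow> real. \<eta> (j + d) = \<eta> j}" for j
    by (intro closed_Collect_eq continuous_on_product_coordinates)
  moreover have "closed {\<eta>::int \<Rightarrow> real. (\<Sum>j\<in>{0..<d}. \<eta> j) = 0}"
    by (intro closed_Collect_eq continuous_on_sum continuous_on_product_coordinates continuous_on_const)
  ultimately show ?thesis by (simp add: closed_INT closed_Int)
qed

lemma compact_box_fun:
  fixes a b :: "'i \<Rightarrow> real"
  shows "compact {f. \<forall>i. f i \<in> {a i..b i}}"
proof -
  have "compactin (product_topology (\<lambda>i. euclideanreal) UNIV) (PiE UNIV (\<lambda>i. {a i..b i}))"
    by (subst compactin_PiE) auto
  moreover have "PiE UNIV (\<lambda>i. {a i..b i}) = {f. \<forall>i. f i \<in> {a i..b i}}" by auto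
  ultimately show ?thesis by (simp add: euclidean_product_topology)
qed

text \<open>Closed in a box, by \<open>slope_bounds\<close>; the box is compact by
  Tychonoff.\<close>

lemma compact_slope_simplex:
  assumes "d > 0"
  shows "compact (slope_simplex d)"
proof -
  have "continuous_on UNIV (slope d)"
    unfolding slope_def using assms
    by (intro continuous_on_Max_image continuous_on_diff continuous_on_product_coordinates) auto
  then have "closed {\<eta>. slope d \<eta> \<le> 1}" by (intro closed_Collect_le continuous_on_const)
  then have "closed (zero_mean d \<inter> {\<eta>. slope d \<eta> \<le> 1})" using closed_zero_mean by (rule closed_Int[rotated])
  moreover have "slope_simplex d = {f. \<forall>i. f i \<in> {(\<lambda>_. - of_int d) i..(\<lambda>_. of_int d) i}} \<inter> (zero_mean d \<inter> {\<eta>. slope d \<eta> \<le> 1})"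
  proof -
    have "- of_int d \<le> \<eta> j \<and> \<eta> j \<le> of_int d" if "\<eta> \<in> zero_mean d" "slope d \<eta> \<le> 1" for \<eta> j
    proof -
      have "of_int d * slope d \<eta> \<le> of_int d * 1" using that(2) assms by (intro mult_left_mono) auto
      then show ?thesis using slope_bounds(2)[OF assms that(1), of j] by linarith
    qed
    then show ?thesis by (auto simp: slope_simplex_def)
  qed
  ultimately show ?thesis
    using compact_Int_closed[OF compact_box_fun[of "\<lambda>_. - of_int d" "\<lambda>_. of_int d"],
        of "zero_mean d \<inter> {\<eta>. slope d \<eta> \<le> 1}"] by simp
qed

text \<open>The set is star-shaped about the zero sequence.\<close>

lemma connected_slope_simplex:
  assumes "d > 0"
  shows "connected (slope_simplex d)"
proof (rule connected_iff_connected_component[THEN iffD2], intro ballI)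
  fix \<eta> \<xi> assume *: "\<eta> \<in> slope_simplex d" "\<xi> \<in> slope_simplex d"
  have "connected_component (slope_simplex d) (\<lambda>_. 0) \<eta>" if \<eta>: "\<eta> \<in> slope_simplex d" for \<eta>
  proof -
    have "(\<lambda>c j. c * \<eta> j) ` {0..1} \<subseteq> slope_simplex d"
    proof clarify
      fix c :: real assume c: "c \<in> {0..1}"
      have "c * slope d \<eta> \<le> 1" using c \<eta> slope_bounds(1)[of d \<eta>] assms
        by (auto simp: slope_simplex_def intro: mult_le_one)
      then show "(\<lambda>j. c * \<eta> j) \<in> slope_simplex d"
        using c \<eta> slope_scale[OF assms] zero_mean_scale by (auto simp: slope_simplex_def)
    qed
    moreover have "connected ((\<lambda>c j. c * \<eta> j) ` {0..1::real})"
      by (intro connected_continuous_image continuous_on_coordinatewise_then_product continuous_intros) auto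
    moreover have "(\<lambda>_. 0) \<in> (\<lambda>c j. c * \<eta> j) ` {0..1::real}" by (rule image_eqI[of _ _ 0]) auto
    moreover have "\<eta> \<in> (\<lambda>c j. c * \<eta> j) ` {0..1::real}" by (rule image_eqI[of _ _ 1]) auto
    ultimately show ?thesis unfolding connected_component_def by blast
  qed
  then show "connected_component (slope_simplex d) \<eta> \<xi>"
    using * connected_component_trans connected_component_sym by meson
qed

section \<open>The space of zigzag vectors\<close>

text \<open>The induced bijection \<open>f\<close> is continuous because the preimage of a closed
  set is the \<open>q\<close>-image of a compact set, hence closed; a continuous bijection from a
  compact to a Hausdorff space is a homeomorphism.\<close>

lemma homeomorphic_compact_quotients:
  fixes q :: "'a::topological_space \<Rightarrow> 'b::t2_space" and q' :: "'a \<Rightarrow> 'c::t2_space"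
  assumes E: "compact E" and q: "continuous_on E q" and q': "continuous_on E q'"
    and eq: "\<And>x y. x \<in> E \<Longrightarrow> y \<in> E \<Longrightarrow> q x = q y \<longleftrightarrow> q' x = q' y"
  shows "q ` E homeomorphic q' ` E"
proof -
  define f where "f y = q' (SOME x. x \<in> E \<and> q x = y)" for y
  have f: "f (q x) = q' x" if "x \<in> E" for x
  proof -
    have "(SOME x'. x' \<in> E \<and> q x' = q x) \<in> E \<and> q (SOME x'. x' \<in> E \<and> q x' = q x) = q x"
      by (rule someI[of "\<lambda>x'. x' \<in> E \<and> q x' = q x" x]) (simp add: that)
    then show ?thesis unfolding f_def using eq that by blast
  qed
  have "compact (q ` E)" by (rule compact_continuous_image[OF q E])
  moreover have "continuous_on (q ` E) f"
  proof (rule continuous_on_closed_invariant[THEN iffD2, rule_format])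
    fix B :: "'c set" assume B: "closed B"
    have "closedin (top_of_set E) (E \<inter> q' -` B)" by (rule continuous_closedin_preimage[OF q' B])
    then have "compact (E \<inter> q' -` B)" using E closedin_compact by blast
    then have "closed (q ` (E \<inter> q' -` B))"
      using compact_continuous_image[OF continuous_on_subset[OF q]] compact_imp_closed by blast
    moreover have "q ` (E \<inter> q' -` B) \<inter> q ` E = f -` B \<inter> q ` E" using f eq by auto
    ultimately show "\<exists>A. closed A \<and> A \<inter> q ` E = f -` B \<inter> q ` E" by blast
  qed
  moreover have "f ` q ` E = q' ` E" using f by (auto simp: image_iff)
  moreover have "inj_on f (q ` E)" using f eq by (auto simp: inj_on_def)
  ultimately have "\<exists>g. homeomorphism (q ` E) (q' ` E) f g" by (rule homeomorphism_compact)
  then show ?thesis unfolding homeomorphic_def by blast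
qed

section \<open>Coordinates on the space of phases\<close>

definition unroll :: "nat \<Rightarrow> (nat \<Rightarrow> real) \<Rightarrow> int \<Rightarrow> real" where
  "unroll N w i = w (nat (i mod int N))"

definition zigzag_vectors :: "nat \<Rightarrow> int \<Rightarrow> (int \<Rightarrow> real) \<Rightarrow> (nat \<Rightarrow> real) set" where
  "zigzag_vectors N l v = {w \<in> RN N. \<exists>\<theta>\<in>phases (int N) l. \<forall>i. unroll N w i = zigzag v (\<theta> i)}"

lemma zigzag_phase_periodic:
  assumes "\<theta> \<in> phases n l" "\<And>k. v (k + l) = v k"
  shows "zigzag v (\<theta> (i mod n)) = zigzag v (\<theta> i)"
proof -
  have "zigzag v (\<theta> (j + n)) = zigzag v (\<theta> j)" for j
    using quasi_periodicD(2)[OF phases_quasi_periodic[OF assms(1)], of j] zigzag_periodic[of v l "\<theta> j", OF assms(2)]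
    by simp
  then show ?thesis using periodic_mod[of "\<lambda>j. zigzag v (\<theta> j)" n i] by simp
qed

text \<open>The even periods are the multiples of \<open>2 * r\<close>. By
  \<open>zigzag_rigid\<close>, these are the shifts under which different phases can give the same
  vector.\<close>

definition minimal_even_period :: "nat \<Rightarrow> (int \<Rightarrow> real) \<Rightarrow> bool" where
  "minimal_even_period r v \<longleftrightarrow> r > 0 \<and>
     (\<forall>m. even m \<longrightarrow> (\<forall>k. v (k + m) = v k) \<longleftrightarrow> 2 * int r dvd m)"

text \<open>Splits a quasi-periodic sequence into an offset \<open>a\<close> and the deviation
  \<open>\<eta>\<close> from an arithmetic progression, scaled so that monotonicity becomes
  \<open>slope d \<eta> \<le> 1\<close>.\<close>

definition spread :: "int \<Rightarrow> int \<Rightarrow> real \<Rightarrow> (int \<Rightarrow> real) \<Rightarrow> int \<Rightarrow> real" where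
  "spread d l a \<eta> j = of_int l / of_int d * (of_int j + \<eta> j) + a"

lemma spread_quasi_periodic:
  assumes "d > 0" "l > 0" "\<eta> \<in> slope_simplex d"
  shows "spread d l a \<eta> \<in> quasi_periodic d l"
proof -
  have \<eta>: "\<eta> \<in> zero_mean d" "slope d \<eta> \<le> 1" using assms(3) by (auto simp: slope_simplex_def)
  have *: "\<forall>j. \<eta> j - \<eta> (j + 1) \<le> 1"
    using slope_le_iff[of d \<eta> 1, OF \<open>d > 0\<close>] zero_meanD(1)[OF \<eta>(1)] \<eta>(2) by blast
  have "spread d l a \<eta> j \<le> spread d l a \<eta> (j + 1)" for j
  proof -
    have "of_int j + \<eta> j \<le> of_int (j + 1) + \<eta> (j + 1)" using spec[OF *, of j] by simp
    then show ?thesis unfolding spread_def using assms(1,2) by (intro add_right_mono mult_left_mono) auto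
  qed
  moreover have "spread d l a \<eta> (j + d) = spread d l a \<eta> j + of_int l" for j
    using zero_meanD(1)[OF \<eta>(1), of j] assms(1) by (simp add: spread_def field_simps)
  ultimately show ?thesis by (simp add: quasi_periodic_def)
qed

lemma quasi_periodic_spread:
  assumes "d > 0" "l > 0" and x: "x \<in> quasi_periodic d l"
  obtains a \<eta> where "\<eta> \<in> slope_simplex d" "x = spread d l a \<eta>"
proof -
  define y where "y j = of_int d / of_int l * x j - of_int j" for j
  have per: "y (j + d) = y j" for j
    using quasi_periodicD(2)[OF x, of j] assms(1,2) by (simp add: y_def field_simps)
  define c where "c = (\<Sum>j\<in>{0..<d}. y j) / of_int d"
  define \<eta> where "\<eta> j = y j - c" for j
  have per\<eta>: "\<eta> (j + d) = \<eta> j" for j using per by (simp add: \<eta>_def)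
  have "\<eta> \<in> zero_mean d" using assms(1) per by (auto simp: zero_mean_def \<eta>_def sum_subtractf c_def)
  moreover have "slope d \<eta> \<le> 1"
  proof -
    have "\<eta> j - \<eta> (j + 1) \<le> 1" for j
    proof -
      have "x j \<le> x (j + 1)" by (rule quasi_periodicD(1)[OF x]) simp
      then have "of_int d / of_int l * x j \<le> of_int d / of_int l * x (j + 1)"
        using assms(1,2) by (intro mult_left_mono) auto
      then show ?thesis by (simp add: \<eta>_def y_def)
    qed
    then show ?thesis using slope_le_iff[of d \<eta> 1, OF assms(1) per\<eta>] by blast
  qed
  ultimately have "\<eta> \<in> slope_simplex d" by (simp add: slope_simplex_def)
  moreover have "x = spread d l (of_int l / of_int d * c) \<eta>"
    using assms(1,2) by (simp add: spread_def \<eta>_def y_def fun_eq_iff field_simps)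
  ultimately show ?thesis by (rule that)
qed

lemma spread_inj:
  assumes "d > 0" "l > 0" "\<eta> \<in> zero_mean d" "\<eta>' \<in> zero_mean d" "spread d l a \<eta> = spread d l a' \<eta>'"
  shows "a = a'" "\<eta> = \<eta>'"
proof -
  have eq: "of_int l / of_int d * (of_int j + \<eta> j) + a = of_int l / of_int d * (of_int j + \<eta>' j) + a'" for j
    using fun_cong[OF assms(5), of j] by (simp add: spread_def)
  then have "(\<Sum>j\<in>{0..<d}. of_int l / of_int d * (of_int j + \<eta> j) + a)
      = (\<Sum>j\<in>{0..<d}. of_int l / of_int d * (of_int j + \<eta>' j) + a')" by (intro sum.cong) auto
  then show "a = a'"
    using zero_meanD(2)[OF assms(3)] zero_meanD(2)[OF assms(4)] assms(1)
    unfolding sum.distrib sum_distrib_left[symmetric] by simp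
  then have "of_int l / of_int d * \<eta> j = of_int l / of_int d * \<eta>' j" for j
    using eq[of j] by (simp add: distrib_left)
  then show "\<eta> = \<eta>'" using assms(1,2) by (auto simp: fun_eq_iff)
qed

text \<open>A unit shift of phases raises the offset by \<open>1 + l / d\<close>: 1 from the values
  and \<open>l / d\<close> from the index (\<open>spread_shift\<close>). Thus \<open>s\<close> from
  0 to 1 covers exactly the shift by \<open>2 * r\<close>.\<close>

definition spiral :: "int \<Rightarrow> int \<Rightarrow> nat \<Rightarrow> real \<times> (int \<Rightarrow> real) \<Rightarrow> int \<Rightarrow> real" where
  "spiral d l r = (\<lambda>(s, \<eta>). spread d l (2 * real r * s * (1 + of_int l / of_int d)) (swirl d r s \<eta>))"

lemma swirl_slope_simplex:
  assumes "d > 0" "s \<in> {0..1}" "\<eta> \<in> slope_simplex d"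
  shows "swirl d r s \<eta> \<in> slope_simplex d"
  using swirl_slope[OF assms(1,2), of \<eta> r] assms(3) by (simp add: slope_simplex_def)

lemma zero_mean_shift: "\<eta> \<in> zero_mean d \<Longrightarrow> d > 0 \<Longrightarrow> (\<lambda>j. \<eta> (j + m)) \<in> zero_mean d"
proof -
  assume \<eta>: "\<eta> \<in> zero_mean d" "d > 0"
  have "\<eta> (j + d + m) = \<eta> (j + m)" for j using zero_meanD(1)[OF \<eta>(1), of "j + m"] by (simp add: ac_simps)
  then show ?thesis using zero_meanD(3)[OF \<eta>] by (simp add: zero_mean_def)
qed

lemma spread_shift:
  "d > 0 \<Longrightarrow> spread d l a \<eta> (j + m) + of_int m
    = spread d l (a + of_int m * (1 + of_int l / of_int d)) (\<lambda>j. \<eta> (j + m)) j"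
  by (simp add: spread_def algebra_simps)

text \<open>The shift of phases by the period \<open>2 * r\<close> of \<open>v\<close> corresponds to one turn \<open>s \<mapsto> s + 1\<close>; since the
  swirl absorbs the index shift that comes with it, the identifications do not depend on \<open>r\<close>.\<close>

lemma spiral_shift_iff:
  assumes dl: "d > 0" "l > 0" and "r > 0" and p: "s \<in> {0..1}" "\<eta> \<in> slope_simplex d"
    and p': "s' \<in> {0..1}" "\<eta>' \<in> slope_simplex d"
  shows "(\<exists>k. \<forall>j. spiral d l r (s', \<eta>') j = spiral d l r (s, \<eta>) (j + 2 * int r * k) + of_int (2 * int r * k))
    \<longleftrightarrow> \<eta> = \<eta>' \<and> s - s' \<in> \<int>" (is "?L \<longleftrightarrow> ?R")
proof -
  let ?c = "1 + real_of_int l / of_int d"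
  have c: "?c > 0" using dl by (simp add: add_pos_pos)
  have z: "\<eta> \<in> zero_mean d" "\<eta>' \<in> zero_mean d" using p p' by (auto simp: slope_simplex_def)
  note sz = swirl_slope(1)[OF dl(1) p(1) z(1), of r] swirl_slope(1)[OF dl(1) p'(1) z(2), of r]
  have key: "(\<forall>j. spiral d l r (s', \<eta>') j = spiral d l r (s, \<eta>) (j + 2 * int r * k) + of_int (2 * int r * k))
      \<longleftrightarrow> s' = s + of_int k \<and> swirl d r s' \<eta>' = (\<lambda>j. swirl d r s \<eta> (j + 2 * int r * k))" for k
  proof -
    let ?m = "2 * int r * k"
    have rhs: "spiral d l r (s, \<eta>) (j + ?m) + of_int ?m
        = spread d l (2 * real r * (s + of_int k) * ?c) (\<lambda>j. swirl d r s \<eta> (j + ?m)) j" for j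
      unfolding spiral_def using spread_shift[OF dl(1), of l _ _ j ?m] by (simp add: algebra_simps)
    have "(\<forall>j. spiral d l r (s', \<eta>') j = spiral d l r (s, \<eta>) (j + ?m) + of_int ?m) \<longleftrightarrow>
       spread d l (2 * real r * s' * ?c) (swirl d r s' \<eta>')
        = spread d l (2 * real r * (s + of_int k) * ?c) (\<lambda>j. swirl d r s \<eta> (j + ?m))"
      unfolding rhs by (simp add: fun_eq_iff spiral_def)
    also have "\<dots> \<longleftrightarrow> 2 * real r * s' * ?c = 2 * real r * (s + of_int k) * ?c \<and>
        swirl d r s' \<eta>' = (\<lambda>j. swirl d r s \<eta> (j + ?m))"
      using spread_inj[OF dl sz(2) zero_mean_shift[OF sz(1) dl(1)]] by metis
    also have "2 * real r * s' * ?c = 2 * real r * (s + of_int k) * ?c \<longleftrightarrow> s' = s + of_int k"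
      using c \<open>r > 0\<close> unfolding mult_cancel_left mult_cancel_right by auto
    finally show ?thesis .
  qed
  show ?thesis unfolding key
  proof
    assume "\<exists>k. s' = s + of_int k \<and> swirl d r s' \<eta>' = (\<lambda>j. swirl d r s \<eta> (j + 2 * int r * k))"
    then obtain k where k: "s' = s + of_int k" "swirl d r s' \<eta>' = (\<lambda>j. swirl d r s \<eta> (j + 2 * int r * k))" by blast
    \<comment> \<open>Both parameters lie in the unit interval. A coincidence with
      \<open>k \<noteq> 0\<close> therefore joins its two ends, where \<open>swirl\<close> is the
      identity or the index shift by \<open>2 * r\<close>.\<close>
    have "real_of_int k \<le> 1" "- 1 \<le> real_of_int k" using k(1) p(1) p'(1) by auto
    then consider "k = 0" | "k = 1" | "k = -1" by linarith
    then have "\<eta> = \<eta>'"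
    proof cases
      case 1 then show ?thesis using k swirl_inj[OF dl(1) p(1) z, of r] by simp
    next
      case 2
      then have "s = 0" "s' = 1" using k(1) p(1) p'(1) by auto
      then have "(\<lambda>j. \<eta>' (j + 2 * int r)) = (\<lambda>j. \<eta> (j + 2 * int r))"
        using k(2) 2 swirl_1[OF dl(1) z(2), of r] swirl_0[OF dl(1) z(1), of r] by simp
      then have "\<eta>' ((j - 2 * int r) + 2 * int r) = \<eta> ((j - 2 * int r) + 2 * int r)" for j by (rule fun_cong)
      then show ?thesis by (simp add: fun_eq_iff)
    next
      case 3
      then have "s = 1" "s' = 0" using k(1) p(1) p'(1) by auto
      then show ?thesis using k(2) 3 swirl_1[OF dl(1) z(1), of r] swirl_0[OF dl(1) z(2), of r] by simp
    qed
    then show ?R using k(1) by simp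
  next
    assume R: ?R
    then obtain k where k: "s - s' = of_int k" by (auto elim: Ints_cases)
    have "real_of_int k \<le> 1" "- 1 \<le> real_of_int k" using k p(1) p'(1) by auto
    then consider "k = 0" | "k = 1" | "k = -1" by linarith
    then show "\<exists>k. s' = s + of_int k \<and> swirl d r s' \<eta>' = (\<lambda>j. swirl d r s \<eta> (j + 2 * int r * k))"
    proof cases
      case 1 then show ?thesis using k R by (intro exI[of _ 0]) simp
    next
      case 2
      then have "s = 1" "s' = 0" using k p(1) p'(1) by auto
      then show ?thesis using R swirl_1[OF dl(1) z(1), of r] swirl_0[OF dl(1) z(2), of r]
        by (intro exI[of _ "-1"]) simp
    next
      case 3
      then have "s = 0" "s' = 1" using k p(1) p'(1) by auto
      then show ?thesis using R swirl_1[OF dl(1) z(2), of r] swirl_0[OF dl(1) z(1), of r]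
        by (intro exI[of _ 1]) simp
    qed
  qed
qed

context
  fixes N :: nat and l d :: int and r :: nat and v :: "int \<Rightarrow> real"
  assumes d: "d = int N - l" "d > 0" and l: "l > 0"
    and v: "alternating l v" and r: "minimal_even_period r v"
begin

definition sample :: "real \<times> (int \<Rightarrow> real) \<Rightarrow> nat \<Rightarrow> real" where
  "sample p i = (if i < N then zigzag v (merge (spiral d l r p) (int i)) else 0)"

lemma v_periodic: "v (k + l) = v k"
  using v by (simp add: alternating_def)

lemma r_pos: "r > 0"
  using r by (simp add: minimal_even_period_def)

lemma spiral_quasi_periodic:
  assumes "p \<in> {0..1} \<times> slope_simplex d"
  shows "spiral d l r p \<in> quasi_periodic d l"
  using assms spread_quasi_periodic[OF d(2) l swirl_slope_simplex[OF d(2)]] by (auto simp: spiral_def)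

lemma spiral_phases:
  assumes "p \<in> {0..1} \<times> slope_simplex d"
  shows "merge (spiral d l r p) \<in> phases (int N) l"
  using merges_phases[OF merges_merge[OF _ d(2) l], OF spiral_quasi_periodic[OF assms] spiral_quasi_periodic[OF assms]]
  by (simp add: d(1))

lemma continuous_on_sample: "continuous_on ({0..1} \<times> slope_simplex d) sample"
proof (rule continuous_on_coordinatewise_then_product)
  fix i
  show "continuous_on ({0..1} \<times> slope_simplex d) (\<lambda>p. sample p i)"
  proof (cases "i < N")
    case True
    have sp: "continuous_on ({0..1} \<times> slope_simplex d) (spiral d l r)"
    proof (rule continuous_on_coordinatewise_then_product)
      fix j
      have "continuous_on ({0..1} \<times> slope_simplex d) (\<lambda>p. swirl d r (fst p) (snd p) j)"
        using continuous_on_swirl[OF d(2), of r j] by (simp add: case_prod_beta)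
      then show "continuous_on ({0..1} \<times> slope_simplex d) (\<lambda>p. spiral d l r p j)"
        unfolding spiral_def spread_def case_prod_beta by (intro continuous_intros)
    qed
    have "continuous_on ({0..1} \<times> slope_simplex d) (\<lambda>p. merge (spiral d l r p) (int i))"
      by (rule continuous_on_compose2[OF continuous_on_merge[OF d(2) l] sp])
         (auto intro: spiral_quasi_periodic)
    then have "continuous_on ({0..1} \<times> slope_simplex d) (\<lambda>p. zigzag v (merge (spiral d l r p) (int i)))"
      by (rule continuous_on_compose2[OF continuous_on_zigzag]) auto
    then show ?thesis using True by (simp add: sample_def)
  qed (simp add: sample_def)
qed

lemma unroll_sample:
  assumes "p \<in> {0..1} \<times> slope_simplex d"
  shows "unroll N (sample p) i = zigzag v (merge (spiral d l r p) i)"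
proof -
  have N: "int N > 0" using d l by simp
  then have "nat (i mod int N) < N" by (simp add: nat_less_iff)
  then have "unroll N (sample p) i = zigzag v (merge (spiral d l r p) (i mod int N))"
    using N by (simp add: unroll_def sample_def)
  then show ?thesis using zigzag_phase_periodic[OF spiral_phases[OF assms], of v] v_periodic by simp
qed

text \<open>Equal vectors have phases that differ by an even period of \<open>v\<close>
  (\<open>zigzag_rigid\<close>), and \<open>merges_inj\<close> carries this over to the spirals.
  Neither \<open>v\<close> nor \<open>r\<close> occurs on the right-hand side, so samples for
  different \<open>v\<close> have the same fibres.\<close>

lemma sample_eq_iff:
  assumes p: "p \<in> {0..1} \<times> slope_simplex d" and p': "p' \<in> {0..1} \<times> slope_simplex d"
  shows "sample p = sample p' \<longleftrightarrow> snd p = snd p' \<and> fst p - fst p' \<in> \<int>"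
proof -
  let ?x = "spiral d l r p" let ?x' = "spiral d l r p'"
  have N: "int N > 0" using d l by simp
  note m = merges_merge[OF spiral_quasi_periodic[OF p] d(2) l]
  note m' = merges_merge[OF spiral_quasi_periodic[OF p'] d(2) l]
  have "sample p = sample p' \<longleftrightarrow> (\<forall>i. zigzag v (merge ?x i) = zigzag v (merge ?x' i))"
    unfolding unroll_sample[OF p, symmetric] unroll_sample[OF p', symmetric]
    by (auto simp: fun_eq_iff unroll_def) (metis N nat_int zmod_int mod_less sample_def)
  also have "\<dots> \<longleftrightarrow> (\<exists>k. \<forall>j. ?x' j = ?x (j + 2 * int r * k) + of_int (2 * int r * k))"
  proof
    assume "\<forall>i. zigzag v (merge ?x i) = zigzag v (merge ?x' i)"
    then obtain e where e: "even e" "\<And>i. merge ?x' i = merge ?x i + of_int e" "\<And>k. v (k + e) = v k"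
      using zigzag_rigid[OF spiral_phases[OF p] spiral_phases[OF p'] N l v v] by metis
    then have "2 * int r dvd e" using r unfolding minimal_even_period_def by blast
    then obtain k where k: "e = 2 * int r * k" by (rule dvdE)
    have "merge ?x' = (\<lambda>i. merge ?x i + of_int e)" using e(2) by auto
    then have "?x' = (\<lambda>j. ?x (j + e) + of_int e)"
      using merges_inj[OF m'] merges_shift[OF m, of e] by simp
    then show "\<exists>k. \<forall>j. ?x' j = ?x (j + 2 * int r * k) + of_int (2 * int r * k)" using k by metis
  next
    assume "\<exists>k. \<forall>j. ?x' j = ?x (j + 2 * int r * k) + of_int (2 * int r * k)"
    then obtain k where k: "\<forall>j. ?x' j = ?x (j + 2 * int r * k) + of_int (2 * int r * k)" by blast
    define e where "e = 2 * int r * k"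
    have e: "2 * int r dvd e" "?x' = (\<lambda>j. ?x (j + e) + of_int e)" unfolding e_def using k by (auto simp only: fun_eq_iff dvd_triv_left)
    then have "merge ?x' = (\<lambda>i. merge ?x i + of_int e)"
      using merges_unique[OF m'] merges_shift[OF m, of e] by simp
    moreover have "even e" using e(1) by auto
    then have "\<forall>k. v (k + e) = v k" using e(1) r unfolding minimal_even_period_def by blast
    ultimately show "\<forall>i. zigzag v (merge ?x i) = zigzag v (merge ?x' i)"
      using zigzag_periodic[of v e] by simp
  qed
  also have "\<dots> \<longleftrightarrow> snd p = snd p' \<and> fst p - fst p' \<in> \<int>"
    using spiral_shift_iff[OF d(2) l r_pos, of "fst p" "snd p" "fst p'" "snd p'"] p p' by auto
  finally show ?thesis .
qed

lemma sample_image: "sample ` ({0..1} \<times> slope_simplex d) = zigzag_vectors N l v"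
proof
  have N: "int N > 0" using d l by simp
  show "sample ` ({0..1} \<times> slope_simplex d) \<subseteq> zigzag_vectors N l v"
  proof clarify
    fix s \<eta> assume "s \<in> {0..1::real}" "\<eta> \<in> slope_simplex d"
    then have p: "(s, \<eta>) \<in> {0..1} \<times> slope_simplex d" by simp
    show "sample (s, \<eta>) \<in> zigzag_vectors N l v"
      using spiral_phases[OF p] unroll_sample[OF p] by (auto simp: zigzag_vectors_def RN_def sample_def)
  qed
  show "zigzag_vectors N l v \<subseteq> sample ` ({0..1} \<times> slope_simplex d)"
  proof
    fix w assume "w \<in> zigzag_vectors N l v"
    then obtain \<theta> where w: "w \<in> RN N" and \<theta>: "\<theta> \<in> phases (int N) l"
      and w\<theta>: "\<And>i. unroll N w i = zigzag v (\<theta> i)" by (auto simp: zigzag_vectors_def)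
    have \<theta>': "\<theta> \<in> phases (d + l) l" using \<theta> d(1) by simp
    obtain x where x: "merges x \<theta>" using merges_surj[OF \<theta>' d(2) l] by blast
    obtain a \<eta> where \<eta>: "\<eta> \<in> slope_simplex d" and xs: "x = spread d l a \<eta>"
      using quasi_periodic_spread[OF d(2) l merges_quasi_periodic[OF x \<theta>']] .
    define C where "C = 2 * real r * (1 + of_int l / of_int d)"
    have C: "C > 0" using d(2) l r_pos by (simp add: C_def add_pos_pos)
    \<comment> \<open>\<open>C\<close> is the offset gained in one turn. Adding \<open>k\<close>
      turns brings the offset \<open>a\<close> into the range from 0 to \<open>C\<close>; the phases
      move by a period of \<open>v\<close>, so \<open>w\<close> does not change.\<close>
    define k where "k = - \<lfloor>a / C\<rfloor>"
    define s where "s = a / C + of_int k"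
    have s: "s \<in> {0..1}" unfolding s_def k_def by (simp; linarith)
    define e where "e = 2 * int r * k"
    have \<eta>': "(\<lambda>j. \<eta> (j + e)) \<in> slope_simplex d"
      using \<eta> zero_mean_shift[OF _ d(2)] slope_shift[OF d(2), of \<eta> e] zero_meanD(1)[of \<eta> d]
      by (auto simp: slope_simplex_def)
    then have "(\<lambda>j. \<eta> (j + e)) \<in> zero_mean d" by (simp add: slope_simplex_def)
    then obtain \<xi> where \<xi>: "\<xi> \<in> zero_mean d" "swirl d r s \<xi> = (\<lambda>j. \<eta> (j + e))"
      using swirl_surj[OF d(2) s, of _ r] by blast
    then have p: "(s, \<xi>) \<in> {0..1} \<times> slope_simplex d"
      using s \<eta>' swirl_slope(2)[OF d(2) s \<xi>(1), of r] by (simp add: slope_simplex_def)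
    have "x (j + e) + of_int e = spiral d l r (s, \<xi>) j" for j
    proof -
      have "a + of_int e * (1 + of_int l / of_int d) = 2 * real r * s * (1 + of_int l / of_int d)"
      proof -
        have "C * s = a + C * of_int k" using C by (simp add: s_def distrib_left)
        then show ?thesis by (simp add: e_def C_def algebra_simps)
      qed
      then show ?thesis
        unfolding xs spread_shift[OF d(2)] by (simp add: spiral_def \<xi>(2))
    qed
    then have "merges (spiral d l r (s, \<xi>)) (\<lambda>i. \<theta> i + of_int e)"
      using merges_shift[OF x, of e] by simp
    then have th: "merge (spiral d l r (s, \<xi>)) = (\<lambda>i. \<theta> i + of_int e)"
      using merges_unique merges_merge[OF spiral_quasi_periodic[OF p] d(2) l] by blast
    have "\<forall>k. v (k + e) = v k" using r unfolding minimal_even_period_def e_def by auto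
    then have "zigzag v (\<theta> i + of_int e) = zigzag v (\<theta> i)" for i using zigzag_periodic[of v e] by simp
    then have "sample (s, \<xi>) = w"
      using w w\<theta> by (auto simp: sample_def th fun_eq_iff RN_def unroll_def zmod_int[symmetric])
        (metis mod_less nat_int of_nat_mod)
    then show "w \<in> sample ` ({0..1} \<times> slope_simplex d)" using p by blast
  qed
qed

end

lemma connected_compact_zigzag_vectors:
  assumes "int N > l" "l > 0" "alternating l v" "minimal_even_period r v"
  shows "compact (zigzag_vectors N l v)" "connected (zigzag_vectors N l v)"
proof -
  have d: "int N - l > 0" using assms(1) by simp
  note h = refl[of "int N - l"] d assms(2,3,4)
  have E: "compact ({0..1::real} \<times> slope_simplex (int N - l))" "connected ({0..1::real} \<times> slope_simplex (int N - l))"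
    using compact_slope_simplex[OF d] connected_slope_simplex[OF d] by (auto intro: compact_Times connected_Times)
  show "compact (zigzag_vectors N l v)" "connected (zigzag_vectors N l v)"
    unfolding sample_image[OF h, symmetric]
    by (intro compact_continuous_image connected_continuous_image continuous_on_sample[OF h] E)+
qed

lemma zigzag_vectors_homeomorphic:
  assumes "int N > l" "l > 0" "alternating l v" "minimal_even_period r v"
    "alternating l v'" "minimal_even_period r' v'"
  shows "zigzag_vectors N l v homeomorphic zigzag_vectors N l v'"
proof -
  have d: "int N - l > 0" using assms(1) by simp
  note h = refl[of "int N - l"] d assms(2,3,4)
  note h' = refl[of "int N - l"] d assms(2,5,6)
  have E: "compact ({0..1::real} \<times> slope_simplex (int N - l))"
    using compact_slope_simplex[OF d] by (auto intro: compact_Times)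
  show ?thesis
    unfolding sample_image[OF h, symmetric] sample_image[OF h', symmetric]
    by (intro homeomorphic_compact_quotients E continuous_on_sample[OF h] continuous_on_sample[OF h'])
       (simp only: sample_eq_iff[OF h] sample_eq_iff[OF h'])
qed

section \<open>Realizations of posets of strings\<close>

text \<open>A finite union of compact simplices, one for each chain.\<close>

lemma compact_poset_realization:
  assumes "finite P"
  shows "compact (poset_realization P lt)"
proof -
  define face where "face C = {f. \<forall>x. f x \<in> {0..(if x \<in> C then 1 else 0)}} \<inter> {f. (\<Sum>x\<in>C. f x) = (1::real)}"
    for C :: "'a set"
  define chains where "chains = {C. C \<subseteq> P \<and> (\<forall>x\<in>C. \<forall>y\<in>C. x = y \<or> lt x y \<or> lt y x)}"
  have "poset_realization P lt = (\<Union>C\<in>chains. face C)"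
  proof (intro equalityI subsetI)
    fix f assume f: "f \<in> poset_realization P lt"
    let ?C = "{x. f x \<noteq> 0}"
    have "finite ?C" using f by (simp add: poset_realization_def)
    then have "f x \<le> sum f ?C" if "x \<in> ?C" for x
      using f that by (intro member_le_sum) (auto simp: poset_realization_def)
    then have "f \<in> face ?C" using f by (auto simp: face_def poset_realization_def)
    moreover have "?C \<in> chains" using f by (auto simp: chains_def poset_realization_def)
    ultimately show "f \<in> (\<Union>C\<in>chains. face C)" by blast
  next
    fix f assume "f \<in> (\<Union>C\<in>chains. face C)"
    then obtain C where C: "C \<in> chains" "f \<in> face C" by blast
    have sub: "{x. f x \<noteq> 0} \<subseteq> C" using C(2) unfolding face_def
      by (auto split: if_splits)
    have fin: "finite C" using C(1) assms by (auto simp: chains_def intro: finite_subset)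
    have "sum f {x. f x \<noteq> 0} = sum f C" using sub fin by (intro sum.mono_neutral_left) auto
    then have "sum f {x. f x \<noteq> 0} = 1" "\<forall>x. 0 \<le> f x" using C(2) by (auto simp: face_def)
    moreover have "\<forall>x\<in>{x. f x \<noteq> 0}. \<forall>y\<in>{x. f x \<noteq> 0}. x = y \<or> lt x y \<or> lt y x" "{x. f x \<noteq> 0} \<subseteq> P"
      using C(1) sub unfolding chains_def by blast+
    ultimately show "f \<in> poset_realization P lt"
      using finite_subset[OF sub fin] unfolding poset_realization_def by blast
  qed
  moreover have "compact (face C)" for C
    unfolding face_def
    by (intro compact_Int_closed closed_Collect_eq continuous_on_sum continuous_on_product_coordinates
        continuous_on_const compact_box_fun[of "\<lambda>_. 0"])
  moreover have "finite chains" using assms unfolding chains_def by simp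
  ultimately show ?thesis by (simp add: compact_UN)
qed

lemma poset_realizationD:
  assumes "f \<in> poset_realization P lt" "finite P"
  shows "0 \<le> f x" "x \<notin> P \<Longrightarrow> f x = 0" "sum f P = 1"
    "f x \<noteq> 0 \<Longrightarrow> f y \<noteq> 0 \<Longrightarrow> x = y \<or> lt x y \<or> lt y x"
proof -
  have "sum f {x. f x \<noteq> 0} = sum f P"
    using assms by (intro sum.mono_neutral_left) (auto simp: poset_realization_def)
  then show "0 \<le> f x" "x \<notin> P \<Longrightarrow> f x = 0" "sum f P = 1"
    "f x \<noteq> 0 \<Longrightarrow> f y \<noteq> 0 \<Longrightarrow> x = y \<or> lt x y \<or> lt y x"
    using assms by (auto simp: poset_realization_def)
qed

section \<open>Barycentres and random thresholds\<close>

fun symval :: "sym \<Rightarrow> real" where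
  "symval S0 = 0" | "symval S1 = 1" | "symval SX = 1 / 2"

definition bary :: "nat \<Rightarrow> sym list set \<Rightarrow> (sym list \<Rightarrow> real) \<Rightarrow> nat \<Rightarrow> real" where
  "bary N P f i = (if i < N then \<Sum>s\<in>P. f s * symval (s ! i) else 0)"

text \<open>For positive \<open>c\<close> the first two conditions exclude each other. Raising
  \<open>c\<close> can only replace bits by \<open>SX\<close>, so the threshold strings of one
  vector form a chain.\<close>

definition threshold :: "real \<Rightarrow> real \<Rightarrow> sym" where
  "threshold c x = (if c \<le> 2 * x - 1 then S1 else if c \<le> 1 - 2 * x then S0 else SX)"

definition threshold_string :: "nat \<Rightarrow> (nat \<Rightarrow> real) \<Rightarrow> real \<Rightarrow> sym list" where
  "threshold_string N u c = map (\<lambda>i. threshold c (u i)) [0..<N]"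

definition threshold_weight :: "nat \<Rightarrow> (nat \<Rightarrow> real) \<Rightarrow> sym list \<Rightarrow> real" where
  "threshold_weight N u s = measure lborel {c \<in> {0<..1}. threshold_string N u c = s}"

lemma threshold_string_eq_iff:
  "threshold_string N u c = s \<longleftrightarrow> length s = N \<and> (\<forall>i<N. threshold c (u i) = s ! i)"
  by (auto simp: threshold_string_def list_eq_iff_nth_eq)

lemma threshold_eq_measurable: "{c \<in> {0<..1}. threshold c x = a} \<in> sets lborel"
  by (cases a) (auto simp: threshold_def cong: conj_cong)

lemma threshold_string_eq_measurable: "{c \<in> {0<..1}. threshold_string N u c = s} \<in> sets lborel"
proof (cases "length s = N")
  case True
  have "{c \<in> {0<..1}. threshold_string N u c = s} =
      {0<..1} \<inter> (\<Inter>i\<in>{..<N}. {c \<in> {0<..1}. threshold c (u i) = s ! i} \<union> - {0<..1})"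
    using True by (auto simp: threshold_string_eq_iff)
  also have "\<dots> \<in> sets lborel"
  proof (cases "N = 0")
    case False
    then show ?thesis
      using threshold_eq_measurable by (intro sets.Int sets.finite_INT sets.Un) auto
  qed simp
  finally show ?thesis .
qed (simp add: threshold_string_eq_iff)

lemma sum_threshold_weight:
  assumes "finite Q"
  shows "sum (threshold_weight N u) Q = measure lborel {c \<in> {0<..1}. threshold_string N u c \<in> Q}"
proof -
  have "emeasure lborel {c \<in> {0<..1}. threshold_string N u c = s} \<noteq> \<infinity>" for s
  proof -
    have "emeasure lborel {c \<in> {0<..1}. threshold_string N u c = s} \<le> emeasure lborel {0<..1::real}"
      by (intro emeasure_mono) auto
    then show ?thesis by (auto simp: top_unique)
  qed
  then have "measure lborel (\<Union>s\<in>Q. {c \<in> {0<..1}. threshold_string N u c = s}) = sum (threshold_weight N u) Q"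
    unfolding threshold_weight_def using assms threshold_string_eq_measurable
    by (intro measure_finite_Union) (auto simp: disjoint_family_on_def)
  moreover have "(\<Union>s\<in>Q. {c \<in> {0<..1}. threshold_string N u c = s}) = {c \<in> {0<..1}. threshold_string N u c \<in> Q}"
    by auto
  ultimately show ?thesis by simp
qed

lemma str_less_chain_symbols:
  assumes "s = s' \<or> str_less s s' \<or> str_less s' s" "i < length s"
  shows "s ! i = SX \<Longrightarrow> s' ! i = SX \<or> str_less s' s" "s ! i \<noteq> SX \<Longrightarrow> s' ! i = s ! i \<or> s' ! i = SX \<and> \<not> str_less s' s"
  using assms by (auto simp: str_less_def)

text \<open>Let \<open>B\<close> be the total weight of the strings below \<open>s\<close>. Every
  level in the interval from \<open>B\<close> to \<open>B + f s\<close> has threshold string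
  \<open>s\<close>, and this interval has length \<open>f s\<close>.\<close>

lemma weight_le_threshold_weight:
  assumes P: "finite P" "\<And>s. s \<in> P \<Longrightarrow> length s = N" and f: "f \<in> poset_realization P str_less"
  shows "f s \<le> threshold_weight N (bary N P f) s"
proof (cases "f s = 0")
  case True
  then show ?thesis by (simp add: threshold_weight_def)
next
  case False
  note fD = poset_realizationD[OF f P(1)]
  have sP: "s \<in> P" using False fD(2) by blast
  define B where "B = (\<Sum>s'\<in>{s' \<in> P. str_less s' s}. f s')"
  have B0: "0 \<le> B" unfolding B_def using fD(1) by (intro sum_nonneg)
  have Bs: "B + f s = sum f (insert s {s' \<in> P. str_less s' s})"
    unfolding B_def using P(1) by (subst sum.insert) (auto simp: str_less_def)
  also have "\<dots> \<le> sum f P" using sP P(1) fD(1) by (intro sum_mono2) auto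
  finally have B1: "B + f s \<le> 1" using fD(3) by simp
  have "threshold_string N (bary N P f) c = s" if c: "c \<in> {B<..B + f s}" for c
    unfolding threshold_string_eq_iff
  proof (intro conjI allI impI)
    show "length s = N" using P(2) sP by blast
    fix i assume i: "i < N"
    have chain: "s = s' \<or> str_less s s' \<or> str_less s' s" if "f s' \<noteq> 0" for s'
      using fD(4)[OF False that] .
    have il: "i < length s" using i P(2)[OF sP] by simp
    have "2 * bary N P f i - 1 = (\<Sum>s'\<in>P. f s' * (2 * symval (s' ! i))) - (\<Sum>s'\<in>P. f s')"
      using i fD(3) by (simp add: bary_def sum_distrib_left mult.left_commute)
    also have "\<dots> = (\<Sum>s'\<in>P. f s' * (2 * symval (s' ! i) - 1))"
      by (simp add: right_diff_distrib sum_subtractf)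
    finally have u: "2 * bary N P f i - 1 = (\<Sum>s'\<in>P. f s' * (2 * symval (s' ! i) - 1))" .
    show "threshold c (bary N P f i) = s ! i"
    proof (cases "s ! i = SX")
      case True
      \<comment> \<open>Where \<open>s\<close> has an \<open>SX\<close>, only strings strictly below
        \<open>s\<close> can carry a bit, so the doubled distance of the barycentre from
        \<open>1/2\<close> is at most \<open>B\<close>, which is less than \<open>c\<close>.\<close>
      have b: "\<bar>f s' * (2 * symval (s' ! i) - 1)\<bar> \<le> (if str_less s' s then f s' else 0)" if "s' \<in> P" for s'
      proof (cases "f s' = 0 \<or> str_less s' s")
        case True
        have "\<bar>2 * symval (s' ! i) - 1\<bar> \<le> 1" by (cases "s' ! i") auto
        then show ?thesis using True fD(1)[of s'] by (auto simp: abs_mult intro: mult_left_le)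
      next
        case False
        then have "s' ! i = SX" using str_less_chain_symbols(1)[OF chain il True] by blast
        then show ?thesis using False by simp
      qed
      have "\<bar>2 * bary N P f i - 1\<bar> \<le> (\<Sum>s'\<in>P. if str_less s' s then f s' else 0)"
        unfolding u by (rule order_trans[OF sum_abs]) (intro sum_mono b)
      also have "\<dots> = B" unfolding B_def using P(1) by (simp add: sum.inter_filter)
      finally show ?thesis using c True by (auto simp: threshold_def)
    next
      case bit: False
      define e where "e = 2 * symval (s ! i) - 1"
      have e: "e = 1 \<and> s ! i = S1 \<or> e = - 1 \<and> s ! i = S0" using bit by (cases "s ! i") (auto simp: e_def)
      \<comment> \<open>Where \<open>s\<close> has a bit, all strings below it have the same bit,
        and those above have this bit or \<open>SX\<close>. The deviation, signed by
        \<open>e\<close>, is thus at least \<open>B + f s\<close>.\<close>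
      have b: "(if s' \<in> insert s {s' \<in> P. str_less s' s} then f s' else 0) \<le> e * (f s' * (2 * symval (s' ! i) - 1))"
        if "s' \<in> P" for s'
      proof (cases "f s' = 0")
        case nz: False
        show ?thesis
        proof (cases "s' ! i = s ! i")
          case True
          then have "e * (f s' * (2 * symval (s' ! i) - 1)) = f s'" using e by (auto simp: e_def)
          then show ?thesis by (simp only:) (use fD(1)[of s'] in simp)
        next
          case False
          then have "s' ! i = SX" "\<not> str_less s' s" "s' \<noteq> s"
            using str_less_chain_symbols(2)[OF chain[OF nz] il bit] by auto
          then show ?thesis by simp
        qed
      qed simp
      have "B + f s = (\<Sum>s'\<in>P. if s' \<in> insert s {s' \<in> P. str_less s' s} then f s' else 0)"
        unfolding Bs using P(1) sP by (subst sum.inter_restrict[symmetric]) (auto intro: arg_cong2[where f=sum])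
      also have "\<dots> \<le> (\<Sum>s'\<in>P. e * (f s' * (2 * symval (s' ! i) - 1)))" by (intro sum_mono b)
      also have "\<dots> = e * (2 * bary N P f i - 1)" unfolding u by (simp add: sum_distrib_left)
      finally have "c \<le> e * (2 * bary N P f i - 1)" using c by simp
      then show ?thesis using e c B0 by (auto simp: threshold_def)
    qed
  qed
  then have sub: "{B<..B + f s} \<subseteq> {c \<in> {0<..1}. threshold_string N (bary N P f) c = s}"
    using B0 B1 by auto
  have "f s = measure lborel {B<..B + f s}" using fD(1)[of s] by simp
  also have "\<dots> \<le> measure lborel {c \<in> {0<..1}. threshold_string N (bary N P f) c = s}"
  proof (intro measure_mono_fmeasurable sub)
    show "{c \<in> {0<..1}. threshold_string N (bary N P f) c = s} \<in> fmeasurable lborel"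
      by (rule fmeasurableI2[of "{0<..1::real}"]) (use threshold_string_eq_measurable in \<open>auto simp: fmeasurable_def\<close>)
  qed simp
  finally show ?thesis by (simp add: threshold_weight_def)
qed

text \<open>A point of the realization is recovered from its barycentre as the distribution of the
  threshold string at a uniformly random level.\<close>

lemma bary_inj:
  assumes P: "finite P" "\<And>s. s \<in> P \<Longrightarrow> length s = N"
  shows "inj_on (bary N P) (poset_realization P str_less)"
proof -
  have eq: "f s = threshold_weight N (bary N P f) s" if f: "f \<in> poset_realization P str_less" and s: "s \<in> P" for f s
  proof -
    \<comment> \<open>The threshold weights dominate \<open>f\<close> termwise. Since they sum to at
      most 1, the sum of \<open>f\<close>, equality holds in every term.\<close>
    have "sum (threshold_weight N (bary N P f)) P \<le> 1"
    proof -
      have "measure lborel {c \<in> {0<..1}. threshold_string N (bary N P f) c \<in> P} \<le> measure lborel {0<..1::real}"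
      proof (intro measure_mono_fmeasurable)
        have "{c \<in> {0<..1}. threshold_string N (bary N P f) c \<in> P}
          = (\<Union>s\<in>P. {c \<in> {0<..1}. threshold_string N (bary N P f) c = s})" by auto
        then show "{c \<in> {0<..1}. threshold_string N (bary N P f) c \<in> P} \<in> sets lborel"
          using P(1) threshold_string_eq_measurable by auto
      qed (auto simp: fmeasurable_def)
      then show ?thesis by (simp add: sum_threshold_weight[OF P(1)])
    qed
    then have le: "sum (threshold_weight N (bary N P f)) P \<le> sum f P"
      using poset_realizationD(3)[OF f P(1)] by simp
    show ?thesis
    proof (rule ccontr)
      assume "f s \<noteq> threshold_weight N (bary N P f) s"
      then have "f s < threshold_weight N (bary N P f) s"
        using weight_le_threshold_weight[OF P f, of s] by linarith
      then have "sum f P < sum (threshold_weight N (bary N P f)) P"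
        using s weight_le_threshold_weight[OF P f] by (intro sum_strict_mono_ex1 P(1)) auto
      then show False using le by simp
    qed
  qed
  show ?thesis
  proof (rule inj_onI, rule ext)
    fix f g s assume *: "f \<in> poset_realization P str_less" "g \<in> poset_realization P str_less" "bary N P f = bary N P g"
    show "f s = g s"
      using eq[OF *(1), of s] eq[OF *(2), of s] *(3) poset_realizationD(2)[OF *(1) P(1), of s]
        poset_realizationD(2)[OF *(2) P(1), of s] by (cases "s \<in> P") auto
  qed
qed

lemma measure_threshold:
  assumes "0 \<le> x" "x \<le> 1"
  shows "measure lborel {c \<in> {0<..1}. threshold c x = S1} = max 0 (2 * x - 1)"
    "measure lborel {c \<in> {0<..1}. threshold c x = SX} = 1 - \<bar>2 * x - 1\<bar>"
proof -
  have "{c \<in> {0<..1}. threshold c x = S1} = {0<..max 0 (2 * x - 1)}"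
    using assms by (auto simp: threshold_def)
  then show "measure lborel {c \<in> {0<..1}. threshold c x = S1} = max 0 (2 * x - 1)" by simp
  have "{c \<in> {0<..1}. threshold c x = SX} = {\<bar>2 * x - 1\<bar><..1}"
    using assms by (auto simp: threshold_def)
  then show "measure lborel {c \<in> {0<..1}. threshold c x = SX} = 1 - \<bar>2 * x - 1\<bar>" using assms by simp
qed

text \<open>The threshold strings of \<open>u\<close> at a uniform level form a chain, and their
  distribution is the required weighting. In coordinate \<open>i\<close>, the probability of
  \<open>S1\<close> plus half that of \<open>SX\<close> is \<open>max 0 (2 * u i - 1) + (1 - \<bar>2
  * u i - 1\<bar>) / 2 = u i\<close>.\<close>

lemma bary_surj:
  assumes P: "finite P" and u: "\<And>i. i < N \<Longrightarrow> u i \<in> {0..1}" "\<And>i. i \<ge> N \<Longrightarrow> u i = 0"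
    and thr: "\<And>c. c \<in> {0<..1} \<Longrightarrow> threshold_string N u c \<in> P"
  shows "u \<in> bary N P ` poset_realization P str_less"
proof (rule image_eqI)
  let ?f = "threshold_weight N u"
  have supp: "\<exists>c\<in>{0<..1}. threshold_string N u c = s" if "?f s \<noteq> 0" for s
  proof (rule ccontr)
    assume "\<not> ?thesis"
    then have "{c \<in> {0<..1}. threshold_string N u c = s} = {}" by blast
    then show False using that unfolding threshold_weight_def by (simp only: measure_empty)
  qed
  have inP: "s \<in> P" if "?f s \<noteq> 0" for s using supp[OF that] thr by blast
  have lt: "threshold_string N u c = threshold_string N u c' \<or> str_less (threshold_string N u c) (threshold_string N u c')"
    if "0 < c" "c \<le> c'" for c c'
    using that unfolding str_less_def threshold_string_def by (auto simp: threshold_def)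
  have "{c \<in> {0<..1}. threshold_string N u c \<in> P} = {0<..1}" using thr by auto
  then have tot: "sum ?f P = 1" using sum_threshold_weight[OF P, of N u] by simp
  have "sum ?f {s. ?f s \<noteq> 0} = sum ?f P" using inP P by (intro sum.mono_neutral_left) auto
  moreover have "finite {s. ?f s \<noteq> 0}" using inP by (intro finite_subset[OF _ P]) auto
  moreover have "\<forall>x\<in>{s. ?f s \<noteq> 0}. \<forall>y\<in>{s. ?f s \<noteq> 0}. x = y \<or> str_less x y \<or> str_less y x"
  proof clarify
    fix x y assume xy: "?f x \<noteq> 0" "?f y \<noteq> 0" "x \<noteq> y" "\<not> str_less y x"
    obtain c where c: "c \<in> {0<..1}" "threshold_string N u c = x" using supp[OF xy(1)] by blast
    obtain c' where c': "c' \<in> {0<..1}" "threshold_string N u c' = y" using supp[OF xy(2)] by blast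
    show "str_less x y" using lt[of c c'] lt[of c' c] c c' xy(3,4) by (cases "c \<le> c'") auto
  qed
  ultimately show "?f \<in> poset_realization P str_less"
    using tot inP by (auto simp: poset_realization_def threshold_weight_def)
  show "u = bary N P ?f"
  proof
    fix i show "u i = bary N P ?f i"
    proof (cases "i < N")
      case True
      have m: "sum ?f {s \<in> P. s ! i = a} = measure lborel {c \<in> {0<..1}. threshold c (u i) = a}" for a
      proof -
        have "threshold_string N u c ! i = threshold c (u i)" for c using True by (simp add: threshold_string_def)
        then have "{c \<in> {0<..1}. threshold_string N u c \<in> {s \<in> P. s ! i = a}} = {c \<in> {0<..1}. threshold c (u i) = a}"
          using thr by auto
        then show ?thesis using sum_threshold_weight[of "{s \<in> P. s ! i = a}" N u] P by simp
      qed
      have "bary N P ?f i = (\<Sum>s\<in>P. (if s ! i = S1 then ?f s else 0) + (if s ! i = SX then ?f s else 0) / 2)"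
        unfolding bary_def using True by (auto intro!: sum.cong split: if_splits) (metis mult_zero_right symval.simps sym.exhaust)
      also have "\<dots> = sum ?f {s \<in> P. s ! i = S1} + sum ?f {s \<in> P. s ! i = SX} / 2"
        using P by (simp add: sum.distrib sum.inter_filter sum_divide_distrib)
      also have "\<dots> = max 0 (2 * u i - 1) + (1 - \<bar>2 * u i - 1\<bar>) / 2"
        unfolding m using measure_threshold[of "u i"] u(1)[OF True] by simp
      also have "\<dots> = u i" by (simp add: max_def abs_if field_simps)
      finally show ?thesis by simp
    qed (simp add: bary_def u(2))
  qed
qed

section \<open>Lifts of circular cellular strings\<close>

definition sym_of :: "int \<Rightarrow> sym" where
  "sym_of k = (if k mod 4 = 0 then S0 else if k mod 4 = 2 then S1 else SX)"

lemma sym_of_SX_iff: "sym_of k = SX \<longleftrightarrow> odd k"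
  unfolding sym_of_def by (auto; presburger)

lemma sym_of_eq_bit: "sym_of k = sym_of k' \<Longrightarrow> even k \<Longrightarrow> 4 dvd k - k'"
  unfolding sym_of_def by (auto split: if_splits; presburger)

lemma sym_of_add_4 [simp]: "sym_of (k + 4 * m) = sym_of k"
  by (simp add: sym_of_def)

lemma sym_of_add_2: "even k \<Longrightarrow> sym_of (k + 2) \<noteq> sym_of k"
  unfolding sym_of_def by (auto split: if_splits; presburger)

definition cyc :: "sym list \<Rightarrow> int \<Rightarrow> sym" where
  "cyc s i = s ! nat (i mod int (length s))"

text \<open>A lift records twice the phase of each position: multiples of 4 are the blocks of \<open>S0\<close>, the
  other even numbers are the blocks of \<open>S1\<close>, and odd numbers are the blocks of \<open>SX\<close>.\<close>

definition lifts :: "nat \<Rightarrow> nat \<Rightarrow> sym list \<Rightarrow> (int \<Rightarrow> int) \<Rightarrow> bool" where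
  "lifts N M s K \<longleftrightarrow> length s = N \<and> (\<lambda>i. of_int (K i) / 2) \<in> phases (int N) (2 * int M) \<and>
     (\<forall>i. sym_of (K i) = cyc s i)"

lemma half_phases_iff:
  "(\<lambda>i. of_int (K i) / 2) \<in> phases n (2 * m) \<longleftrightarrow>
    (\<forall>i. K i \<le> K (i + 1)) \<and> (\<forall>i. K (i + n) = K i + 4 * m) \<and> (\<forall>i. K (i + 1) \<le> 2 * (K i div 2) + 2)"
proof -
  have fl: "\<lfloor>real_of_int k / 2\<rfloor> = k div 2" for k
    using floor_divide_of_int_eq[of k 2] by simp
  have 1: "real_of_int a / 2 = real_of_int b / 2 + real_of_int (2 * m) \<longleftrightarrow> a = b + 4 * m" for a b
  proof -
    have "real_of_int a / 2 = real_of_int b / 2 + real_of_int (2 * m) \<longleftrightarrow> real_of_int a = real_of_int (b + 4 * m)"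
      by auto
    then show ?thesis by linarith
  qed
  have 2: "real_of_int a / 2 \<le> real_of_int b + 1 \<longleftrightarrow> a \<le> 2 * b + 2" for a b
  proof -
    have "real_of_int a / 2 \<le> real_of_int b + 1 \<longleftrightarrow> real_of_int a \<le> real_of_int (2 * b + 2)" by auto
    then show ?thesis by linarith
  qed
  show ?thesis unfolding phases_def quasi_periodic_def mem_Collect_eq fl 1 2
    by (auto simp: divide_right_mono)
qed

lemma liftsD:
  assumes "lifts N M s K"
  shows "length s = N" "K i \<le> K (i + 1)" "K (i + int N) = K i + 4 * int M"
    "K (i + 1) \<le> 2 * (K i div 2) + 2" "sym_of (K i) = cyc s i"
  using assms by (auto simp: lifts_def half_phases_iff)

lemma lifts_period_mult: "lifts N M s K \<Longrightarrow> K (i + q * int N) = K i + q * (4 * int M)"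
  using int_period_mult[of K "int N" "4 * int M" i q] liftsD(3) by simp

lemma cat_eq_cyc: "s \<noteq> [] \<Longrightarrow> cat s i = cyc s (int i)"
  by (simp add: cat_def cyc_def nat_mod_distrib flip: zmod_int)

lemma cyc_nth: "i < length s \<Longrightarrow> cyc s (int i) = s ! i"
  by (simp add: cyc_def nat_mod_distrib)

lemma cyc_periodic [simp]: "cyc s (i + int (length s)) = cyc s i"
  by (simp add: cyc_def)

lemma cat_pred: "s \<noteq> [] \<Longrightarrow> cat s (i + length s - 1) = cyc s (int i - 1)"
proof -
  assume s: "s \<noteq> []"
  then have "int (i + length s - 1) = (int i - 1) + int (length s)"
    by (cases s) auto
  then show ?thesis using cat_eq_cyc[OF s, of "i + length s - 1"] by simp
qed

section \<open>From lifts to strings\<close>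

lemma card_parity_interval:
  assumes "o' \<in> {0, 1}"
  shows "card {k \<in> {c<..c + 2 * int M}. k mod 2 = o'} = M"
proof (induction M)
  case (Suc M)
  let ?A = "{k \<in> {c<..c + 2 * int M}. k mod 2 = o'}"
  define e where "e = (if (c + 2 * int M + 1) mod 2 = o' then c + 2 * int M + 1 else c + 2 * int M + 2)"
  have "{k \<in> {c<..c + 2 * int (Suc M)}. k mod 2 = o'} = insert e ?A"
  proof (intro set_eqI)
    fix k
    have "k \<in> {c<..c + 2 * int (Suc M)} \<longleftrightarrow> k \<in> {c<..c + 2 * int M} \<or> k = c + 2 * int M + 1 \<or> k = c + 2 * int M + 2"
      by auto
    moreover have "(c + 2 * int M + 1) mod 2 = o' \<longleftrightarrow> (c + 2 * int M + 2) mod 2 \<noteq> o'" using assms by auto presburger+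
    ultimately show "k \<in> {k \<in> {c<..c + 2 * int (Suc M)}. k mod 2 = o'} \<longleftrightarrow> k \<in> insert e ?A"
      unfolding e_def by (auto split: if_splits)
  qed
  moreover have "e \<notin> ?A" by (auto simp: e_def)
  moreover have "finite ?A" by (rule finite_subset[of _ "{c<..c + 2 * int M}"]) auto
  ultimately show ?case using Suc by simp
qed simp

text \<open>Blocks of bits start exactly where \<open>K\<close> first reaches an even number
  \<open>2 * k\<close>, and the parity of \<open>k\<close> is the bit. One period of
  \<open>K\<close> covers \<open>2 * M\<close> consecutive \<open>k\<close>, hence \<open>M\<close>
  of each parity.\<close>

lemma lifts_block_starts:
  assumes K: "lifts N M s K" and NM: "N > 0" "M > 0" and o: "o' \<in> {0, 1}"
  shows "card {i. i < N \<and> cyc s (int i) = sym_of (2 * o') \<and> cyc s (int i - 1) \<noteq> sym_of (2 * o')} = M"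
proof -
  let ?\<theta> = "\<lambda>i. real_of_int (K i) / 2"
  have \<theta>: "?\<theta> \<in> phases (int N) (2 * int M)" using K by (simp add: lifts_def)
  have fl: "\<lfloor>real_of_int k / 2\<rfloor> = k div 2" for k
    using floor_divide_of_int_eq[of k 2] by simp
  have "\<exists>a. K a = 2 * k \<and> (\<forall>i. k \<le> K i div 2 \<longleftrightarrow> a \<le> i)" for k
  proof -
    obtain a where "?\<theta> a = of_int k" "\<And>i. k \<le> \<lfloor>?\<theta> i\<rfloor> \<longleftrightarrow> a \<le> i"
      by (rule phases_first_hit[OF \<theta>, of k]) (use NM in auto)
    moreover from this have "real_of_int (K a) = real_of_int (2 * k)" by simp
    ultimately show ?thesis by (metis fl of_int_eq_iff)
  qed
  then obtain a where a: "\<And>k. K (a k) = 2 * k" "\<And>k i. k \<le> K i div 2 \<longleftrightarrow> a k \<le> i" by metis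
  have start: "cyc s i = sym_of (2 * o') \<and> cyc s (i - 1) \<noteq> sym_of (2 * o') \<longleftrightarrow> (\<exists>k. k mod 2 = o' \<and> a k = i)" for i
  proof
    assume *: "cyc s i = sym_of (2 * o') \<and> cyc s (i - 1) \<noteq> sym_of (2 * o')"
    then have "sym_of (2 * o') = sym_of (K i)" using liftsD(5)[OF K] by simp
    then have "4 dvd 2 * o' - K i" using sym_of_eq_bit[of "2 * o'" "K i"] by simp
    then have "K i = 2 * (K i div 2)" "(K i div 2) mod 2 = o'" using o by (auto; presburger)+
    then obtain k where k: "K i = 2 * k" "k mod 2 = o'" by blast
    have "a k \<le> i" using a(2)[of k i] k by simp
    moreover have "\<not> a k \<le> i - 1"
    proof
      assume "a k \<le> i - 1"
      then have "k \<le> K (i - 1) div 2" using a(2) by blast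
      then have "K (i - 1) = K i" using liftsD(2)[OF K, of "i - 1"] k by simp
      then show False using * liftsD(5)[OF K] by metis
    qed
    ultimately show "\<exists>k. k mod 2 = o' \<and> a k = i" using k by (intro exI[of _ k]) simp
  next
    assume "\<exists>k. k mod 2 = o' \<and> a k = i"
    then obtain k where k: "k mod 2 = o'" "a k = i" by blast
    have "2 * k = 2 * o' + 4 * (k div 2)" using k(1) by presburger
    then have s2: "sym_of (2 * k) = sym_of (2 * o')" by (metis sym_of_add_4)
    then have 1: "cyc s i = sym_of (2 * o')" using a(1)[of k] k(2) liftsD(5)[OF K, of i] by simp
    have "\<not> k \<le> K (i - 1) div 2" using a(2)[of k "i - 1"] k(2) by simp
    moreover have "K i = 2 * k" using a(1) k(2) by blast
    ultimately have "K (i - 1) < K i" "K i \<le> K (i - 1) + 2" using liftsD(4)[OF K, of "i - 1"] by auto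
    then have "\<not> 4 dvd K i - K (i - 1)" by presburger
    then have "sym_of (K i) \<noteq> sym_of (K (i - 1))"
      using sym_of_eq_bit[of "K i" "K (i - 1)"] \<open>K i = 2 * k\<close> by auto
    then show "cyc s i = sym_of (2 * o') \<and> cyc s (i - 1) \<noteq> sym_of (2 * o')"
      using 1 liftsD(5)[OF K] by metis
  qed
  define c where "c = K (- 1) div 2"
  have ge: "0 \<le> a k \<longleftrightarrow> c < k" for k using a(2)[of k "- 1"] unfolding c_def by linarith
  have "K (int N - 1) = K (- 1) + 4 * int M" using liftsD(3)[OF K, of "- 1"] by simp
  then have "K (int N - 1) div 2 = c + 2 * int M" unfolding c_def by simp
  then have le: "a k < int N \<longleftrightarrow> k \<le> c + 2 * int M" for k using a(2)[of k "int N - 1"] by linarith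
  let ?B = "{k \<in> {c<..c + 2 * int M}. k mod 2 = o'}"
  have "{i. i < N \<and> cyc s (int i) = sym_of (2 * o') \<and> cyc s (int i - 1) \<noteq> sym_of (2 * o')} = (nat \<circ> a) ` ?B"
  proof (intro set_eqI iffI)
    fix i assume "i \<in> {i. i < N \<and> cyc s (int i) = sym_of (2 * o') \<and> cyc s (int i - 1) \<noteq> sym_of (2 * o')}"
    then obtain k where k: "i < N" "k mod 2 = o'" "a k = int i" using start by auto
    then have "k \<in> ?B" using ge[of k] le[of k] by simp
    then show "i \<in> (nat \<circ> a) ` ?B" using k(3) by force
  next
    fix i assume "i \<in> (nat \<circ> a) ` ?B"
    then obtain k where k: "k \<in> ?B" "i = nat (a k)" by auto
    then have "0 \<le> a k" "a k < int N" using ge[of k] le[of k] by auto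
    then show "i \<in> {i. i < N \<and> cyc s (int i) = sym_of (2 * o') \<and> cyc s (int i - 1) \<noteq> sym_of (2 * o')}"
      using k start[of "a k"] by auto
  qed
  moreover have "inj_on (nat \<circ> a) ?B"
  proof (rule inj_onI)
    fix k k' assume *: "k \<in> ?B" "k' \<in> ?B" "(nat \<circ> a) k = (nat \<circ> a) k'"
    then have "0 \<le> a k" "0 \<le> a k'" using ge by auto
    then have "a k = a k'" using *(3) by simp
    then show "k = k'" using a(1) by (metis mult_cancel_left zero_neq_numeral)
  qed
  ultimately show ?thesis using card_parity_interval[OF o, of c M] by (simp only: card_image)
qed

text \<open>Along a run of \<open>SX\<close> the lift is odd, hence constant; it is one more than
  before the run and one less than after it. The bits at the two ends have lifts differing by 2, so
  they differ.\<close>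

lemma lifts_xblock:
  assumes K: "lifts N M s K" and p: "cyc s p \<noteq> SX" and q: "cyc s q \<noteq> SX" and "p < q"
    and X: "\<And>j. p < j \<Longrightarrow> j < q \<Longrightarrow> cyc s j = SX" and "p + 1 < q"
  shows "cyc s p \<noteq> cyc s q"
proof -
  have even: "even (K j) \<longleftrightarrow> cyc s j \<noteq> SX" for j using sym_of_SX_iff[of "K j"] liftsD(5)[OF K, of j] by auto
  have run: "K j = K p + 1" if "p + 1 \<le> j" "j < q" for j
    using that
  proof (induction j rule: int_ge_induct)
    case base
    have "odd (K (p + 1))" "even (K p)" using even X p base by auto
    then show ?case using liftsD(2,4)[OF K, of p] by presburger
  next
    case (step j)
    have "odd (K (j + 1))" "odd (K j)" using even[of j] even[of "j + 1"] X[of j] X[of "j + 1"] step by auto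
    then have "K (j + 1) = K j" using liftsD(2,4)[OF K, of j] by presburger
    then show ?case using step by simp
  qed
  have "K (q - 1) = K p + 1" using run \<open>p + 1 < q\<close> by simp
  moreover have "even (K q)" "even (K p)" using even p q by auto
  moreover have "K (q - 1) \<le> K q" "K q \<le> 2 * (K (q - 1) div 2) + 2" using liftsD(2,4)[OF K, of "q - 1"] by simp_all
  ultimately have "K q = K p + 2" by presburger
  then show ?thesis using sym_of_add_2[of "K p"] \<open>even (K p)\<close> liftsD(5)[OF K] by metis
qed

lemma lifts_imp_Str:
  assumes K: "lifts N M s K" and NM: "N > 0" "M > 0"
  shows "s \<in> Str N M"
proof -
  have len: "length s = N" using liftsD(1)[OF K] .
  have ne: "s \<noteq> []" using len NM by auto
  have nb: "nblocks s (sym_of (2 * o')) = M" if o: "o' \<in> {0, 1}" for o'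
  proof -
    have c0: "card {i. i < N \<and> cyc s (int i) = sym_of (2 * o') \<and> cyc s (int i - 1) \<noteq> sym_of (2 * o')} = M"
      by (rule lifts_block_starts[OF K NM o])
    \<comment> \<open>The special clause of \<open>nblocks\<close> for constant strings does not
      apply: since \<open>M > 0\<close> there is a block start, and its predecessor is a different
      symbol.\<close>
    then have "{i. i < N \<and> cyc s (int i) = sym_of (2 * o') \<and> cyc s (int i - 1) \<noteq> sym_of (2 * o')} \<noteq> {}"
      using NM by (metis card.empty less_irrefl)
    then obtain i where i: "i < N" "cyc s (int i - 1) \<noteq> sym_of (2 * o')" by blast
    have "nat ((int i - 1) mod int N) < N" using NM by (simp add: nat_less_iff)
    then have "\<not> (\<forall>i<length s. s ! i = sym_of (2 * o'))" using i len by (auto simp: cyc_def)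
    moreover have "{i. i < length s \<and> s ! i = sym_of (2 * o') \<and> cat s (i + length s - 1) \<noteq> sym_of (2 * o')}
      = {i. i < N \<and> cyc s (int i) = sym_of (2 * o') \<and> cyc s (int i - 1) \<noteq> sym_of (2 * o')}"
      using len cat_pred[OF ne] cyc_nth[of _ s] by auto
    ultimately show ?thesis using c0 unfolding nblocks_def by (simp only: if_False simp_thms)
  qed
  have "xblocks_ok s" unfolding xblocks_ok_def
  proof (intro allI impI, elim conjE)
    fix i k assume *: "i < length s" "k < length s" "s ! i = SX" "cat s (i + length s - 1) \<noteq> SX"
      "\<forall>l\<le>k. cat s (i + l) = SX" "cat s (i + k + 1) \<noteq> SX"
    have "cyc s (int i - 1) \<noteq> cyc s (int (i + k + 1))"
    proof (rule lifts_xblock[OF K])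
      fix j assume j: "int i - 1 < j" "j < int (i + k + 1)"
      then have "cat s (i + nat (j - int i)) = SX" using *(5) by auto
      then show "cyc s j = SX" using cat_eq_cyc[OF ne, of "i + nat (j - int i)"] j by simp
    qed (use * cat_pred[OF ne, of i] cat_eq_cyc[OF ne, of "i + k + 1"] in auto)
    then show "cat s (i + length s - 1) \<noteq> cat s (i + k + 1)"
      using cat_pred[OF ne, of i] cat_eq_cyc[OF ne, of "i + k + 1"] by simp
  qed
  moreover have "sym_of (2 * 0) = S0" "sym_of (2 * 1) = S1" by (simp_all add: sym_of_def)
  ultimately show ?thesis using nb[of 0] nb[of 1] len by (simp add: Str_def)
qed

section \<open>From strings to lifts\<close>

lemma Str_xblock:
  assumes ok: "xblocks_ok s" and ne: "s \<noteq> []" and p: "cyc s p \<noteq> SX" and q: "cyc s q \<noteq> SX"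
    and X: "\<And>j. p < j \<Longrightarrow> j < q \<Longrightarrow> cyc s j = SX" and pq: "p + 1 < q"
  shows "cyc s p \<noteq> cyc s q"
proof -
  let ?n = "int (length s)"
  have n: "?n > 0" using ne by simp
  have mod: "cyc s (j mod ?n + m) = cyc s (j + m)" for j m by (simp add: cyc_def mod_add_left_eq)
  define i where "i = nat ((p + 1) mod ?n)"
  have ii: "int i = (p + 1) mod ?n" using n by (simp add: i_def)
  define k where "k = nat (q - p - 2)"
  have k: "int k = q - p - 2" using pq by (simp add: k_def)
  \<comment> \<open>The run cannot go all the way round, because the bit at \<open>p\<close> occurs
    again one period later.\<close>
  have "k < length s"
  proof (rule ccontr)
    assume "\<not> k < length s"
    then have "p + ?n < q" using k by linarith
    then have "cyc s (p + ?n) = SX" using X[of "p + ?n"] n by linarith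
    then show False using p by simp
  qed
  moreover have "i < length s" using n ii by (metis nat_less_iff i_def pos_mod_bound pos_mod_sign)
  moreover have prev: "cat s (i + length s - 1) = cyc s p"
    using cat_pred[OF ne, of i] ii mod[of "p + 1" "- 1"] by simp
  moreover have at: "cat s (i + l) = cyc s (p + 1 + int l)" for l
    using cat_eq_cyc[OF ne, of "i + l"] ii mod[of "p + 1" "int l"] by simp
  moreover have "s ! i = SX" using cyc_nth[of i s] \<open>i < length s\<close> at[of 0] cat_eq_cyc[OF ne, of i] X[of "p + 1"] pq by simp
  moreover have "\<forall>l\<le>k. cat s (i + l) = SX" using X k unfolding at by simp
  moreover have nxt: "cat s (i + k + 1) = cyc s q" using at[of "k + 1"] k by simp
  ultimately show ?thesis using ok p q unfolding xblocks_ok_def by (metis)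
qed

lemma Str_starts_sum:
  assumes "s \<in> Str N M" "N > 0" "M > 0" "a \<noteq> SX"
  shows "(\<Sum>j\<in>{0..<int N}. of_bool (cyc s j = a \<and> cyc s (j - 1) \<noteq> a)) = int M"
proof -
  have len: "length s = N" and nb: "nblocks s S0 = M" "nblocks s S1 = M" using assms(1) by (auto simp: Str_def)
  have ne: "s \<noteq> []" using len assms(2) by auto
  have na: "nblocks s a = M" using nb assms(4) by (cases a) auto
  have "\<not> (\<forall>i<length s. s ! i = a)"
  proof
    assume all: "\<forall>i<length s. s ! i = a"
    obtain b where b: "b \<noteq> a" "nblocks s b = M" using nb assms(4) by (cases a) auto
    have "\<not> (\<forall>i<length s. s ! i = b)" using all b(1) ne by force
    then have "nblocks s b = card {i. i < length s \<and> s ! i = b \<and> cat s (i + length s - 1) \<noteq> b}"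
      unfolding nblocks_def by (simp only: if_False simp_thms)
    also have "{i. i < length s \<and> s ! i = b \<and> cat s (i + length s - 1) \<noteq> b} = {}" using all b(1) by auto
    finally show False using b(2) assms(3) by simp
  qed
  then have "card {i. i < length s \<and> s ! i = a \<and> cat s (i + length s - 1) \<noteq> a} = M"
    using na unfolding nblocks_def by auto
  moreover have "{i. i < length s \<and> s ! i = a \<and> cat s (i + length s - 1) \<noteq> a}
      = {i \<in> {..<N}. cyc s (int i) = a \<and> cyc s (int i - 1) \<noteq> a}"
    using len cat_pred[OF ne] cyc_nth[of _ s] by auto
  ultimately have "card {i \<in> {..<N}. cyc s (int i) = a \<and> cyc s (int i - 1) \<noteq> a} = M" by simp
  then have "(\<Sum>i<N. of_bool (cyc s (int i) = a \<and> cyc s (int i - 1) \<noteq> a)) = int M"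
    by (simp add: sum_of_bool_eq Int_def)
  moreover have "{0..<int N} = int ` {..<N}" using image_int_atLeastLessThan[of 0 N] by (simp add: atLeast0LessThan)
  ultimately show ?thesis by (simp only: sum.reindex[OF inj_on_of_nat] o_def)
qed

text \<open>Ends and starts of blocks differ by the increments of a periodic indicator, which cancel
  around the circle.\<close>

lemma Str_ends_sum:
  assumes "s \<in> Str N M" "N > 0" "M > 0" "a \<noteq> SX"
  shows "(\<Sum>j\<in>{0..<int N}. of_bool (cyc s j = a \<and> cyc s (j + 1) \<noteq> a)) = int M"
    and "(\<Sum>j\<in>{0..<int N}. of_bool (cyc s (j + 1) = a \<and> cyc s j \<noteq> a)) = int M"
proof -
  have len: "length s = N" using assms(1) by (auto simp: Str_def)
  have per: "cyc s (j + int N) = cyc s j" for j using len cyc_periodic[of s j] by simp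
  have sh: "(\<Sum>j\<in>{0..<int N}. g (j + 1)) = (\<Sum>j\<in>{0..<int N}. g j)" if "\<And>j. g (j + int N) = g j" for g :: "int \<Rightarrow> int"
    using periodic_sum_shift[of g "int N" 1, OF that] assms(2) by simp
  have "cyc s (j + int N - 1) = cyc s (j - 1)" for j using per[of "j - 1"] by (simp add: algebra_simps)
  then have "(\<Sum>j\<in>{0..<int N}. of_bool (cyc s (j + 1) = a \<and> cyc s (j + 1 - 1) \<noteq> a)) = int M"
    using sh[of "\<lambda>j. of_bool (cyc s j = a \<and> cyc s (j - 1) \<noteq> a)"] Str_starts_sum[OF assms] per by simp
  then show 2: "(\<Sum>j\<in>{0..<int N}. of_bool (cyc s (j + 1) = a \<and> cyc s j \<noteq> a)) = int M" by simp
  have "of_bool (cyc s j = a \<and> cyc s (j + 1) \<noteq> a) = of_bool (cyc s (j + 1) = a \<and> cyc s j \<noteq> a)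
      + (of_bool (cyc s j = a) - of_bool (cyc s (j + 1) = a) :: int)" for j by auto
  then show "(\<Sum>j\<in>{0..<int N}. of_bool (cyc s j = a \<and> cyc s (j + 1) \<noteq> a)) = int M"
    using 2 sh[of "\<lambda>j. of_bool (cyc s j = a)"] per by (simp add: sum.distrib sum_subtractf)
qed

text \<open>The increment counts 1 for leaving a bit and 1 for entering one, so that consecutive
  bits are 2 apart with or without an \<open>SX\<close> run between them. The block counts give the
  increase \<open>4 * M\<close> per period; the condition on \<open>SX\<close> blocks ensures that
  the next bit has the right residue modulo 4.\<close>

lemma Str_imp_lifts:
  assumes s: "s \<in> Str N M" and NM: "N > 0" "M > 0" and bit: "cyc s a \<noteq> SX" and c: "sym_of c = cyc s a"
  obtains K where "lifts N M s K" "K a = c"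
proof -
  let ?y = "cyc s"
  have len: "length s = N" and ok: "xblocks_ok s" using s by (auto simp: Str_def)
  have ne: "s \<noteq> []" using len NM by auto
  have per: "?y (j + int N) = ?y j" for j using len cyc_periodic[of s j] by simp
  define \<delta> :: "int \<Rightarrow> int" where
    "\<delta> i = of_bool (?y i \<noteq> SX \<and> ?y (i + 1) \<noteq> ?y i) + of_bool (?y (i + 1) \<noteq> SX \<and> ?y (i + 1) \<noteq> ?y i)" for i
  obtain K where K: "\<And>i. K (i + 1) = K i + \<delta> i" "K a = c" using int_primitive[of \<delta> a c] by metis
  have total: "(\<Sum>j\<in>{0..<int N}. \<delta> j) = 4 * int M"
  proof -
    have "\<delta> j = of_bool (?y j = S0 \<and> ?y (j + 1) \<noteq> S0) + of_bool (?y j = S1 \<and> ?y (j + 1) \<noteq> S1)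
       + of_bool (?y (j + 1) = S0 \<and> ?y j \<noteq> S0) + of_bool (?y (j + 1) = S1 \<and> ?y j \<noteq> S1)" for j
      by (cases "?y j"; cases "?y (j + 1)") (auto simp: \<delta>_def)
    then show ?thesis using Str_ends_sum[OF s NM, of S0] Str_ends_sum[OF s NM, of S1] by (simp add: sum.distrib)
  qed
  have perK: "K (i + int N) = K i + 4 * int M" for i
  proof -
    have k: "K (i + int k) = K i + (\<Sum>j\<in>{0..<int k}. \<delta> (j + i))" for k
    proof (induction k)
      case (Suc k)
      have "{0..<int (Suc k)} = insert (int k) {0..<int k}" by auto
      then show ?case using K(1)[of "i + int k"] Suc by (simp add: ac_simps)
    qed simp
    have "\<delta> (j + int N) = \<delta> j" for j
      using per[of j] per[of "j + 1"] by (simp add: \<delta>_def ac_simps)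
    then have "(\<Sum>j\<in>{0..<int N}. \<delta> (j + i)) = 4 * int M"
      using periodic_sum_shift[of \<delta> "int N" i] NM total by simp
    then show ?thesis using k[of N] by simp
  qed
  \<comment> \<open>Both odd residues modulo 4 stand for \<open>SX\<close>, so inside a run the
    symbol does not tell which bit comes next. The invariant therefore remembers the last bit before
    the run. It is proved to the right of \<open>a\<close> and extended by periodicity.\<close>
  have inv: "sym_of (K i) = ?y i \<and>
      (?y i = SX \<longrightarrow> (\<exists>p<i. (\<forall>j. p < j \<longrightarrow> j \<le> i \<longrightarrow> ?y j = SX) \<and> ?y p = sym_of (K i - 1)))"
    if "a \<le> i" for i
    using that
  proof (induction i rule: int_ge_induct)
    case base
    then show ?case using K(2) c bit by simp
  next
    case (step i)
    have ev: "even (K i) \<longleftrightarrow> ?y i \<noteq> SX" using step.IH sym_of_SX_iff[of "K i"] by auto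
    consider "?y (i + 1) = ?y i" | "?y (i + 1) \<noteq> ?y i" "?y i \<noteq> SX" "?y (i + 1) \<noteq> SX"
      | "?y i \<noteq> SX" "?y (i + 1) = SX" | "?y i = SX" "?y (i + 1) \<noteq> SX" by metis
    then show ?case
    proof cases
      case 1
      then have eq: "K (i + 1) = K i" using K(1) by (simp add: \<delta>_def)
      show ?thesis
      proof (intro conjI impI)
        show "sym_of (K (i + 1)) = ?y (i + 1)" using eq 1 step.IH by simp
        assume X: "?y (i + 1) = SX"
        then obtain p where p: "p < i" "\<forall>j. p < j \<longrightarrow> j \<le> i \<longrightarrow> ?y j = SX" "?y p = sym_of (K i - 1)"
          using step.IH 1 by auto
        have "?y j = SX" if "p < j" "j \<le> i + 1" for j using p(2) X that by (cases "j = i + 1") auto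
        then show "\<exists>p<i + 1. (\<forall>j. p < j \<longrightarrow> j \<le> i + 1 \<longrightarrow> ?y j = SX) \<and> ?y p = sym_of (K (i + 1) - 1)"
          using p eq by (intro exI[of _ p]) auto
      qed
    next
      case 2
      then have eq: "K (i + 1) = K i + 2" using K(1) by (simp add: \<delta>_def)
      have "even (K i)" using ev 2 by simp
      then have "sym_of (K i + 2) \<noteq> sym_of (K i)" "sym_of (K i + 2) \<noteq> SX"
        using sym_of_add_2 sym_of_SX_iff[of "K i + 2"] by auto
      then have "sym_of (K (i + 1)) = ?y (i + 1)"
        using eq 2 step.IH by (metis sym.exhaust)
      then show ?thesis using 2 by simp
    next
      case 3
      then have eq: "K (i + 1) = K i + 1" using K(1) by (simp add: \<delta>_def)
      have "odd (K i + 1)" using ev 3 by simp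
      then have "sym_of (K (i + 1)) = SX" using eq sym_of_SX_iff by simp
      moreover have "\<exists>p<i + 1. (\<forall>j. p < j \<longrightarrow> j \<le> i + 1 \<longrightarrow> ?y j = SX) \<and> ?y p = sym_of (K (i + 1) - 1)"
      proof (intro exI[of _ i] conjI allI impI)
        fix j assume "i < j" "j \<le> i + 1"
        then have "j = i + 1" by simp
        then show "?y j = SX" using 3 by simp
      qed (use eq step.IH in simp_all)
      ultimately show ?thesis using 3 by simp
    next
      case 4
      then have eq: "K (i + 1) = K i + 1" using K(1) by (simp add: \<delta>_def)
      obtain p where p: "p < i" "\<forall>j. p < j \<longrightarrow> j \<le> i \<longrightarrow> ?y j = SX" "?y p = sym_of (K i - 1)"
        using step.IH 4 by auto
      have ev': "even (K i - 1)" using ev 4 by simp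
      then have pX: "?y p \<noteq> SX" using p(3) sym_of_SX_iff by simp
      have "?y p \<noteq> ?y (i + 1)"
        by (rule Str_xblock[OF ok ne pX 4(2)]) (use p in auto)
      moreover have "sym_of (K i - 1 + 2) \<noteq> sym_of (K i - 1)" "sym_of (K i - 1 + 2) \<noteq> SX"
        using sym_of_add_2[OF ev'] sym_of_SX_iff[of "K i - 1 + 2"] ev' by auto
      ultimately have "sym_of (K i - 1 + 2) = ?y (i + 1)" using p(3) pX 4(2) by (metis sym.exhaust)
      then have "sym_of (K (i + 1)) = ?y (i + 1)" using eq by (simp add: algebra_simps)
      then show ?thesis using 4 by simp
    qed
  qed
  have sym: "sym_of (K i) = ?y i" for i
  proof -
    define q where "q = \<bar>a\<bar> + \<bar>i\<bar>"
    have q: "a \<le> i + q * int N"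
    proof -
      have "q * 1 \<le> q * int N" using NM by (intro mult_left_mono) (auto simp: q_def)
      then show ?thesis using q_def by linarith
    qed
    have "K (i + q * int N) = K i + 4 * (q * int M)"
      using int_period_mult[of K "int N" "4 * int M" i q] perK by (simp add: algebra_simps)
    moreover have "?y (i + q * int N) = ?y i" using len by (simp add: cyc_def)
    ultimately show ?thesis using inv[OF q] by simp
  qed
  have "K i \<le> K (i + 1)" for i using K(1)[of i] by (simp add: \<delta>_def)
  moreover have "K (i + 1) \<le> 2 * (K i div 2) + 2" for i
  proof (cases "?y i = SX")
    case True
    then have "odd (K i)" using sym[of i] sym_of_SX_iff by simp
    moreover have "\<delta> i \<le> 1" using True by (simp add: \<delta>_def)
    ultimately show ?thesis using K(1)[of i] by presburger
  next
    case False
    then have "even (K i)" using sym[of i] sym_of_SX_iff[of "K i"] by auto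
    moreover have "\<delta> i \<le> 2" by (simp add: \<delta>_def)
    ultimately show ?thesis using K(1)[of i] by presburger
  qed
  ultimately have "lifts N M s K" using len perK sym unfolding lifts_def half_phases_iff by simp
  then show ?thesis using that K(2) by blast
qed

text \<open>Passing to a smaller string moves the phases only within the unit segments of the larger one.\<close>

lemma lifts_between:
  assumes K: "lifts N M s K" and K': "lifts N M s' K'" and N: "N > 0"
    and le: "s' = s \<or> str_less s' s" and a: "cyc s a \<noteq> SX" "K' a = K a"
  shows "2 * (K i div 2) \<le> K' i" "K' i \<le> 2 * ((K i + 1) div 2)"
proof -
  have same: "sym_of (K' j) = sym_of (K j)" if "even (K j)" for j
  proof -
    have "cyc s j \<noteq> SX" using that liftsD(5)[OF K, of j] sym_of_SX_iff[of "K j"] by auto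
    moreover have "nat (j mod int N) < N" using N by (simp add: nat_less_iff)
    ultimately have "cyc s' j = cyc s j"
      using le liftsD(1)[OF K] liftsD(1)[OF K'] unfolding cyc_def str_less_def by auto
    then show ?thesis using liftsD(5)[OF K] liftsD(5)[OF K'] by simp
  qed
  define q where "q = \<bar>a\<bar> + \<bar>i\<bar>"
  have q: "a \<le> i + q * int N" "i + (- q) * int N \<le> a"
  proof -
    have "q * 1 \<le> q * int N" using N by (intro mult_left_mono) (auto simp: q_def)
    moreover have "(- q) * int N = - (q * int N)" by simp
    ultimately show "a \<le> i + q * int N" "i + (- q) * int N \<le> a" using q_def by linarith+
  qed
  \<comment> \<open>Whenever \<open>K\<close> moves up to a new even value, the two strings share a
    bit there, so \<open>K'\<close> agrees with \<open>K\<close> modulo 4. It is at most 2 too small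
    by the previous step, hence not too small at all.\<close>
  have low: "2 * (K j div 2) \<le> K' j" if "a \<le> j" for j
    using that
  proof (induction j rule: int_ge_induct)
    case base then show ?case using a(2) by simp
  next
    case (step j)
    show ?case
    proof (cases "K (j + 1) div 2 = K j div 2")
      case True
      then show ?thesis using step liftsD(2)[OF K', of j] by simp
    next
      case False
      then have eq: "K (j + 1) = 2 * (K j div 2) + 2"
        using liftsD(2,4)[OF K, of j] by presburger
      then have "sym_of (K' (j + 1)) = sym_of (K (j + 1))" by (intro same) simp
      then have "4 dvd K (j + 1) - K' (j + 1)" using sym_of_eq_bit[of "K (j + 1)" "K' (j + 1)"] eq by simp
      then show ?thesis using eq step liftsD(2)[OF K', of j] by presburger
    qed
  qed
  have up: "K' j \<le> 2 * ((K j + 1) div 2)" if "j \<le> a" for j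
    using that
  proof (induction j rule: int_le_induct)
    case base then show ?case using a(2) by simp
  next
    case (step j)
    have st: "K (j - 1) \<le> K j" "K j \<le> 2 * (K (j - 1) div 2) + 2" "K' (j - 1) \<le> K' j"
      using liftsD(2,4)[OF K, of "j - 1"] liftsD(2)[OF K', of "j - 1"] by simp_all
    show ?case
    proof (cases "(K (j - 1) + 1) div 2 = (K j + 1) div 2")
      case True
      then show ?thesis using step st by simp
    next
      case False
      then have eq: "K (j - 1) = 2 * ((K j + 1) div 2) - 2" using st by presburger
      then have "sym_of (K' (j - 1)) = sym_of (K (j - 1))" by (intro same) simp
      then have "4 dvd K (j - 1) - K' (j - 1)" using sym_of_eq_bit[of "K (j - 1)" "K' (j - 1)"] eq by simp
      then show ?thesis using eq step st by presburger
    qed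
  qed
  show "2 * (K i div 2) \<le> K' i"
  proof -
    have "(K i + q * (4 * int M)) div 2 = K i div 2 + q * (2 * int M)"
      using div_mult_self1[of 2 "K i" "q * (2 * int M)"] by (simp add: algebra_simps)
    then show ?thesis
      using low[OF q(1)] lifts_period_mult[OF K, of i q] lifts_period_mult[OF K', of i q] by simp
  qed
  show "K' i \<le> 2 * ((K i + 1) div 2)"
  proof -
    have "(K i + (- q) * (4 * int M) + 1) div 2 = (K i + 1) div 2 + (- q) * (2 * int M)"
      using div_mult_self1[of 2 "K i + 1" "(- q) * (2 * int M)"] by (simp add: algebra_simps)
    then show ?thesis
      using up[OF q(2)] lifts_period_mult[OF K, of i "- q"] lifts_period_mult[OF K', of i "- q"] by simp
  qed
qed

section \<open>Strings and zigzag vectors\<close>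

abbreviation unit_zigzag :: "int \<Rightarrow> real" where
  "unit_zigzag k \<equiv> of_bool (odd k)"

lemma alternating_unit_zigzag: "alternating (2 * m) unit_zigzag"
  by (simp add: alternating_def)

lemma minimal_even_period_unit_zigzag: "minimal_even_period 1 unit_zigzag"
  by (auto simp: minimal_even_period_def)

lemma zigzag_unit_cases:
  "zigzag unit_zigzag x = (if even \<lfloor>x\<rfloor> then x - of_int \<lfloor>x\<rfloor> else 1 - (x - of_int \<lfloor>x\<rfloor>))"
  by (simp add: zigzag_def)

lemma zigzag_unit_half: "zigzag unit_zigzag (of_int k / 2) = symval (sym_of k)"
proof -
  have fl: "\<lfloor>real_of_int k / 2\<rfloor> = k div 2"
    using floor_divide_of_int_eq[of k 2] by simp
  have m: "k = 4 * (k div 4) + k mod 4" by simp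
  define q where "q = k div 4"
  have "k mod 4 \<in> {0, 1, 2, 3}" by (auto; presburger)
  then have "k = 4 * q \<or> k = 4 * q + 1 \<or> k = 4 * q + 2 \<or> k = 4 * q + 3" using m unfolding q_def by fastforce
  then show ?thesis
  proof (elim disjE)
    assume k: "k = 4 * q"
    have "k div 2 = 2 * q" "sym_of k = S0" using k by (simp_all add: sym_of_def)
    then show ?thesis using k unfolding zigzag_unit_cases fl by simp
  next
    assume k: "k = 4 * q + 1"
    have "k div 2 = 2 * q" using k by presburger
    moreover have "sym_of k = SX" using k sym_of_SX_iff by simp
    ultimately show ?thesis using k unfolding zigzag_unit_cases fl by (simp add: field_simps)
  next
    assume k: "k = 4 * q + 2"
    have "k div 2 = 2 * q + 1" using k by presburger
    moreover have "sym_of k = S1" using k by (simp add: sym_of_def; presburger)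
    ultimately show ?thesis using k unfolding zigzag_unit_cases fl by (simp add: field_simps)
  next
    assume k: "k = 4 * q + 3"
    have "k div 2 = 2 * q + 1" using k by presburger
    moreover have "sym_of k = SX" using k sym_of_SX_iff by simp
    ultimately show ?thesis using k unfolding zigzag_unit_cases fl by (simp add: field_simps)
  qed
qed

lemma zigzag_convex_sum:
  assumes "finite C" "\<And>s. s \<in> C \<Longrightarrow> 0 \<le> f s" "sum f C = 1"
    and seg: "\<And>s. s \<in> C \<Longrightarrow> of_int m \<le> x s \<and> x s \<le> of_int m + 1"
  shows "zigzag v (\<Sum>s\<in>C. f s * x s) = (\<Sum>s\<in>C. f s * zigzag v (x s))"
proof -
  have "(\<Sum>s\<in>C. f s * of_int m) \<le> (\<Sum>s\<in>C. f s * x s)"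
    using seg assms(2) by (intro sum_mono mult_left_mono) auto
  moreover have "(\<Sum>s\<in>C. f s * x s) \<le> (\<Sum>s\<in>C. f s * (of_int m + 1))"
    using seg assms(2) by (intro sum_mono mult_left_mono) auto
  moreover have c: "(\<Sum>s\<in>C. f s * c) = c" for c using assms(3) by (simp flip: sum_distrib_right)
  ultimately have "of_int m \<le> (\<Sum>s\<in>C. f s * x s)" "(\<Sum>s\<in>C. f s * x s) \<le> of_int m + 1" by (simp_all only: c)
  then have "zigzag v (\<Sum>s\<in>C. f s * x s) = v m + ((\<Sum>s\<in>C. f s * x s) - of_int m) * (v (m + 1) - v m)"
    by (rule zigzag_on_segment)
  also have "\<dots> = (\<Sum>s\<in>C. f s * v m) + ((\<Sum>s\<in>C. f s * x s) - (\<Sum>s\<in>C. f s * of_int m)) * (v (m + 1) - v m)"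
    unfolding c ..
  also have "\<dots> = (\<Sum>s\<in>C. f s * v m + (f s * x s - f s * of_int m) * (v (m + 1) - v m))"
    by (simp only: sum.distrib sum_subtractf sum_distrib_right[symmetric])
  also have "\<dots> = (\<Sum>s\<in>C. f s * (v m + (x s - of_int m) * (v (m + 1) - v m)))"
    by (intro sum.cong refl) (simp add: algebra_simps)
  also have "\<dots> = (\<Sum>s\<in>C. f s * zigzag v (x s))"
    using zigzag_on_segment[of m _ v] seg by (intro sum.cong refl) presburger
  finally show ?thesis .
qed

lemma finite_Str: "finite (Str N M)"
proof -
  have "(UNIV :: sym set) = {S0, S1, SX}" using sym.exhaust by auto
  then have "finite (UNIV :: sym set)" by (metis finite.emptyI finite_insert)
  then have "finite {s :: sym list. set s \<subseteq> UNIV \<and> length s = N}" by (rule finite_lists_length_eq)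
  then show ?thesis by (rule finite_subset[rotated]) (auto simp: Str_def)
qed

lemma finite_str_chain_top:
  assumes "finite C" "C \<noteq> {}" "\<And>s s'. s \<in> C \<Longrightarrow> s' \<in> C \<Longrightarrow> s = s' \<or> str_less s s' \<or> str_less s' s"
  shows "\<exists>t\<in>C. \<forall>s\<in>C. s = t \<or> str_less s t"
proof -
  define r where "r s = card {i. i < length s \<and> s ! i = SX}" for s :: "sym list"
  have less: "r s < r s'" if "str_less s s'" for s s'
    unfolding r_def
  proof (rule psubset_card_mono)
    have "length s = length s'" "s \<noteq> s'" using that by (auto simp: str_less_def)
    then obtain i where "i < length s'" "s ! i \<noteq> s' ! i" using list_eq_iff_nth_eq[of s s'] by auto
    then show "{i. i < length s \<and> s ! i = SX} \<subset> {i. i < length s' \<and> s' ! i = SX}"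
      using that unfolding str_less_def by (auto; metis)
  qed simp
  have "Max (r ` C) \<in> r ` C" using assms(1,2) by (intro Max_in) auto
  then obtain t where tC: "t \<in> C" and tm: "Max (r ` C) = r t" by blast
  have t: "t \<in> C" "\<forall>s\<in>C. r s \<le> r t" using tC assms(1) unfolding tm[symmetric] by auto
  have "s = t \<or> str_less s t" if "s \<in> C" for s
    using assms(3)[OF that t(1)] less[of t s] bspec[OF t(2) that] by linarith
  then show ?thesis using t(1) by blast
qed

text \<open>The lifts of all strings of the chain are anchored with the same value at one bit of the
  largest string, a bit they all share. By \<open>lifts_between\<close> they then stay in a common
  unit segment at each position. There \<open>unit_zigzag\<close> interpolates affinely, so
  averaging phases averages the values.\<close>

lemma bary_Str_subset:
  assumes NM: "N > 0" "M > 0" and f: "f \<in> poset_realization (Str N M) str_less"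
  shows "bary N (Str N M) f \<in> zigzag_vectors N (2 * int M) unit_zigzag"
proof -
  note fD = poset_realizationD[OF f finite_Str]
  define C where "C = {s. f s \<noteq> 0}"
  have CS: "C \<subseteq> Str N M" using fD(2) by (auto simp: C_def)
  have finC: "finite C" using finite_subset[OF CS finite_Str] .
  have sumC: "sum g C = sum g (Str N M)" if "\<And>s. f s = 0 \<Longrightarrow> g s = 0" for g :: "sym list \<Rightarrow> real"
    using CS that by (intro sum.mono_neutral_left finite_Str) (auto simp: C_def)
  have s1: "sum f C = 1" using sumC[of f] fD(3) by simp
  have neC: "C \<noteq> {}" using s1 by auto
  have chain: "s = s' \<or> str_less s s' \<or> str_less s' s" if "s \<in> C" "s' \<in> C" for s s'
    using fD(4)[of s s'] that by (simp add: C_def)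
  obtain t where t: "t \<in> C" "\<And>s. s \<in> C \<Longrightarrow> s = t \<or> str_less s t"
    using finite_str_chain_top[OF finC neC chain] by blast
  have tS: "t \<in> Str N M" using t CS by blast
  have "\<exists>a. cyc t a \<noteq> SX"
  proof (rule ccontr)
    assume "\<not> ?thesis"
    then have "(\<Sum>j\<in>{0..<int N}. of_bool (cyc t j = S0 \<and> cyc t (j - 1) \<noteq> S0)) = (0::int)" by simp
    then show False using Str_starts_sum[OF tS NM, of S0] NM by simp
  qed
  then obtain a where a: "cyc t a \<noteq> SX" by blast
  define c where "c = (if cyc t a = S0 then 0 else 2 :: int)"
  have c: "sym_of c = cyc t a" using a by (cases "cyc t a") (auto simp: c_def sym_of_def)
  obtain K where K: "lifts N M t K" "K a = c" by (rule Str_imp_lifts[OF tS NM a c])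
  have "\<exists>K'. lifts N M s K' \<and> K' a = c" if s: "s \<in> C" for s
  proof -
    have sS: "s \<in> Str N M" using s CS by blast
    have "nat (a mod int N) < N" using NM by (simp add: nat_less_iff)
    then have "cyc s a = cyc t a"
      using t(2)[OF s] a tS sS unfolding cyc_def str_less_def by (auto simp: Str_def)
    then have "cyc s a \<noteq> SX" "sym_of c = cyc s a" using a c by simp_all
    then obtain K' where "lifts N M s K'" "K' a = c" by (rule Str_imp_lifts[OF sS NM])
    then show ?thesis by blast
  qed
  then obtain L where L: "\<And>s. s \<in> C \<Longrightarrow> lifts N M s (L s)" "\<And>s. s \<in> C \<Longrightarrow> L s a = c" by metis
  have btw: "2 * (K i div 2) \<le> L s i" "L s i \<le> 2 * ((K i + 1) div 2)" if "s \<in> C" for s i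
    using lifts_between[OF K(1) L(1)[OF that] NM(1) _ a] t(2)[OF that] L(2)[OF that] K(2) by auto
  define \<theta> where "\<theta> i = (\<Sum>s\<in>C. f s * (of_int (L s i) / 2))" for i
  have const: "(\<Sum>s\<in>C. f s * x) = x" for x using s1 by (simp flip: sum_distrib_right)
  have "\<theta> \<in> phases (int N) (2 * int M)"
  proof (rule phasesI_hits)
    have "\<theta> i \<le> \<theta> (i + 1)" for i
      unfolding \<theta>_def using liftsD(2)[OF L(1)] fD(1) by (intro sum_mono mult_left_mono divide_right_mono) auto
    moreover have "\<theta> (i + int N) = \<theta> i + of_int (2 * int M)" for i
    proof -
      have "\<theta> (i + int N) = (\<Sum>s\<in>C. f s * (of_int (L s i) / 2) + f s * of_int (2 * int M))"
        unfolding \<theta>_def using liftsD(3)[OF L(1)] by (intro sum.cong refl) (simp add: field_simps)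
      then show ?thesis unfolding \<theta>_def sum.distrib const .
    qed
    ultimately show "\<theta> \<in> quasi_periodic (int N) (2 * int M)" by (simp add: quasi_periodic_def)
    fix k
    have "(\<lambda>i. of_int (K i) / 2) \<in> phases (int N) (2 * int M)" using K(1) by (simp add: lifts_def)
    then obtain b where "real_of_int (K b) / 2 = of_int k"
      by (rule phases_first_hit[where k=k]) (use NM in auto)
    then have "real_of_int (K b) = real_of_int (2 * k)" by simp
    then have b: "K b = 2 * k" by linarith
    \<comment> \<open>Where the largest string has the integral phase \<open>k\<close>, the two
      bounds coincide and pin all lifts, so the averaged phase also hits \<open>k\<close>.\<close>
    have "L s b = 2 * k" if "s \<in> C" for s
    proof -
      have "(2 * k) div 2 = k" "(2 * k + 1) div 2 = k" by presburger+
      then show ?thesis using btw[OF that, of b] b by simp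
    qed
    then have "\<theta> b = (\<Sum>s\<in>C. f s * of_int k)" unfolding \<theta>_def by (intro sum.cong refl) simp
    then show "\<exists>i. \<theta> i = of_int k" using const by metis
  qed
  moreover have "unroll N (bary N (Str N M) f) i = zigzag unit_zigzag (\<theta> i)" for i
  proof -
    have len: "length s = N" if "s \<in> C" for s using that CS by (auto simp: Str_def)
    have "nat (i mod int N) < N" using NM by (simp add: nat_less_iff)
    then have "unroll N (bary N (Str N M) f) i = (\<Sum>s\<in>Str N M. f s * symval (s ! nat (i mod int N)))"
      by (simp add: unroll_def bary_def)
    also have "\<dots> = (\<Sum>s\<in>C. f s * symval (s ! nat (i mod int N)))" by (rule sumC[symmetric]) simp
    also have "\<dots> = (\<Sum>s\<in>C. f s * zigzag unit_zigzag (of_int (L s i) / 2))"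
      unfolding zigzag_unit_half using liftsD(5)[OF L(1)] len by (intro sum.cong refl) (simp add: cyc_def)
    also have "\<dots> = zigzag unit_zigzag (\<theta> i)" unfolding \<theta>_def
    proof (rule zigzag_convex_sum[symmetric, OF finC fD(1) s1])
      fix s assume s: "s \<in> C"
      have "2 * (K i div 2) \<le> L s i \<and> L s i \<le> 2 * (K i div 2) + 2" using btw[OF s, of i] by presburger
      then show "of_int (K i div 2) \<le> real_of_int (L s i) / 2 \<and> real_of_int (L s i) / 2 \<le> of_int (K i div 2) + 1"
        by linarith
    qed
    finally show ?thesis .
  qed
  ultimately show ?thesis by (auto simp: zigzag_vectors_def RN_def bary_def)
qed

section \<open>Threshold strings of zigzag vectors\<close>

text \<open>Put \<open>r = (1 - c) / 2\<close>, which is below \<open>1/2\<close>. The threshold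
  snaps phases within distance \<open>r\<close> of an integer to that integer and all other phases
  to the midpoint of their segment; the sum of floor and ceiling is twice the snapped phase.\<close>

lemma threshold_zigzag_unit:
  assumes "0 < c" "c \<le> 1"
  shows "threshold c (zigzag unit_zigzag x) = sym_of (\<lfloor>x + (1 - c) / 2\<rfloor> + \<lceil>x - (1 - c) / 2\<rceil>)"
proof -
  define m where "m = \<lfloor>x\<rfloor>"
  define g where "g = x - of_int m"
  have g: "0 \<le> g" "g < 1" and x: "x = of_int m + g" unfolding g_def m_def by linarith+
  define r where "r = (1 - c) / 2"
  have r: "0 \<le> r" "r < 1 / 2" "c = 1 - 2 * r" using assms by (auto simp: r_def field_simps)
  have zz: "zigzag unit_zigzag x = (if even m then g else 1 - g)"
    using zigzag_unit_cases[of x] by (simp add: g_def m_def)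
  consider "g \<le> r" | "r < g" "g < 1 - r" | "1 - r \<le> g" by linarith
  then show ?thesis
  proof cases
    case 1
    have "\<lfloor>x + r\<rfloor> = m" "\<lceil>x - r\<rceil> = m" using 1 g r unfolding x by (auto simp: floor_eq_iff ceiling_eq_iff)
    moreover have "sym_of (m + m) = (if even m then S0 else S1)" by (auto simp: sym_of_def; presburger)
    ultimately show ?thesis unfolding zz r_def[symmetric] using 1 g r by (auto simp: threshold_def)
  next
    case 2
    have "\<lfloor>x + r\<rfloor> = m" "\<lceil>x - r\<rceil> = m + 1" using 2 g r unfolding x by (auto simp: floor_eq_iff ceiling_eq_iff)
    moreover have "sym_of (m + (m + 1)) = SX" using sym_of_SX_iff by simp
    ultimately show ?thesis unfolding zz r_def[symmetric] using 2 g r by (auto simp: threshold_def)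
  next
    case 3
    have "\<lfloor>x + r\<rfloor> = m + 1" "\<lceil>x - r\<rceil> = m + 1" using 3 g r unfolding x by (auto simp: floor_eq_iff ceiling_eq_iff)
    moreover have "sym_of ((m + 1) + (m + 1)) = (if even m then S1 else S0)" by (auto simp: sym_of_def; presburger)
    ultimately show ?thesis unfolding zz r_def[symmetric] using 3 g r by (auto simp: threshold_def)
  qed
qed

text \<open>Snapping is monotone, commutes with integer shifts and fixes integers. So the snapped
  phases again hit every integer and form a lift of the threshold string.\<close>

lemma threshold_string_Str:
  assumes NM: "N > 0" "M > 0" and \<theta>: "\<theta> \<in> phases (int N) (2 * int M)"
    and u: "\<And>i. unroll N u i = zigzag unit_zigzag (\<theta> i)" and c: "0 < c" "c \<le> 1"
  shows "threshold_string N u c \<in> Str N M"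
proof (rule lifts_imp_Str[OF _ NM])
  note qp = phases_quasi_periodic[OF \<theta>]
  define r where "r = (1 - c) / 2"
  have r: "0 \<le> r" "r < 1 / 2" using c by (auto simp: r_def)
  define K where "K i = \<lfloor>\<theta> i + r\<rfloor> + \<lceil>\<theta> i - r\<rceil>" for i
  have "(\<lambda>i. of_int (K i) / 2) \<in> phases (int N) (2 * int M)"
  proof (rule phasesI_hits)
    have "K i \<le> K (i + 1)" for i
      unfolding K_def using phases_step(1)[OF \<theta>, of i] by (intro add_mono floor_mono ceiling_mono) auto
    moreover have "K (i + int N) = K i + 4 * int M" for i
    proof -
      have "\<theta> (i + int N) + r = (\<theta> i + r) + of_int (2 * int M)" "\<theta> (i + int N) - r = (\<theta> i - r) + of_int (2 * int M)"
        using quasi_periodicD(2)[OF qp, of i] by simp_all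
      then show ?thesis unfolding K_def by (simp only: floor_add_int[symmetric] ceiling_add_of_int)
    qed
    ultimately show "(\<lambda>i. of_int (K i) / 2) \<in> quasi_periodic (int N) (2 * int M)"
      by (simp add: quasi_periodic_def divide_right_mono add_divide_distrib)
    fix k
    obtain a where a: "\<theta> a = of_int k" by (rule phases_first_hit[OF \<theta>, where k=k]) (use NM in auto)
    have "\<lfloor>of_int k + r\<rfloor> = k" "\<lceil>of_int k - r\<rceil> = k" using r by (auto simp: floor_eq_iff ceiling_eq_iff)
    then have "K a = k + k" using a by (simp add: K_def)
    then show "\<exists>i. of_int (K i) / 2 = real_of_int k" by (intro exI[of _ a]) simp
  qed
  moreover have "sym_of (K i) = cyc (threshold_string N u c) i" for i
  proof -
    have "nat (i mod int N) < N" using NM by (simp add: nat_less_iff)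
    then have "cyc (threshold_string N u c) i = threshold c (unroll N u i)"
      by (simp add: cyc_def threshold_string_def unroll_def)
    then show ?thesis unfolding u K_def r_def using threshold_zigzag_unit[OF c] by simp
  qed
  ultimately show "lifts N M (threshold_string N u c) K" by (simp add: lifts_def threshold_string_def)
qed

lemma Str_realization_homeomorphic:
  assumes NM: "N > 0" "M > 0"
  shows "poset_realization (Str N M) str_less homeomorphic zigzag_vectors N (2 * int M) unit_zigzag"
proof -
  let ?R = "poset_realization (Str N M) str_less"
  let ?Z = "zigzag_vectors N (2 * int M) unit_zigzag"
  have "?Z \<subseteq> bary N (Str N M) ` ?R"
  proof
    fix u assume "u \<in> ?Z"
    then obtain \<theta> where u: "u \<in> RN N" and \<theta>: "\<theta> \<in> phases (int N) (2 * int M)"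
      and u\<theta>: "\<And>i. unroll N u i = zigzag unit_zigzag (\<theta> i)" by (auto simp: zigzag_vectors_def)
    show "u \<in> bary N (Str N M) ` ?R"
    proof (rule bary_surj[OF finite_Str])
      fix i assume i: "i < N"
      have "u i = zigzag unit_zigzag (\<theta> (int i))" using u\<theta>[of "int i"] i by (simp add: unroll_def nat_mod_distrib)
      then show "u i \<in> {0..1}" unfolding zigzag_unit_cases by (auto; linarith)
    next
      fix c :: real assume "c \<in> {0<..1}"
      then show "threshold_string N u c \<in> Str N M" using threshold_string_Str[OF NM \<theta> u\<theta>] by simp
    qed (use u in \<open>simp add: RN_def\<close>)
  qed
  then have "bary N (Str N M) ` ?R = ?Z" using bary_Str_subset[OF NM] by blast
  moreover have "continuous_on ?R (bary N (Str N M))"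
  proof (rule continuous_on_coordinatewise_then_product)
    fix i
    show "continuous_on ?R (\<lambda>f. bary N (Str N M) f i)"
      unfolding bary_def
      by (cases "i < N") (auto intro!: continuous_intros continuous_on_subset[OF continuous_on_product_coordinates])
  qed
  moreover have "inj_on (bary N (Str N M)) ?R" by (rule bary_inj[OF finite_Str]) (simp add: Str_def)
  ultimately have "\<exists>g. homeomorphism ?R ?Z (bary N (Str N M)) g"
    by (intro homeomorphism_compact compact_poset_realization finite_Str)
  then show ?thesis unfolding homeomorphic_def by blast
qed

section \<open>Ranks as numbers of components\<close>

text \<open>Works on the integers, the vertices of the universal cover of the polygon, with jumps by
  \<open>n\<close> in place of reduction modulo \<open>n\<close>; phases can then be used directly.
  The reflexive closure also links vertices above level \<open>t\<close> to themselves.\<close>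

definition linked :: "int \<Rightarrow> (int \<Rightarrow> real) \<Rightarrow> real \<Rightarrow> (int \<times> int) set" where
  "linked n W t = {(i, j). W i \<le> t \<and> W j \<le> t \<and> (j = i + 1 \<or> i = j + 1 \<or> j = i + n \<or> i = j + n)}\<^sup>*"

definition component :: "int \<Rightarrow> (int \<Rightarrow> real) \<Rightarrow> real \<Rightarrow> int \<Rightarrow> int set" where
  "component n W t i = linked n W t `` {i}"

lemma linked_step:
  "W i \<le> t \<Longrightarrow> W j \<le> t \<Longrightarrow> j = i + 1 \<or> i = j + 1 \<or> j = i + n \<or> i = j + n \<Longrightarrow> (i, j) \<in> linked n W t"
  unfolding linked_def by (rule r_into_rtrancl) simp

lemma linked_refl [simp]: "(i, i) \<in> linked n W t"
  by (simp add: linked_def)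

lemma linked_trans: "(i, j) \<in> linked n W t \<Longrightarrow> (j, k) \<in> linked n W t \<Longrightarrow> (i, k) \<in> linked n W t"
  unfolding linked_def by (rule rtrancl_trans)

lemma linked_sym: "(i, j) \<in> linked n W t \<Longrightarrow> (j, i) \<in> linked n W t"
proof -
  have "sym {(i, j). W i \<le> t \<and> W j \<le> t \<and> (j = i + 1 \<or> i = j + 1 \<or> j = i + n \<or> i = j + n)}"
    by (auto simp: sym_def)
  from sym_rtrancl[OF this] show "(i, j) \<in> linked n W t \<Longrightarrow> (j, i) \<in> linked n W t"
    unfolding linked_def by (rule symD)
qed

lemma linked_induct [consumes 1, case_names base step]:
  assumes "(i, j) \<in> linked n W t" and "P i"
    and "\<And>j k. (i, j) \<in> linked n W t \<Longrightarrow> P j \<Longrightarrow> W j \<le> t \<Longrightarrow> W k \<le> t \<Longrightarrow>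
        k = j + 1 \<or> j = k + 1 \<or> k = j + n \<or> j = k + n \<Longrightarrow> P k"
  shows "P j"
  using assms(1) unfolding linked_def
proof (induction rule: rtrancl_induct)
  case (step j k)
  then show ?case using assms(3)[of j k] unfolding linked_def by auto
qed (rule assms(2))

lemma linked_mono: "(i, j) \<in> linked n W t \<Longrightarrow> t \<le> t' \<Longrightarrow> (i, j) \<in> linked n W t'"
proof (induction rule: linked_induct)
  case (step j k)
  then have "(j, k) \<in> linked n W t'" by (intro linked_step) auto
  then show ?case using step by (auto intro: linked_trans)
qed simp

lemma linked_upward:
  assumes "i \<le> j" "\<And>m. i \<le> m \<Longrightarrow> m \<le> j \<Longrightarrow> W m \<le> t"
  shows "(i, j) \<in> linked n W t"
  using assms
proof (induction rule: int_ge_induct)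
  case (step j)
  then have "(j, j + 1) \<in> linked n W t" by (intro linked_step) auto
  then show ?case using step by (auto intro: linked_trans)
qed simp

lemma component_eq_iff: "component n W t i = component n W t j \<longleftrightarrow> (i, j) \<in> linked n W t"
  unfolding component_def by (auto intro: linked_trans linked_sym)

lemma linked_mult:
  assumes per: "\<And>i. W (i + n) = W i" and "W i \<le> t"
  shows "(i, i + q * n) \<in> linked n W t"
proof (induction q rule: int_induct[where k=0])
  case (step1 q)
  have "W (i + q * n) \<le> t" "W (i + (q + 1) * n) \<le> t"
    using int_period_mult[of W n 0 i] per assms(2) by simp_all
  then have "(i + q * n, i + (q + 1) * n) \<in> linked n W t" by (intro linked_step) (auto simp: algebra_simps)
  then show ?case using step1 linked_trans by blast
next
  case (step2 q)
  have "W (i + q * n) \<le> t" "W (i + (q - 1) * n) \<le> t"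
    using int_period_mult[of W n 0 i] per assms(2) by simp_all
  then have "(i + q * n, i + (q - 1) * n) \<in> linked n W t" by (intro linked_step) (auto simp: algebra_simps)
  then show ?case using step2 linked_trans by blast
qed simp

lemma linked_mod:
  assumes per: "\<And>i. W (i + n) = W i" and "W i \<le> t"
  shows "(i, i mod n) \<in> linked n W t"
  using linked_mult[of W n i t "- (i div n)", OF per assms(2)] minus_mult_div_eq_mod[of i n]
  by (simp add: mult.commute)

lemma unroll_periodic [simp]: "unroll N w (i + int N) = unroll N w i"
  by (simp add: unroll_def)

lemma unroll_int: "i < N \<Longrightarrow> unroll N w (int i) = w i"
  by (simp add: unroll_def nat_mod_distrib)

lemma unroll_mod: "N > 0 \<Longrightarrow> nat (i mod int N) < N"
  by (simp add: nat_less_iff)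

section \<open>Chains and boundaries\<close>

interpretation fs: vector_space scaleF
  unfolding scaleF_def by (rule vector_space_fun)

definition indicator_vec :: "nat \<Rightarrow> int \<Rightarrow> nat \<Rightarrow> real" where
  "indicator_vec N i j = of_bool (j = nat (i mod int N))"

lemma subspace_B0: "fs.subspace (B0 N w t)"
proof -
  have b: "bdry N (\<lambda>_. 0) = 0" "bdry N (c + c') = bdry N c + bdry N c'" "bdry N (scaleF k c) = scaleF k (bdry N c)" for c c' k
    by (auto simp: bdry_def scaleF_def fun_eq_iff algebra_simps)
  have C: "(\<lambda>_. 0) \<in> C1 N w t" "c \<in> C1 N w t \<Longrightarrow> c' \<in> C1 N w t \<Longrightarrow> c + c' \<in> C1 N w t"
    "c \<in> C1 N w t \<Longrightarrow> scaleF k c \<in> C1 N w t" for c c' k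
    by (auto simp: C1_def scaleF_def) force
  show ?thesis unfolding fs.subspace_def B0_def
    by (auto simp flip: b intro: imageI C)
qed

lemma succ_mod_nat: "N > 0 \<Longrightarrow> nat ((i + 1) mod int N) = (nat (i mod int N) + 1) mod N"
proof -
  assume N: "N > 0"
  have "(i + 1) mod int N = (i mod int N + 1) mod int N" by (simp add: mod_add_left_eq)
  also have "\<dots> = int ((nat (i mod int N) + 1) mod N)" using N by (simp add: zmod_int ac_simps)
  finally show ?thesis by simp
qed

lemma pred_mod_eq_iff:
  fixes v e N :: nat
  assumes "v < N" "e < N"
  shows "(v + N - 1) mod N = e \<longleftrightarrow> v = (e + 1) mod N"
proof (cases "v = 0")
  case True
  then show ?thesis using assms by (cases "e + 1 = N") auto
next
  case False
  then have "(v + N - 1) mod N = v - 1" using assms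
    by (metis Nat.add_diff_assoc2 One_nat_def Suc_leI add_diff_cancel_right' gr0I less_imp_diff_less mod_add_self2 mod_less)
  then show ?thesis using assms False by (cases "e + 1 = N") auto
qed

lemma indicator_vec_step_B0:
  assumes N: "N > 0" and "unroll N w i \<le> t" "unroll N w (i + 1) \<le> t"
  shows "indicator_vec N (i + 1) - indicator_vec N i \<in> B0 N w t"
proof -
  let ?e = "nat (i mod int N)"
  have e: "?e < N" using unroll_mod[OF N] .
  have "bdry N (\<lambda>j. of_bool (j = ?e)) = indicator_vec N (i + 1) - indicator_vec N i"
  proof
    fix v
    show "bdry N (\<lambda>j. of_bool (j = ?e)) v = (indicator_vec N (i + 1) - indicator_vec N i) v"
    proof (cases "v < N")
      case True
      then show ?thesis using pred_mod_eq_iff[OF True e]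
        by (simp add: bdry_def indicator_vec_def succ_mod_nat[OF N])
    next
      case False
      moreover have "(?e + 1) mod N < N" using N by simp
      ultimately show ?thesis using e by (auto simp: bdry_def indicator_vec_def succ_mod_nat[OF N])
    qed
  qed
  moreover have "(\<lambda>j. of_bool (j = ?e)) \<in> C1 N w t"
    using assms e by (auto simp: C1_def Kedges_def unroll_def succ_mod_nat[OF N])
  ultimately show ?thesis unfolding B0_def by (metis imageI)
qed

lemma linked_B0:
  assumes N: "N > 0" and "(i, j) \<in> linked (int N) (unroll N w) t"
  shows "indicator_vec N j - indicator_vec N i \<in> B0 N w t"
  using assms(2)
proof (induction rule: linked_induct)
  case base
  show ?case using fs.subspace_0[OF subspace_B0, of N w t] by (simp add: zero_fun_def)
next
  case (step j k)
  have "indicator_vec N k - indicator_vec N j \<in> B0 N w t"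
  proof -
    have per: "indicator_vec N (i + int N) = indicator_vec N i" for i by (simp add: indicator_vec_def fun_eq_iff)
    consider "k = j + 1" | "j = k + 1" | "k = j + int N" | "j = k + int N" using step by blast
    then show ?thesis
    proof cases
      case 1 then show ?thesis using indicator_vec_step_B0[OF N] step by simp
    next
      case 2
      then have "indicator_vec N j - indicator_vec N k \<in> B0 N w t" using indicator_vec_step_B0[OF N] step by simp
      from fs.subspace_neg[OF subspace_B0 this] show ?thesis by simp
    qed (use per fs.subspace_0[OF subspace_B0, of N w t] in \<open>auto simp: zero_fun_def\<close>)
  qed
  from fs.subspace_add[OF subspace_B0 this step.IH]
  have "(indicator_vec N k - indicator_vec N j) + (indicator_vec N j - indicator_vec N i) \<in> B0 N w t" .
  moreover have "(indicator_vec N k - indicator_vec N j) + (indicator_vec N j - indicator_vec N i)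
      = indicator_vec N k - indicator_vec N i" by (simp add: fun_eq_iff)
  ultimately show ?case by (simp only:)
qed

definition component_sum :: "nat \<Rightarrow> int set \<Rightarrow> (nat \<Rightarrow> real) \<Rightarrow> real" where
  "component_sum N A b = (\<Sum>x<N. if int x \<in> A then b x else 0)"

text \<open>An edge present at level \<open>t\<close> has both ends in one component, so its two
  contributions to the sum cancel. These sums are the functionals that separate components in
  homology.\<close>

lemma component_sum_B0:
  assumes N: "N > 0" and b: "b \<in> B0 N w t"
  shows "component_sum N (component (int N) (unroll N w) t i) b = 0"
proof -
  let ?A = "component (int N) (unroll N w) t i" and ?W = "unroll N w"
  obtain c where c: "c \<in> C1 N w t" and bc: "b = bdry N c" using b by (auto simp: B0_def)
  let ?s = "\<lambda>x. (x + 1) mod N"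
  have inA: "int (?s x) \<in> ?A \<longleftrightarrow> int x \<in> ?A" if "c x \<noteq> 0" for x
  proof -
    have x: "x < N" "w x \<le> t" "w (?s x) \<le> t" using c that by (auto simp: C1_def Kedges_def)
    have W: "?W (int x) \<le> t" "?W (int x + 1) \<le> t"
      using x N succ_mod_nat[OF N, of "int x"] by (simp_all add: unroll_def nat_mod_distrib)
    have "(int x, int x + 1) \<in> linked (int N) ?W t" by (rule linked_step[OF W]) simp
    moreover have "(int x + 1, (int x + 1) mod int N) \<in> linked (int N) ?W t"
      by (rule linked_mod) (use W in auto)
    moreover have "(int x + 1) mod int N = int (?s x)" by (simp add: zmod_int ac_simps)
    ultimately have "(int x, int (?s x)) \<in> linked (int N) ?W t" using linked_trans by metis
    then show ?thesis unfolding component_def by (auto intro: linked_trans linked_sym)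
  qed
  have bij: "bij_betw ?s {..<N} {..<N}"
  proof -
    have "inj_on ?s {..<N}" by (rule inj_onI) (metis pred_mod_eq_iff lessThan_iff mod_less_divisor N)
    moreover have "?s ` {..<N} \<subseteq> {..<N}" using N by auto
    ultimately show ?thesis by (simp add: bij_betw_def endo_inj_surj)
  qed
  have "(\<Sum>x<N. if int x \<in> ?A then c ((x + N - 1) mod N) else 0)
      = (\<Sum>x<N. if int (?s x) \<in> ?A then c ((?s x + N - 1) mod N) else 0)"
    by (rule sum.reindex_bij_betw[OF bij, symmetric])
  also have "\<dots> = (\<Sum>x<N. if int x \<in> ?A then c x else 0)"
  proof (intro sum.cong refl)
    fix x assume "x \<in> {..<N}"
    then have "(?s x + N - 1) mod N = x" using pred_mod_eq_iff[of "?s x" N x] N by simp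
    then show "(if int (?s x) \<in> ?A then c ((?s x + N - 1) mod N) else 0) = (if int x \<in> ?A then c x else 0)"
      using inA[of x] by (cases "c x = 0") auto
  qed
  finally have eq: "(\<Sum>x<N. if int x \<in> ?A then c ((x + N - 1) mod N) else 0) = (\<Sum>x<N. if int x \<in> ?A then c x else 0)" .
  have "component_sum N ?A b = (\<Sum>x<N. (if int x \<in> ?A then c ((x + N - 1) mod N) else 0) - (if int x \<in> ?A then c x else 0))"
    unfolding component_sum_def bc by (intro sum.cong refl) (simp add: bdry_def)
  then show ?thesis using eq by (simp add: sum_subtractf)
qed

lemma component_sum_indicator:
  assumes "N > 0"
  shows "component_sum N A (indicator_vec N i) = of_bool (int (nat (i mod int N)) \<in> A)"
proof -
  have "component_sum N A (indicator_vec N i) = (\<Sum>x<N. if x = nat (i mod int N) then of_bool (int x \<in> A) else 0)"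
    unfolding component_sum_def indicator_vec_def by (intro sum.cong refl) auto
  then show ?thesis using unroll_mod[OF assms, of i] by simp
qed

lemma component_sum_span_0:
  assumes "\<And>b. b \<in> S \<Longrightarrow> component_sum N A b = 0" "x \<in> fs.span S"
  shows "component_sum N A x = 0"
  using assms(2)
proof (induction rule: fs.span_induct_alt)
  case base
  show ?case by (simp add: component_sum_def cong: if_cong)
next
  case (step c x y)
  have "component_sum N A (scaleF c x + y) = c * component_sum N A x + component_sum N A y"
    unfolding component_sum_def sum_distrib_left sum.distrib[symmetric]
    by (intro sum.cong refl) (simp add: scaleF_def)
  then show ?case using step assms(1)[OF step(1)] by (simp only: mult_zero_right add_0)
qed

lemma finite_components:
  assumes "N > 0"
  shows "finite (component (int N) (unroll N w) t ` {i. unroll N w i \<le> t})"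
proof -
  have "component (int N) (unroll N w) t i \<in> component (int N) (unroll N w) t ` {0..<int N}"
    if "unroll N w i \<le> t" for i
    using linked_mod[of "unroll N w" "int N" i t] that assms
    by (intro image_eqI[of _ _ "i mod int N"]) (auto simp: component_eq_iff)
  then have "component (int N) (unroll N w) t ` {i. unroll N w i \<le> t}
      \<subseteq> component (int N) (unroll N w) t ` {0..<int N}" by (intro image_subsetI) simp
  then show ?thesis by (rule finite_subset) simp
qed

text \<open>Choose in each component one vertex \<open>r\<close> with value at most
  \<open>s\<close>. Their indicators extend a basis of \<open>B0 N w t\<close> to one of the sum
  space: component sums show independence, and \<open>linked_B0\<close> shows that they
  span.\<close>

lemma hrank_0_eq_card_components:
  assumes N: "N > 0" and st: "s \<le> t"
  shows "hrank 0 N w s t = card (component (int N) (unroll N w) t ` {i. unroll N w i \<le> s})"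
proof -
  let ?W = "unroll N w" and ?comp = "component (int N) (unroll N w) t"
  let ?e = "indicator_vec N"
  obtain R where R: "R \<subseteq> {i. ?W i \<le> s}" "inj_on ?comp R" "?comp ` R = ?comp ` {i. ?W i \<le> s}"
    using subset_image_inj[of "?comp ` {i. ?W i \<le> s}" ?comp "{i. ?W i \<le> s}"] by auto
  have "?comp ` {i. ?W i \<le> s} \<subseteq> ?comp ` {i. ?W i \<le> t}" using st by auto
  then have "finite (?comp ` R)" using finite_components[OF N] R(3) finite_subset by metis
  then have finR: "finite R" using R(2) finite_imageD by blast
  let ?V = "{a + b | a b. a \<in> C0 N w s \<and> b \<in> B0 N w t}"
  obtain BB where BB: "BB \<subseteq> B0 N w t" "fs.independent BB" "B0 N w t \<subseteq> fs.span BB" "card BB = fdim (B0 N w t)"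
    by (rule fs.basis_exists)
  have spBB: "fs.span BB = B0 N w t"
    using BB(3) fs.span_minimal[OF BB(1) subspace_B0] by (rule subset_antisym[rotated])
  have e_i: "component_sum N (?comp i) (?e j) = of_bool ((i, j) \<in> linked (int N) ?W t)" if "?W j \<le> t" for i j
  proof -
    have "(j, j mod int N) \<in> linked (int N) ?W t" by (rule linked_mod) (use that in auto)
    then have "int (nat (j mod int N)) \<in> ?comp i \<longleftrightarrow> (i, j) \<in> linked (int N) ?W t"
      using N unfolding component_def by (auto intro: linked_trans linked_sym)
    then show ?thesis using component_sum_indicator[OF N] by simp
  qed
  have step: "fs.independent (BB \<union> ?e ` A) \<and> card (BB \<union> ?e ` A) = card BB + card A" if "A \<subseteq> R" for A
    using finite_subset[OF that finR] that
  proof (induction A rule: finite_induct)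
    case empty
    then show ?case using BB(2) by simp
  next
    case (insert r A)
    have rW: "?W r \<le> t" using insert.prems R(1) st by auto
    have zero: "component_sum N (?comp r) x = 0" if x: "x \<in> BB \<union> ?e ` A" for x
    proof (cases "x \<in> BB")
      case True
      then show ?thesis using component_sum_B0[OF N] BB(1) by blast
    next
      case False
      then obtain a where a: "a \<in> A" "x = ?e a" using x by blast
      then have aR: "a \<in> R" "a \<noteq> r" "?W a \<le> t" using insert R(1) st by auto
      then have "?comp a \<noteq> ?comp r" using R(2) insert.prems by (auto simp: inj_on_def)
      then have "(r, a) \<notin> linked (int N) ?W t" using component_eq_iff linked_sym by metis
      then show ?thesis using e_i[OF aR(3)] a(2) by simp
    qed
    have nz: "?e r \<notin> fs.span (BB \<union> ?e ` A)"
    proof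
      assume "?e r \<in> fs.span (BB \<union> ?e ` A)"
      then have "component_sum N (?comp r) (?e r) = 0" by (rule component_sum_span_0[rotated]) (rule zero)
      then show False unfolding e_i[OF rW] by simp
    qed
    have IH: "fs.independent (BB \<union> ?e ` A)" "card (BB \<union> ?e ` A) = card BB + card A"
      using insert.IH insert.prems by blast+
    have ind: "fs.independent (insert (?e r) (BB \<union> ?e ` A))"
      by (rule fs.independent_insertI[OF nz IH(1)])
    have "?e r \<notin> BB \<union> ?e ` A" by (rule contrapos_nn[OF nz fs.span_base])
    moreover have "finite (BB \<union> ?e ` A)"
    proof -
      have "B0 N w t \<subseteq> fs.span (?e ` {0..<int N})"
      proof
        fix b assume "b \<in> B0 N w t"
        then have b0: "b j = 0" if "j \<ge> N" for j using that by (auto simp: B0_def bdry_def)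
        have "b = (\<Sum>x<N. scaleF (b x) (?e (int x)))"
        proof
          fix j
          have "(\<Sum>x<N. scaleF (b x) (?e (int x))) j = (\<Sum>x<N. scaleF (b x) (?e (int x)) j)" by (rule sum_fun_apply)
          also have "\<dots> = (\<Sum>x<N. if x = j then b x else 0)"
            by (intro sum.cong refl) (auto simp: scaleF_def indicator_vec_def nat_mod_distrib)
          also have "\<dots> = b j" using b0[of j] by (auto simp: sum.delta)
          finally show "b j = (\<Sum>x<N. scaleF (b x) (?e (int x))) j" by simp
        qed
        moreover have "\<dots> \<in> fs.span (?e ` {0..<int N})"
          by (intro fs.span_sum fs.span_scale fs.span_base) auto
        ultimately show "b \<in> fs.span (?e ` {0..<int N})" by metis
      qed
      then have "finite BB" using fs.independent_span_bound[of "?e ` {0..<int N}" BB] BB(1,2) by auto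
      then show ?thesis using insert.hyps by simp
    qed
    ultimately have "card (insert (?e r) (BB \<union> ?e ` A)) = Suc (card BB + card A)" using IH(2) by simp
    moreover have "BB \<union> ?e ` insert r A = insert (?e r) (BB \<union> ?e ` A)" by blast
    ultimately show ?case using ind insert.hyps by simp
  qed
  have "fs.span (BB \<union> ?e ` R) = ?V"
  proof -
    have spu: "fs.span (BB \<union> ?e ` R) = {x + y | x y. x \<in> fs.span (?e ` R) \<and> y \<in> B0 N w t}"
      unfolding spBB[symmetric] using fs.span_Un[of "?e ` R" BB] by (simp add: Un_commute)
    have sC0: "fs.subspace (C0 N w s)"
      unfolding fs.subspace_def C0_def by (auto simp: scaleF_def) (metis add.right_neutral)
    have "?e ` R \<subseteq> C0 N w s"
    proof clarify
      fix r assume "r \<in> R"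
      then have "?W r \<le> s" using R(1) by auto
      then show "?e r \<in> C0 N w s"
        using unroll_mod[OF N, of r] by (auto simp: C0_def Kverts_def indicator_vec_def unroll_def)
    qed
    then have sub1: "fs.span (?e ` R) \<subseteq> C0 N w s" using fs.span_minimal sC0 by blast
    have sub2: "C0 N w s \<subseteq> fs.span (BB \<union> ?e ` R)"
    proof
      fix a assume a: "a \<in> C0 N w s"
      have "a = (\<Sum>x\<in>{x. x < N \<and> w x \<le> s}. scaleF (a x) (?e (int x)))"
      proof
        fix j
        have "(\<Sum>x\<in>{x. x < N \<and> w x \<le> s}. scaleF (a x) (?e (int x))) j
            = (\<Sum>x\<in>{x. x < N \<and> w x \<le> s}. scaleF (a x) (?e (int x)) j)" by (rule sum_fun_apply)
        also have "\<dots> = (\<Sum>x\<in>{x. x < N \<and> w x \<le> s}. if x = j then a x else 0)"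
          by (intro sum.cong refl) (auto simp: scaleF_def indicator_vec_def nat_mod_distrib)
        also have "\<dots> = a j" using a by (auto simp: sum.delta' C0_def Kverts_def)
        finally show "a j = (\<Sum>x\<in>{x. x < N \<and> w x \<le> s}. scaleF (a x) (?e (int x))) j" by simp
      qed
      moreover have "\<dots> \<in> fs.span (BB \<union> ?e ` R)"
      proof (intro fs.span_sum fs.span_scale)
        fix x assume x: "x \<in> {x. x < N \<and> w x \<le> s}"
        then have "?comp (int x) \<in> ?comp ` R" unfolding R(3) by (auto simp: unroll_int)
        then obtain r where r: "r \<in> R" "(r, int x) \<in> linked (int N) ?W t" using component_eq_iff by (metis imageE)
        have "?e (int x) - ?e r \<in> fs.span (BB \<union> ?e ` R)"
          using linked_B0[OF N r(2)] spBB fs.span_mono[of BB "BB \<union> ?e ` R"] by blast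
        moreover have "?e r \<in> fs.span (BB \<union> ?e ` R)" using r(1) by (intro fs.span_base) auto
        ultimately show "?e (int x) \<in> fs.span (BB \<union> ?e ` R)" using fs.span_add[of "?e (int x) - ?e r" _ "?e r"] by simp
      qed
      ultimately show "a \<in> fs.span (BB \<union> ?e ` R)" by metis
    qed
    show ?thesis
    proof
      show "fs.span (BB \<union> ?e ` R) \<subseteq> ?V" unfolding spu using sub1 by blast
      show "?V \<subseteq> fs.span (BB \<union> ?e ` R)"
        using sub2 spBB fs.span_mono[of BB "BB \<union> ?e ` R"] by (auto intro!: fs.span_add)
    qed
  qed
  then have "fdim ?V = card BB + card R"
    using step[OF subset_refl] fs.dim_span_eq_card_independent by metis
  then have "hrank 0 N w s t = card R" using BB(4) by (simp add: hrank_def)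
  also have "\<dots> = card (?comp ` R)" using R(2) by (simp add: card_image)
  finally show ?thesis using R(3) by simp
qed

text \<open>The coefficients of a cycle are the same on all edges, so a cycle vanishes as soon as
  one edge is missing.\<close>

lemma hrank_1_eq:
  assumes N: "N > 0"
  shows "hrank 1 N w s t = of_bool (\<forall>i. unroll N w i \<le> s)"
proof -
  have const: "c x = c 0" if c: "bdry N c = (\<lambda>_. 0)" and "x < N" for c x
    using that(2)
  proof (induction x)
    case (Suc x)
    have "bdry N c (Suc x) = 0" using c by simp
    moreover have "(Suc x + N - 1) mod N = x" using Suc.prems by simp
    ultimately show ?case using Suc by (simp add: bdry_def)
  qed simp
  show ?thesis
  proof (cases "\<forall>i. unroll N w i \<le> s")
    case True
    then have wle: "w x \<le> s" if "x < N" for x using unroll_int[OF that, of w] by metis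
    let ?u = "\<lambda>x. of_bool (x < N) :: real"
    have "Z1 N w s = fs.span {?u}"
    proof
      show "Z1 N w s \<subseteq> fs.span {?u}"
      proof
        fix c assume "c \<in> Z1 N w s"
        then have c: "bdry N c = (\<lambda>_. 0)" "\<And>x. \<not> x < N \<Longrightarrow> c x = 0" by (auto simp: Z1_def C1_def Kedges_def)
        have "c = scaleF (c 0) ?u"
        proof
          fix x show "c x = scaleF (c 0) ?u x"
            using const[OF c(1), of x] c(2)[of x] by (cases "x < N") (simp_all add: scaleF_def)
        qed
        then show "c \<in> fs.span {?u}" by (metis fs.span_base fs.span_scale singletonI)
      qed
      have "?u \<in> Z1 N w s" using wle N by (auto simp: Z1_def C1_def Kedges_def bdry_def fun_eq_iff)
      moreover have "fs.subspace (Z1 N w s)"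
        unfolding fs.subspace_def Z1_def C1_def
        by (auto simp: scaleF_def bdry_def fun_eq_iff) (metis add.right_neutral)
      ultimately show "fs.span {?u} \<subseteq> Z1 N w s" by (intro fs.span_minimal) auto
    qed
    moreover have "fs.independent {?u}"
    proof (rule fs.independent_insertI)
      show "?u \<notin> fs.span {}" using N by (auto simp: fun_eq_iff)
    qed (rule fs.independent_empty)
    ultimately have "fdim (Z1 N w s) = 1" using fs.dim_span_eq_card_independent[of "{?u}"] by simp
    then show ?thesis using True by (simp add: hrank_def)
  next
    case False
    then obtain i where "\<not> unroll N w i \<le> s" by blast
    then have x: "nat (i mod int N) < N" "\<not> w (nat (i mod int N)) \<le> s" using unroll_mod[OF N] by (auto simp: unroll_def)
    have "Z1 N w s = fs.span {}"
    proof -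
      have "c = 0" if "c \<in> Z1 N w s" for c
      proof -
        have c: "bdry N c = (\<lambda>_. 0)" "\<And>x. c x \<noteq> 0 \<Longrightarrow> x < N \<and> w x \<le> s" using that by (auto simp: Z1_def C1_def Kedges_def)
        have "c (nat (i mod int N)) = 0" using c(2) x by blast
        then have "c 0 = 0" using const[OF c(1) x(1)] by simp
        then have "c x = 0" for x using const[OF c(1), of x] c(2)[of x] by (cases "x < N") auto
        then show ?thesis by (simp add: fun_eq_iff)
      qed
      moreover have "0 \<in> Z1 N w s" by (auto simp: Z1_def C1_def bdry_def)
      ultimately show ?thesis by auto
    qed
    then have "fdim (Z1 N w s) = 0" using fs.dim_span_eq_card_independent[OF fs.independent_empty] by simp
    then show ?thesis using False by (simp add: hrank_def)
  qed
qed

section \<open>Persistence diagrams by the elder rule\<close>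

definition diagram_of :: "(real \<Rightarrow> real \<Rightarrow> nat) \<Rightarrow> (real \<times> ereal) multiset \<Rightarrow> bool" where
  "diagram_of r D \<longleftrightarrow> (\<forall>p \<in># D. ereal (fst p) < snd p) \<and>
     (\<forall>s t. s \<le> t \<longrightarrow> r s t = size (filter_mset (\<lambda>p. fst p \<le> s \<and> ereal t < snd p) D))"

lemma PH_diagram_of: "PH k N w = (THE D. diagram_of (hrank k N w) D)"
  unfolding PH_def diagram_of_def ..

lemma finite_gap_below:
  fixes b :: real
  assumes "finite S"
  obtains s where "s < b" "\<And>x. x \<in> S \<Longrightarrow> x < b \<Longrightarrow> x \<le> s"
proof
  let ?A = "insert (b - 1) {x \<in> S. x < b}"
  have A: "finite ?A" "?A \<noteq> {}" using assms by auto
  show "Max ?A < b" using A by (subst Max_less_iff) auto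
  show "x \<le> Max ?A" if "x \<in> S" "x < b" for x using A(1) that by (intro Max_ge) auto
qed

lemma finite_ereal_gap_below:
  fixes b :: real
  assumes "finite S" "ereal b < d" "\<And>y. y \<in> S \<Longrightarrow> y \<noteq> - \<infinity>"
  obtains t where "b \<le> t" "ereal t < d" "\<And>y. y \<in> S \<Longrightarrow> y < d \<Longrightarrow> y \<le> ereal t"
proof
  let ?A = "insert b (real_of_ereal ` {y \<in> S. y < d})"
  have A: "finite ?A" "?A \<noteq> {}" using assms(1) by auto
  have y: "ereal (real_of_ereal y) = y" if "y \<in> S" "y < d" for y
    using that assms(3)[of y] by (cases y) auto
  show "b \<le> Max ?A" using A(1) by (intro Max_ge) auto
  have "Max ?A \<in> ?A" using A by (rule Max_in)
  then show "ereal (Max ?A) < d" using assms(2) y by auto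
  show "y' \<le> ereal (Max ?A)" if "y' \<in> S" "y' < d" for y'
  proof -
    have "real_of_ereal y' \<le> Max ?A" using A(1) that by (intro Max_ge) auto
    then show ?thesis using y[OF that] by (metis ereal_less_eq(3))
  qed
qed

lemma size_filter_diff:
  assumes "\<And>p. p \<in># D \<Longrightarrow> P p \<longleftrightarrow> Q p \<or> R p" "\<And>p. p \<in># D \<Longrightarrow> \<not> (Q p \<and> R p)"
  shows "size (filter_mset P D) = size (filter_mset Q D) + size (filter_mset R D)"
  using assms
proof (induction D)
  case (add x D)
  have IH: "size (filter_mset P D) = size (filter_mset Q D) + size (filter_mset R D)"
    using add.prems by (intro add.IH) simp_all
  show ?case using IH add.prems(1)[of x] add.prems(2)[of x] by auto
qed simp

text \<open>The multiplicity of \<open>(b, d)\<close> is an inclusion-exclusion of ranks at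
  \<open>b\<close> and just below it, and at \<open>d\<close> and just below it. The auxiliary
  levels \<open>s\<close> and \<open>t\<close> are chosen beyond the finitely many other coordinates
  of both diagrams; for infinite \<open>d\<close> no point dies later.\<close>

lemma diagram_of_unique:
  assumes D: "diagram_of r D" and D': "diagram_of r D'"
  shows "D = D'"
proof (rule multiset_eqI)
  fix p :: "real \<times> ereal"
  obtain b d where p: "p = (b, d)" by (cases p)
  show "count D p = count D' p"
  proof (cases "ereal b < d")
    case False
    then show ?thesis using D D' p unfolding diagram_of_def by (metis fst_conv snd_conv not_in_iff)
  next
    case bd: True
    have fin: "finite (set_mset (D + D'))" by simp
    obtain s where s: "s < b" "\<And>q. q \<in># D + D' \<Longrightarrow> fst q < b \<Longrightarrow> fst q \<le> s"
      by (rule finite_gap_below[of "fst ` set_mset (D + D')" b]) auto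
    have ninf: "y \<noteq> - \<infinity>" if "y \<in> snd ` set_mset (D + D')" for y
      using that D D' unfolding diagram_of_def by (auto simp: less_ereal.simps)
    obtain t where t: "b \<le> t" "ereal t < d" "\<And>q. q \<in># D + D' \<Longrightarrow> snd q < d \<Longrightarrow> snd q \<le> ereal t"
      by (rule finite_ereal_gap_below[of "snd ` set_mset (D + D')" b d]) (use bd ninf in auto)
    have ge: "size (filter_mset (\<lambda>q. fst q = b \<and> d \<le> snd q) E) = r b t - r s t"
      and gt: "d = ereal \<delta> \<Longrightarrow> size (filter_mset (\<lambda>q. fst q = b \<and> d < snd q) E) = r b \<delta> - r s \<delta>"
      if E: "E = D \<or> E = D'" for E \<delta>
    proof -
      have sub: "q \<in># D + D'" if "q \<in># E" for q using that E by auto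
      have rE: "r s t = size (filter_mset (\<lambda>p. fst p \<le> s \<and> ereal t < snd p) E)" if "s \<le> t" for s t
        using E D D' that unfolding diagram_of_def by auto
      have "size (filter_mset (\<lambda>p. fst p \<le> b \<and> ereal t < snd p) E) =
         size (filter_mset (\<lambda>p. fst p \<le> s \<and> ereal t < snd p) E) + size (filter_mset (\<lambda>q. fst q = b \<and> d \<le> snd q) E)"
      proof (rule size_filter_diff)
        fix q assume "q \<in># E"
        note q = sub[OF this]
        have "ereal t < snd q \<longleftrightarrow> d \<le> snd q" using t(2) t(3)[OF q] by (meson not_le order_less_le_trans)
        moreover have "fst q \<le> b \<longleftrightarrow> fst q \<le> s \<or> fst q = b" using s(1) s(2)[OF q] by linarith
        ultimately show "(fst q \<le> b \<and> ereal t < snd q) = (fst q \<le> s \<and> ereal t < snd q \<or> fst q = b \<and> d \<le> snd q)" by blast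
        show "\<not> ((fst q \<le> s \<and> ereal t < snd q) \<and> fst q = b \<and> d \<le> snd q)" using s(1) by auto
      qed
      then show "size (filter_mset (\<lambda>q. fst q = b \<and> d \<le> snd q) E) = r b t - r s t"
        using rE[of b t] rE[of s t] s(1) t(1) by simp
      assume d: "d = ereal \<delta>"
      have "size (filter_mset (\<lambda>p. fst p \<le> b \<and> ereal \<delta> < snd p) E) =
         size (filter_mset (\<lambda>p. fst p \<le> s \<and> ereal \<delta> < snd p) E) + size (filter_mset (\<lambda>q. fst q = b \<and> d < snd q) E)"
      proof (rule size_filter_diff)
        fix q assume "q \<in># E"
        note q = sub[OF this]
        have "fst q \<le> b \<longleftrightarrow> fst q \<le> s \<or> fst q = b" using s(1) s(2)[OF q] by linarith
        then show "(fst q \<le> b \<and> ereal \<delta> < snd q) = (fst q \<le> s \<and> ereal \<delta> < snd q \<or> fst q = b \<and> d < snd q)" using d by blast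
        show "\<not> ((fst q \<le> s \<and> ereal \<delta> < snd q) \<and> fst q = b \<and> d < snd q)" using s(1) by auto
      qed
      moreover have "b < \<delta>" using bd d by simp
      ultimately show "size (filter_mset (\<lambda>q. fst q = b \<and> d < snd q) E) = r b \<delta> - r s \<delta>"
        using rE[of b \<delta>] rE[of s \<delta>] s(1) by simp
    qed
    have cnt: "size (filter_mset (\<lambda>q. fst q = b \<and> d \<le> snd q) E) =
        count E p + size (filter_mset (\<lambda>q. fst q = b \<and> d < snd q) E)" for E
    proof -
      have "size (filter_mset (\<lambda>q. fst q = b \<and> d \<le> snd q) E) =
        size (filter_mset (\<lambda>q. q = p) E) + size (filter_mset (\<lambda>q. fst q = b \<and> d < snd q) E)"
        by (rule size_filter_diff) (auto simp: p prod_eq_iff le_less)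
      then show ?thesis by (simp add: filter_eq_replicate_mset)
    qed
    have "size (filter_mset (\<lambda>q. fst q = b \<and> d < snd q) D) = size (filter_mset (\<lambda>q. fst q = b \<and> d < snd q) D')"
    proof (cases d)
      case (real \<delta>)
      then show ?thesis using gt[of D \<delta>] gt[of D' \<delta>] by simp
    qed (use bd in auto)
    then show ?thesis using cnt[of D] cnt[of D'] ge[of D] ge[of D'] by simp
  qed
qed

section \<open>The elder rule\<close>

text \<open>Equal values are ordered by index, so that every component has exactly one elder
  vertex.\<close>

definition elder :: "nat \<Rightarrow> (nat \<Rightarrow> real) \<Rightarrow> real \<Rightarrow> nat \<Rightarrow> bool" where
  "elder N w t v \<longleftrightarrow> v < N \<and> w v \<le> t \<and>
     (\<forall>x<N. (int v, int x) \<in> linked (int N) (unroll N w) t \<longrightarrow> w v < w x \<or> w v = w x \<and> v \<le> x)"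

lemma elder_antimono:
  assumes "elder N w t v" "w v \<le> t'" "t' \<le> t"
  shows "elder N w t' v"
  using assms linked_mono unfolding elder_def by blast

lemma card_components_elder:
  assumes N: "N > 0" and st: "s \<le> t"
  shows "card (component (int N) (unroll N w) t ` {i. unroll N w i \<le> s}) = card {v. elder N w t v \<and> w v \<le> s}"
proof -
  let ?W = "unroll N w" and ?comp = "component (int N) (unroll N w) t"
  let ?E = "{v. elder N w t v \<and> w v \<le> s}"
  have inj: "inj_on (\<lambda>v. ?comp (int v)) ?E"
  proof (rule inj_onI)
    fix v v' assume v: "v \<in> ?E" "v' \<in> ?E" "?comp (int v) = ?comp (int v')"
    then have lk: "(int v, int v') \<in> linked (int N) ?W t" "(int v', int v) \<in> linked (int N) ?W t"
      unfolding component_eq_iff using linked_sym by blast+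
    have "w v < w v' \<or> w v = w v' \<and> v \<le> v'" "w v' < w v \<or> w v' = w v \<and> v' \<le> v"
      using v(1,2) lk by (simp_all add: elder_def)
    then show "v = v'" by linarith
  qed
  have img: "(\<lambda>v. ?comp (int v)) ` ?E = ?comp ` {i. ?W i \<le> s}"
  proof (intro equalityI subsetI)
    fix c assume "c \<in> (\<lambda>v. ?comp (int v)) ` ?E"
    then show "c \<in> ?comp ` {i. ?W i \<le> s}" by (auto simp: elder_def unroll_int)
  next
    fix c assume "c \<in> ?comp ` {i. ?W i \<le> s}"
    then obtain i where i: "?W i \<le> s" "c = ?comp i" by blast
    define X where "X = {x. x < N \<and> (i, int x) \<in> linked (int N) ?W t}"
    have finX: "finite X" by (simp add: X_def)
    have "(i, i mod int N) \<in> linked (int N) ?W t" by (rule linked_mod) (use i st in auto)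
    then have iX: "nat (i mod int N) \<in> X" using N unroll_mod[OF N, of i] by (simp add: X_def)
    define m where "m = Min (w ` X)"
    have mX: "m \<in> w ` X" unfolding m_def using finX iX by (intro Min_in) auto
    define v where "v = Min {x \<in> X. w x = m}"
    have "v \<in> {x \<in> X. w x = m}" unfolding v_def using finX mX by (intro Min_in) auto
    then have v: "v \<in> X" "w v = m" by auto
    have m_le: "m \<le> w x" if "x \<in> X" for x unfolding m_def using finX that by auto
    have v_le: "v \<le> x" if "x \<in> X" "w x = m" for x unfolding v_def using finX that by (intro Min_le) auto
    have wvs: "w v \<le> s" using m_le[OF iX] v(2) i(1) by (simp add: unroll_def)
    have iv: "(i, int v) \<in> linked (int N) ?W t" using v(1) by (simp add: X_def)
    have "elder N w t v" unfolding elder_def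
    proof (intro conjI allI impI)
      show "v < N" using v(1) by (simp add: X_def)
      show "w v \<le> t" using wvs st by simp
      fix x assume "x < N" "(int v, int x) \<in> linked (int N) ?W t"
      then have "x \<in> X" using iv linked_trans by (auto simp: X_def)
      then show "w v < w x \<or> w v = w x \<and> v \<le> x" using m_le[of x] v_le[of x] v(2) by force
    qed
    moreover have "?comp i = ?comp (int v)" using iv component_eq_iff by blast
    ultimately show "c \<in> (\<lambda>v. ?comp (int v)) ` ?E" using wvs i(2) by blast
  qed
  show ?thesis unfolding img[symmetric] by (rule card_image[OF inj])
qed

lemma linked_cong: "(\<And>i. W i \<le> t \<longleftrightarrow> W i \<le> t') \<Longrightarrow> linked n W t = linked n W t'"
  unfolding linked_def by simp

text \<open>Once lost, being elder is lost for good, since components only grow with the level. The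
  change happens at one of finitely many vertex values, and \<open>d v\<close> is the first of
  these.\<close>

lemma elder_death:
  obtains d :: "nat \<Rightarrow> ereal" where "\<And>v t. v < N \<Longrightarrow> w v \<le> t \<Longrightarrow> elder N w t v \<longleftrightarrow> ereal t < d v"
proof -
  define S where "S v = {w x | x. x < N \<and> w v \<le> w x \<and> \<not> elder N w (w x) v}" for v
  define d where "d v = (if S v = {} then \<infinity> else ereal (Min (S v)))" for v
  have fin: "finite (S v)" for v unfolding S_def by simp
  have "elder N w t v \<longleftrightarrow> ereal t < d v" if v: "v < N" "w v \<le> t" for v t
  proof
    assume e: "elder N w t v"
    show "ereal t < d v"
    proof (cases "S v = {}")
      case False
      have "t < m" if "m \<in> S v" for m
      proof (rule ccontr)
        assume "\<not> t < m"
        then show False using that elder_antimono[OF e, of m] by (auto simp: S_def)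
      qed
      then show ?thesis using False fin by (simp add: d_def)
    qed (simp add: d_def)
  next
    assume d: "ereal t < d v"
    show "elder N w t v"
    proof (rule ccontr)
      assume ne: "\<not> elder N w t v"
      let ?A = "{w x | x. x < N \<and> w x \<le> t}"
      \<comment> \<open>The largest vertex value not above \<open>t\<close>. The links at level
        \<open>\<tau>\<close> are those at level \<open>t\<close>, so the loss is already visible at
        a vertex value.\<close>
      define \<tau> where "\<tau> = Max ?A"
      have A: "finite ?A" "w v \<in> ?A" using v by auto
      have \<tau>: "\<tau> \<in> ?A" unfolding \<tau>_def using A by (intro Max_in) auto
      have ge: "w x \<le> \<tau>" if "x < N" "w x \<le> t" for x unfolding \<tau>_def using A(1) that by (intro Max_ge) auto
      have N: "N > 0" using v by simp
      have "unroll N w i \<le> t \<longleftrightarrow> unroll N w i \<le> \<tau>" for i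
        using ge[OF unroll_mod[OF N, of i]] \<tau> by (auto simp: unroll_def)
      then have "linked (int N) (unroll N w) t = linked (int N) (unroll N w) \<tau>" by (rule linked_cong)
      moreover have "w v \<le> \<tau>" using ge v by blast
      ultimately have "\<not> elder N w \<tau> v" using ne v unfolding elder_def by simp
      then have "\<tau> \<in> S v" using \<tau> \<open>w v \<le> \<tau>\<close> by (auto simp: S_def)
      then have "d v \<le> ereal \<tau>" using fin by (auto simp: d_def)
      moreover have "\<tau> \<le> t" using \<tau> by auto
      ultimately show False using d by (metis ereal_less_eq(3) not_le order_trans)
    qed
  qed
  then show ?thesis using that by blast
qed

text \<open>Each vertex that is elder at its own birth contributes a point with its value as birth
  and \<open>d v\<close> as death; the other vertices never are elder. Counting elders at level
  \<open>t\<close> among vertices born by \<open>s\<close> counts components.\<close>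

lemma ex_diagram_of_hrank_0:
  assumes N: "N > 0"
  obtains D where "diagram_of (hrank 0 N w) D" "size D = card {v. elder N w (w v) v}"
    "fst ` set_mset D = w ` {v. elder N w (w v) v}"
proof -
  obtain d where d: "\<And>v t. v < N \<Longrightarrow> w v \<le> t \<Longrightarrow> elder N w t v \<longleftrightarrow> ereal t < d v" using elder_death[of N w] by blast
  let ?E = "{v. elder N w (w v) v}"
  define D where "D = image_mset (\<lambda>v. (w v, d v)) (mset_set ?E)"
  have finE: "finite ?E" by (rule finite_subset[of _ "{..<N}"]) (auto simp: elder_def)
  have "ereal (w v) < d v" if "elder N w (w v) v" for v
    using that d[of v "w v"] by (simp add: elder_def)
  then have "\<forall>p \<in># D. ereal (fst p) < snd p" using finE by (auto simp: D_def)
  moreover have "hrank 0 N w s t = size (filter_mset (\<lambda>p. fst p \<le> s \<and> ereal t < snd p) D)" if st: "s \<le> t" for s t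
  proof -
    have set_eq: "{v. elder N w t v \<and> w v \<le> s} = {v \<in> ?E. w v \<le> s \<and> ereal t < d v}"
    proof (intro set_eqI iffI)
      fix v assume "v \<in> {v. elder N w t v \<and> w v \<le> s}"
      then have v: "elder N w t v" "w v \<le> s" by auto
      then show "v \<in> {v \<in> ?E. w v \<le> s \<and> ereal t < d v}"
        using elder_antimono[OF v(1), of "w v"] d[of v t] st by (auto simp: elder_def)
    next
      fix v assume "v \<in> {v \<in> ?E. w v \<le> s \<and> ereal t < d v}"
      then show "v \<in> {v. elder N w t v \<and> w v \<le> s}" using d[of v t] st by (auto simp: elder_def)
    qed
    have "hrank 0 N w s t = card {v. elder N w t v \<and> w v \<le> s}"
      unfolding hrank_0_eq_card_components[OF N st] by (rule card_components_elder[OF N st])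
    also have "\<dots> = card {v \<in> ?E. w v \<le> s \<and> ereal t < d v}" unfolding set_eq ..
    also have "\<dots> = size (filter_mset (\<lambda>p. fst p \<le> s \<and> ereal t < snd p) D)"
      unfolding D_def filter_mset_image_mset using finE by (simp add: filter_mset_mset_set)
    finally show ?thesis .
  qed
  ultimately have "diagram_of (hrank 0 N w) D" unfolding diagram_of_def by blast
  then show ?thesis using that finE by (simp add: D_def image_image)
qed

lemma unroll_le_all_iff:
  assumes N: "N > 0"
  shows "(\<forall>i. unroll N w i \<le> s) \<longleftrightarrow> Max (w ` {..<N}) \<le> s"
proof -
  have "(\<forall>i. unroll N w i \<le> s) \<longleftrightarrow> (\<forall>x<N. w x \<le> s)"
    using unroll_mod[OF N] unroll_int[of _ N w] unfolding unroll_def by metis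
  also have "\<dots> \<longleftrightarrow> Max (w ` {..<N}) \<le> s" using N by (subst Max_le_iff) auto
  finally show ?thesis .
qed

lemma diagram_of_hrank_1:
  assumes N: "N > 0"
  shows "diagram_of (hrank 1 N w) {#(Max (w ` {..<N}), \<infinity>)#}"
  unfolding diagram_of_def hrank_1_eq[OF N] unroll_le_all_iff[OF N] by simp

lemma PH_eqI: "diagram_of (hrank k N w) D \<Longrightarrow> PH k N w = D"
  unfolding PH_diagram_of by (rule the_equality) (auto intro: diagram_of_unique)

lemma diagram_of_PH:
  assumes "N > 0" "k \<in> {0, 1}"
  shows "diagram_of (hrank k N w) (PH k N w)"
proof -
  obtain D where "diagram_of (hrank 0 N w) D" by (rule ex_diagram_of_hrank_0[OF assms(1)])
  then have "\<exists>D. diagram_of (hrank k N w) D"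
    using assms(2) diagram_of_hrank_1[OF assms(1), of w] by auto
  then show ?thesis using PH_eqI by metis
qed

lemma PH_eq_iff:
  assumes "N > 0" "N' > 0" "k \<in> {0, 1}"
  shows "PH k N w = PH k N' w' \<longleftrightarrow> (\<forall>s t. s \<le> t \<longrightarrow> hrank k N w s t = hrank k N' w' s t)"
proof
  assume "PH k N w = PH k N' w'"
  then show "\<forall>s t. s \<le> t \<longrightarrow> hrank k N w s t = hrank k N' w' s t"
    using diagram_of_PH[OF assms(1,3), of w] diagram_of_PH[OF assms(2,3), of w'] unfolding diagram_of_def by simp
next
  assume *: "\<forall>s t. s \<le> t \<longrightarrow> hrank k N w s t = hrank k N' w' s t"
  then have "diagram_of (hrank k N w) (PH k N' w')"
    using diagram_of_PH[OF assms(2,3), of w'] unfolding diagram_of_def by simp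
  then show "PH k N w = PH k N' w'" by (rule PH_eqI)
qed

lemma PH_0_elder:
  assumes "N > 0"
  shows "size (PH 0 N w) = card {v. elder N w (w v) v}" "fst ` set_mset (PH 0 N w) = w ` {v. elder N w (w v) v}"
proof -
  obtain D where D: "diagram_of (hrank 0 N w) D" "size D = card {v. elder N w (w v) v}"
    "fst ` set_mset D = w ` {v. elder N w (w v) v}" using ex_diagram_of_hrank_0[OF assms] by blast
  then show "size (PH 0 N w) = card {v. elder N w (w v) v}"
    "fst ` set_mset (PH 0 N w) = w ` {v. elder N w (w v) v}" using PH_eqI[OF D(1)] by simp_all
qed

section \<open>Persistence of zigzag vectors\<close>

lemma card_image_eq_kernel:
  assumes "\<And>x y. x \<in> A \<Longrightarrow> y \<in> A \<Longrightarrow> f x = f y \<longleftrightarrow> g x = g y"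
  shows "card (f ` A) = card (g ` A)"
proof -
  have "bij_betw (\<lambda>c. g (inv_into A f c)) (f ` A) (g ` A)"
  proof (rule bij_betw_imageI)
    have inv: "inv_into A f (f x) \<in> A" "f (inv_into A f (f x)) = f x" if "x \<in> A" for x
      using that by (simp_all add: inv_into_into f_inv_into_f)
    then have g: "g (inv_into A f (f x)) = g x" if "x \<in> A" for x
      using assms that by blast
    show "inj_on (\<lambda>c. g (inv_into A f c)) (f ` A)" using g assms by (auto simp: inj_on_def)
    show "(\<lambda>c. g (inv_into A f c)) ` f ` A = g ` A" using g by (force simp: image_iff)
  qed
  then show ?thesis by (rule bij_betw_same_card)
qed

lemma card_image_less_kernel:
  assumes "finite (f ` A)" "\<And>x y. x \<in> A \<Longrightarrow> y \<in> A \<Longrightarrow> f x = f y \<Longrightarrow> g x = g y"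
    and "a \<in> A" "b \<in> A" "g a = g b" "f a \<noteq> f b"
  shows "card (g ` A) < card (f ` A)"
proof -
  define h where "h c = g (inv_into A f c)" for c
  have h: "h (f x) = g x" if "x \<in> A" for x
  proof -
    have "inv_into A f (f x) \<in> A" "f (inv_into A f (f x)) = f x"
      using that by (simp_all add: inv_into_into f_inv_into_f)
    then show ?thesis unfolding h_def using assms(2) that by blast
  qed
  have img: "g ` A = h ` f ` A" using h by (force simp: image_iff)
  have "\<not> inj_on h (f ` A)" using h assms(3-6) by (auto simp: inj_on_def)
  then have "card (h ` f ` A) \<noteq> card (f ` A)" using eq_card_imp_inj_on[OF assms(1)] by blast
  moreover have "card (h ` f ` A) \<le> card (f ` A)" by (rule card_image_le[OF assms(1)])
  ultimately show ?thesis using img by simp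
qed

lemma zigzag_le_max:
  assumes v: "alternating l v" and seg: "of_int k \<le> x" "x \<le> of_int k + 1" "of_int k \<le> y" "y \<le> of_int k + 1"
    and u: "x \<le> u" "u \<le> y"
  shows "zigzag v u \<le> max (zigzag v x) (zigzag v y)"
proof -
  have useg: "of_int k \<le> u" "u \<le> of_int k + 1" using seg u by linarith+
  have "\<not> zigzag v y < zigzag v u" if "even k"
    using zigzag_segment_less_iff(1)[OF v seg(3,4) useg that] u by simp
  moreover have "\<not> zigzag v x < zigzag v u" if "odd k"
    using zigzag_segment_less_iff(2)[OF v seg(1,2) useg that] u by simp
  ultimately show ?thesis by (cases "even k") auto
qed

text \<open>The vertex of the coarse polygon to which a point of phase \<open>x\<close> flows downhill; integral phases
  stay in place, even at a maximum.\<close>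

definition downhill :: "real \<Rightarrow> int" where
  "downhill x = (if x = of_int \<lfloor>x\<rfloor> \<or> even \<lfloor>x\<rfloor> then \<lfloor>x\<rfloor> else \<lfloor>x\<rfloor> + 1)"

lemma downhill_of_int [simp]: "downhill (of_int k) = k"
  by (simp add: downhill_def)

lemma downhill_segment:
  assumes "of_int k \<le> x" "x \<le> of_int k + 1"
  shows "downhill x = k \<or> downhill x = k + 1"
proof (cases "x = of_int k + 1")
  case True
  then have "x = of_int (k + 1)" by simp
  then show ?thesis by (simp only: downhill_of_int) simp
next
  case False
  then have "\<lfloor>x\<rfloor> = k" using assms by linarith
  then show ?thesis by (auto simp: downhill_def)
qed

lemma downhill_shift: "even l \<Longrightarrow> downhill (x + of_int l) = downhill x + l"
  by (simp add: downhill_def)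

lemma downhill_le:
  assumes v: "alternating l v"
  shows "v (downhill x) \<le> zigzag v x"
proof -
  have fl: "of_int \<lfloor>x\<rfloor> \<le> x" "x \<le> of_int \<lfloor>x\<rfloor> + 1" by linarith+
  show ?thesis
  proof (cases "x = of_int \<lfloor>x\<rfloor>")
    case True
    then show ?thesis by (metis downhill_of_int zigzag_of_int order_refl)
  next
    case False
    show ?thesis
    proof (cases "even \<lfloor>x\<rfloor>")
      case True
      then have "\<not> zigzag v x < zigzag v (of_int \<lfloor>x\<rfloor>)"
        using zigzag_segment_less_iff(1)[OF v fl, of "of_int \<lfloor>x\<rfloor>"] fl by auto
      then show ?thesis using True by (simp add: downhill_def)
    next
      case odd: False
      then have "\<not> zigzag v x < zigzag v (of_int (\<lfloor>x\<rfloor> + 1))"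
        using zigzag_segment_less_iff(2)[OF v fl, of "of_int (\<lfloor>x\<rfloor> + 1)"] fl by auto
      then show ?thesis using odd False by (simp only: zigzag_of_int downhill_def) simp
    qed
  qed
qed

context
  fixes n l :: int and \<theta> :: "int \<Rightarrow> real" and v :: "int \<Rightarrow> real"
  assumes \<theta>: "\<theta> \<in> phases n l" and n: "n > 0" and l: "l > 0" "even l" and v: "alternating l v"
begin

lemma linked_zigzag_same_phase:
  assumes "\<theta> i = \<theta> j" "zigzag v (\<theta> i) \<le> t"
  shows "(i, j) \<in> linked n (\<lambda>i. zigzag v (\<theta> i)) t"
proof -
  note mono = quasi_periodicD(1)[OF phases_quasi_periodic[OF \<theta>]]
  have *: "(i, j) \<in> linked n (\<lambda>i. zigzag v (\<theta> i)) t" if "i \<le> j" "\<theta> i = \<theta> j" "zigzag v (\<theta> i) \<le> t" for i j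
  proof (rule linked_upward[OF that(1)])
    fix m assume "i \<le> m" "m \<le> j"
    then have "\<theta> m = \<theta> i" using mono[of i m] mono[of m j] that(2) by simp
    then show "zigzag v (\<theta> m) \<le> t" using that(3) by simp
  qed
  show ?thesis
  proof (cases "i \<le> j")
    case False
    then have "(j, i) \<in> linked n (\<lambda>i. zigzag v (\<theta> i)) t" using assms by (intro *) auto
    then show ?thesis by (rule linked_sym)
  qed (rule *[OF _ assms])
qed

lemma linked_zigzag_segment:
  assumes "of_int k \<le> \<theta> i" "\<theta> i \<le> of_int k + 1" "of_int k \<le> \<theta> j" "\<theta> j \<le> of_int k + 1"
    and "zigzag v (\<theta> i) \<le> t" "zigzag v (\<theta> j) \<le> t"
  shows "(i, j) \<in> linked n (\<lambda>i. zigzag v (\<theta> i)) t"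
proof -
  note mono = quasi_periodicD(1)[OF phases_quasi_periodic[OF \<theta>]]
  have *: "(i, j) \<in> linked n (\<lambda>i. zigzag v (\<theta> i)) t"
    if "i \<le> j" and seg: "of_int k \<le> \<theta> i" "\<theta> i \<le> of_int k + 1" "of_int k \<le> \<theta> j" "\<theta> j \<le> of_int k + 1"
    and "zigzag v (\<theta> i) \<le> t" "zigzag v (\<theta> j) \<le> t" for i j
  proof (rule linked_upward[OF that(1)])
    fix m assume "i \<le> m" "m \<le> j"
    then have "\<theta> i \<le> \<theta> m" "\<theta> m \<le> \<theta> j" using mono by auto
    then show "zigzag v (\<theta> m) \<le> t" using zigzag_le_max[OF v seg] that(6,7) by fastforce
  qed
  show ?thesis
  proof (cases "i \<le> j")
    case False
    then have "(j, i) \<in> linked n (\<lambda>i. zigzag v (\<theta> i)) t" using assms by (intro *) auto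
    then show ?thesis by (rule linked_sym)
  qed (rule *[OF _ assms])
qed

text \<open>\<open>e\<close> places the coarse polygon at integral phases and
  \<open>downhill\<close> leads back. Both respect links, \<open>downhill\<close> undoes
  \<open>e\<close>, and every vertex is linked to the image under \<open>e\<close> of its downhill
  vertex, which is not higher.\<close>

lemma card_components_zigzag:
  assumes st: "s \<le> t"
  shows "card (component n (\<lambda>i. zigzag v (\<theta> i)) t ` {i. zigzag v (\<theta> i) \<le> s})
    = card (component l v t ` {k. v k \<le> s})"
proof -
  let ?W = "\<lambda>i. zigzag v (\<theta> i)"
  note qp = phases_quasi_periodic[OF \<theta>]
  have "\<exists>a. \<theta> a = of_int k" for k using phases_first_hit[OF \<theta> l(1)] by metis
  then obtain e where e: "\<And>k. \<theta> (e k) = of_int k" by metis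
  have We: "?W (e k) = v k" for k using e by simp
  have fwd: "(e k, e k') \<in> linked n ?W t" if "(k, k') \<in> linked l v t" for k k'
    using that
  proof (induction rule: linked_induct)
    case (step j k')
    have up: "(e m, e (m + 1)) \<in> linked n ?W t" if "v m \<le> t" "v (m + 1) \<le> t" for m
    proof (rule linked_zigzag_segment[of m])
      show "zigzag v (\<theta> (e m)) \<le> t" "zigzag v (\<theta> (e (m + 1))) \<le> t" unfolding We by (rule that)+
    qed (simp_all add: e)
    \<comment> \<open>The choice function \<open>e\<close> need not commute with the period:
      \<open>e (m + l)\<close> and \<open>e m + n\<close> may differ, but they have the same phase
      and are joined along it.\<close>
    have per: "(e m, e (m + l)) \<in> linked n ?W t" if "v m \<le> t" for m
    proof -
      have th: "\<theta> (e m + n) = \<theta> (e (m + l))" using quasi_periodicD(2)[OF qp, of "e m"] e by simp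
      have vper: "v (m + l) = v m" using v by (simp add: alternating_def)
      have W: "?W (e m + n) \<le> t" unfolding th using We vper that by simp
      have "(e m, e m + n) \<in> linked n ?W t" by (rule linked_step) (use that We W in auto)
      moreover have "(e m + n, e (m + l)) \<in> linked n ?W t" by (rule linked_zigzag_same_phase[OF th W])
      ultimately show ?thesis by (rule linked_trans)
    qed
    have "(e j, e k') \<in> linked n ?W t"
      using step(4) up[OF step(2)] linked_sym[OF up[OF step(3)]] per[OF step(2)] linked_sym[OF per[OF step(3)]]
        step(2,3) by (elim disjE) simp_all
    with step.IH show ?case by (rule linked_trans)
  qed simp
  have bwd: "(downhill (\<theta> i), downhill (\<theta> j)) \<in> linked l v t" if "(i, j) \<in> linked n ?W t" for i j
    using that
  proof (induction rule: linked_induct)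
    case (step j k)
    have up: "(downhill (\<theta> m), downhill (\<theta> (m + 1))) \<in> linked l v t" if "?W m \<le> t" "?W (m + 1) \<le> t" for m
    proof -
      have "downhill (\<theta> m) = \<lfloor>\<theta> m\<rfloor> \<or> downhill (\<theta> m) = \<lfloor>\<theta> m\<rfloor> + 1"
        by (rule downhill_segment) linarith+
      moreover have "downhill (\<theta> (m + 1)) = \<lfloor>\<theta> m\<rfloor> \<or> downhill (\<theta> (m + 1)) = \<lfloor>\<theta> m\<rfloor> + 1"
        by (rule downhill_segment) (use phases_step[OF \<theta>, of m] in linarith)+
      moreover have "v (downhill (\<theta> m)) \<le> t" "v (downhill (\<theta> (m + 1))) \<le> t"
        using downhill_le[OF v, of "\<theta> m"] downhill_le[OF v, of "\<theta> (m + 1)"] that by linarith+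
      ultimately show ?thesis
        by (cases "downhill (\<theta> m) = downhill (\<theta> (m + 1))") (auto intro!: linked_step)
    qed
    have per: "(downhill (\<theta> m), downhill (\<theta> (m + n))) \<in> linked l v t" if "?W m \<le> t" for m
    proof -
      have "v (downhill (\<theta> m)) \<le> t" using downhill_le[OF v, of "\<theta> m"] that by linarith
      moreover have "downhill (\<theta> (m + n)) = downhill (\<theta> m) + l"
        using quasi_periodicD(2)[OF qp, of m] downhill_shift[OF l(2)] by simp
      moreover have "v (downhill (\<theta> m) + l) = v (downhill (\<theta> m))" using v by (simp add: alternating_def)
      ultimately show ?thesis by (intro linked_step) auto
    qed
    have "(downhill (\<theta> j), downhill (\<theta> k)) \<in> linked l v t"
      using step(4) up[OF step(2)] linked_sym[OF up[OF step(3)]] per[OF step(2)] linked_sym[OF per[OF step(3)]]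
        step(2,3) by (elim disjE) simp_all
    with step.IH show ?case by (rule linked_trans)
  qed simp
  have "component n ?W t ` {i. ?W i \<le> s} = (\<lambda>k. component n ?W t (e k)) ` {k. v k \<le> s}"
  proof (intro equalityI subsetI)
    fix c assume "c \<in> component n ?W t ` {i. ?W i \<le> s}"
    then obtain i where i: "?W i \<le> s" "c = component n ?W t i" by blast
    let ?k = "downhill (\<theta> i)"
    have vk: "v ?k \<le> s" using downhill_le[OF v, of "\<theta> i"] i(1) by linarith
    have fl: "of_int \<lfloor>\<theta> i\<rfloor> \<le> \<theta> i" "\<theta> i \<le> of_int \<lfloor>\<theta> i\<rfloor> + 1" by linarith+
    have "of_int \<lfloor>\<theta> i\<rfloor> \<le> \<theta> (e ?k)" "\<theta> (e ?k) \<le> of_int \<lfloor>\<theta> i\<rfloor> + 1"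
      unfolding e using downhill_segment[OF fl] by auto
    then have "(i, e ?k) \<in> linked n ?W t"
      by (rule linked_zigzag_segment[OF fl]) (use i(1) vk We st in auto)
    then have "c = component n ?W t (e ?k)" using i(2) component_eq_iff by blast
    then show "c \<in> (\<lambda>k. component n ?W t (e k)) ` {k. v k \<le> s}" using vk by blast
  next
    fix c assume "c \<in> (\<lambda>k. component n ?W t (e k)) ` {k. v k \<le> s}"
    then show "c \<in> component n ?W t ` {i. ?W i \<le> s}" using We by force
  qed
  moreover have "card ((\<lambda>k. component n ?W t (e k)) ` {k. v k \<le> s}) = card (component l v t ` {k. v k \<le> s})"
  proof (rule card_image_eq_kernel)
    fix k k'
    have "(e k, e k') \<in> linked n ?W t \<Longrightarrow> (k, k') \<in> linked l v t" using bwd[of "e k" "e k'"] e by simp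
    then show "component n ?W t (e k) = component n ?W t (e k') \<longleftrightarrow> component l v t k = component l v t k'"
      unfolding component_eq_iff using fwd by blast
  qed
  ultimately show ?thesis by simp
qed

lemma zigzag_le_all_iff: "(\<forall>i. zigzag v (\<theta> i) \<le> s) \<longleftrightarrow> (\<forall>k. v k \<le> s)"
proof
  assume *: "\<forall>i. zigzag v (\<theta> i) \<le> s"
  show "\<forall>k. v k \<le> s"
  proof
    fix k
    obtain a where "\<theta> a = of_int k" using phases_first_hit[OF \<theta> l(1), of k] by metis
    then show "v k \<le> s" using spec[OF *, of a] by simp
  qed
next
  assume *: "\<forall>k. v k \<le> s"
  show "\<forall>i. zigzag v (\<theta> i) \<le> s"
  proof
    fix i
    have "zigzag v (\<theta> i) \<le> max (zigzag v (of_int \<lfloor>\<theta> i\<rfloor>)) (zigzag v (of_int (\<lfloor>\<theta> i\<rfloor> + 1)))"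
      by (rule zigzag_le_max[OF v, of "\<lfloor>\<theta> i\<rfloor>"]) (simp_all; linarith)+
    then show "zigzag v (\<theta> i) \<le> s" unfolding zigzag_of_int using spec[OF *, of "\<lfloor>\<theta> i\<rfloor>"] spec[OF *, of "\<lfloor>\<theta> i\<rfloor> + 1"] by linarith
  qed
qed

end

section \<open>The polygon of extrema\<close>

lemma unroll_polygon:
  assumes "M > 0" "alternating (2 * int M) v"
  shows "unroll (2 * M) (\<lambda>k. v (int k)) = v"
proof
  fix k
  have "v (k mod (2 * int M)) = v k" using periodic_mod[of v "2 * int M" k] assms(2) by (simp add: alternating_def)
  then show "unroll (2 * M) (\<lambda>k. v (int k)) k = v k" using assms(1) by (simp add: unroll_def)
qed

lemma PH_zigzag:
  assumes "N > 0" "M > 0" "\<theta> \<in> phases (int N) (2 * int M)" and v: "alternating (2 * int M) v"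
    and w: "\<And>i. unroll N w i = zigzag v (\<theta> i)" and k: "k \<in> {0, 1}"
  shows "PH k N w = PH k (2 * M) (\<lambda>k. v (int k))"
proof -
  have M2: "2 * M > 0" "2 * int M > 0" "int N > 0" using assms by auto
  note up = unroll_polygon[OF assms(2) v]
  have W: "unroll N w = (\<lambda>i. zigzag v (\<theta> i))" using w by auto
  have "hrank k N w s t = hrank k (2 * M) (\<lambda>k. v (int k)) s t" if "s \<le> t" for s t
  proof (cases "k = 0")
    case True
    then show ?thesis
      using hrank_0_eq_card_components[OF assms(1) that, of w] hrank_0_eq_card_components[OF M2(1) that, of "\<lambda>k. v (int k)"]
        card_components_zigzag[OF assms(3) M2(3,2) _ v that] unfolding up W by simp
  next
    case False
    then have "k = 1" using k by simp
    then show ?thesis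
      using hrank_1_eq[OF assms(1), of w s t] hrank_1_eq[OF M2(1), of "\<lambda>k. v (int k)" s t]
        zigzag_le_all_iff[OF assms(3) M2(3,2) _ v, of s] unfolding up W by simp
  qed
  then show ?thesis using PH_eq_iff[OF assms(1) M2(1) k] by blast
qed

text \<open>At its own level an even vertex is linked only to its own translates, both neighbours
  being strictly higher; an odd vertex is linked to a strictly lower neighbour.\<close>

lemma polygon_elder_iff:
  assumes M: "M > 0" and v: "alternating (2 * int M) v" and u: "u < 2 * M"
  shows "elder (2 * M) (\<lambda>k. v (int k)) (v (int u)) u \<longleftrightarrow> even u"
proof -
  let ?l = "2 * int M"
  note up = unroll_polygon[OF M v]
  have L: "int (2 * M) = ?l" by simp
  have per: "v (k + ?l) = v k" for k using v by (simp add: alternating_def)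
  have alt: "if even k then v k < v (k + 1) else v (k + 1) < v k" for k using v by (simp add: alternating_def)
  show ?thesis
  proof
    assume e: "elder (2 * M) (\<lambda>k. v (int k)) (v (int u)) u"
    show "even u"
    proof (rule ccontr)
      assume "odd u"
      then have lt: "v (int u + 1) < v (int u)" using alt[of "int u"] by simp
      let ?x = "nat ((int u + 1) mod ?l)"
      have x: "?x < 2 * M" "int ?x = (int u + 1) mod ?l" using M by (auto simp: nat_less_iff)
      have "v (int ?x) = v (int u + 1)" unfolding x(2) using periodic_mod[of v ?l "int u + 1"] per by simp
      moreover have "(int u, int u + 1) \<in> linked ?l v (v (int u))" by (rule linked_step) (use lt in auto)
      moreover have "(int u + 1, (int u + 1) mod ?l) \<in> linked ?l v (v (int u))"
        by (rule linked_mod) (use per lt in auto)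
      ultimately have "v (int u) < v (int ?x) \<or> v (int u) = v (int ?x) \<and> u \<le> ?x"
        using e x linked_trans unfolding elder_def up L by metis
      then show False using lt \<open>v (int ?x) = v (int u + 1)\<close> by simp
    qed
  next
    assume ev: "even u"
    have cls: "j mod ?l = int u mod ?l" if "(int u, j) \<in> linked ?l v (v (int u))" for j
      using that
    proof (induction rule: linked_induct)
      case (step j k)
      have "v (j mod ?l) = v j" "v (int u mod ?l) = v (int u)"
        using periodic_mod[of v ?l] per by simp_all
      then have vj: "v j = v (int u)" using step.IH by simp
      have evj: "even j" using step.IH ev by (metis dvd_mod_iff dvd_triv_left even_of_nat)
      have "k \<noteq> j + 1" using alt[of j] evj vj step(3) by auto
      moreover have "j \<noteq> k + 1" using alt[of k] evj vj step(3) by (auto split: if_splits)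
      ultimately have "k = j + ?l \<or> j = k + ?l" using step(4) by blast
      then show ?case using step.IH by auto
    qed simp
    show "elder (2 * M) (\<lambda>k. v (int k)) (v (int u)) u"
      unfolding elder_def up L
    proof (intro conjI allI impI)
      fix x assume x: "x < 2 * M" "(int u, int x) \<in> linked ?l v (v (int u))"
      have "int x mod ?l = int u mod ?l" by (rule cls[OF x(2)])
      then have "x = u" using x(1) u by simp
      then show "v (int u) < v (int x) \<or> v (int u) = v (int x) \<and> u \<le> x" by simp
    qed (use u in auto)
  qed
qed

lemma polygon_PH_0:
  assumes M: "M > 0" and v: "alternating (2 * int M) v"
  shows "size (PH 0 (2 * M) (\<lambda>k. v (int k))) = M"
    and "even k \<Longrightarrow> v k \<in> fst ` set_mset (PH 0 (2 * M) (\<lambda>k. v (int k)))"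
proof -
  have M2: "2 * M > 0" using M by simp
  have E: "{u. elder (2 * M) (\<lambda>k. v (int k)) (v (int u)) u} = (\<lambda>m. 2 * m) ` {..<M}"
  proof (intro equalityI subsetI)
    fix u assume "u \<in> {u. elder (2 * M) (\<lambda>k. v (int k)) (v (int u)) u}"
    then have "u < 2 * M" "elder (2 * M) (\<lambda>k. v (int k)) (v (int u)) u" by (auto simp: elder_def)
    then have "u < 2 * M" "even u" using polygon_elder_iff[OF M v] by auto
    then show "u \<in> (\<lambda>m. 2 * m) ` {..<M}" by (auto elim!: evenE)
  next
    fix u assume "u \<in> (\<lambda>m. 2 * m) ` {..<M}"
    then have "u < 2 * M" "even u" by auto
    then show "u \<in> {u. elder (2 * M) (\<lambda>k. v (int k)) (v (int u)) u}" using polygon_elder_iff[OF M v, of u] by simp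
  qed
  show "size (PH 0 (2 * M) (\<lambda>k. v (int k))) = M"
    using PH_0_elder(1)[OF M2, of "\<lambda>k. v (int k)"] unfolding E by (simp add: card_image inj_on_def)
  assume k: "even k"
  let ?u = "nat (k mod (2 * int M))"
  have "?u < 2 * M" using M by (simp add: nat_less_iff)
  moreover have iu: "int ?u = k mod (2 * int M)" using M by simp
  have "even (k mod (2 * int M))" using k by (simp add: dvd_mod_iff)
  then have "even ?u" using iu by (metis even_of_nat)
  ultimately have "elder (2 * M) (\<lambda>k. v (int k)) (v (int ?u)) ?u" using polygon_elder_iff[OF M v] by blast
  moreover have "v (int ?u) = v k" unfolding iu using periodic_mod[of v "2 * int M" k] v by (simp add: alternating_def)
  ultimately show "v k \<in> fst ` set_mset (PH 0 (2 * M) (\<lambda>k. v (int k)))"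
    unfolding PH_0_elder(2)[OF M2] by (intro image_eqI[of _ _ ?u]) auto
qed

text \<open>At a level below both peaks a path from \<open>k + 1\<close> stays in the translates by
  \<open>n\<close> of the open gap between \<open>k\<close> and \<open>m\<close>. The vertex
  \<open>k - 1\<close> lies in the complementary gaps.\<close>

lemma not_linked_across_peaks:
  assumes "k < m" "m < k + n" "t < W k" "t < W m" and per: "\<And>i. W (i + n) = W i" and "n > 0"
    and "W (k + 1) \<le> t"
  shows "(k + 1, k - 1) \<notin> linked n W t"
proof
  assume lk: "(k + 1, k - 1) \<in> linked n W t"
  have Wq: "W (i + q * n) = W i" for i q using int_period_mult[of W n 0 i q] per by simp
  have "\<exists>q. k + q * n < k - 1 \<and> k - 1 < m + q * n"
    using lk
  proof (induction rule: linked_induct)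
    case base
    have "k + 1 \<noteq> m" using assms(4,7) by auto
    then show ?case using assms(1) by (intro exI[of _ 0]) auto
  next
    case (step i j)
    then obtain q where q: "k + q * n < i" "i < m + q * n" by blast
    have ne: "j \<noteq> k + q * n" "j \<noteq> m + q * n" using step(3) Wq[of k q] Wq[of m q] assms(3,4) by auto
    consider "j = i + 1" | "i = j + 1" | "j = i + n" | "i = j + n" using step(4) by blast
    then show ?case
    proof cases
      case 1 then show ?thesis using q ne by (intro exI[of _ q]) auto
    next
      case 2 then show ?thesis using q ne by (intro exI[of _ q]) auto
    next
      case 3 then show ?thesis using q by (intro exI[of _ "q + 1"]) (auto simp: algebra_simps)
    next
      case 4 then show ?thesis using q by (intro exI[of _ "q - 1"]) (auto simp: algebra_simps)
    qed
  qed
  then obtain q where q: "k + q * n < k - 1" "k - 1 < m + q * n" by blast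
  then have "q * n < 0" by simp
  then have "q \<le> - 1" using \<open>n > 0\<close> by (simp add: mult_less_0_iff)
  then have "q * n \<le> (- 1) * n" using \<open>n > 0\<close> by (intro mult_right_mono) auto
  then show False using q(2) assms(2) by simp
qed

text \<open>A minimum is a birth. A maximum that is reached or exceeded by another vertex within the
  period joins two different components, so it is a death in degree 0. Otherwise it is the global
  maximum, where the cycle is born. Hence the diagrams leave finitely many choices for
  \<open>v\<close>.\<close>

lemma polygon_values:
  assumes M: "M > 0" and v: "alternating (2 * int M) v"
    and D0: "D0 = PH 0 (2 * M) (\<lambda>k. v (int k))" and D1: "D1 = PH 1 (2 * M) (\<lambda>k. v (int k))"
  shows "v k \<in> fst ` set_mset D0 \<union> real_of_ereal ` snd ` set_mset D0 \<union> fst ` set_mset D1"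
proof (cases "even k")
  case True
  then show ?thesis using polygon_PH_0(2)[OF M v] D0 by simp
next
  case odd: False
  let ?l = "2 * int M"
  have M2: "2 * M > 0" using M by simp
  note up = unroll_polygon[OF M v]
  have L: "int (2 * M) = ?l" by simp
  have per: "v (k + ?l) = v k" for k using v by (simp add: alternating_def)
  have low: "v (k + 1) < v k" "v (k - 1) < v k"
  proof -
    show "v (k + 1) < v k" using v odd by (simp add: alternating_def)
    have "even (k - 1)" using odd by simp
    then have "v (k - 1) < v (k - 1 + 1)" using v unfolding alternating_def by metis
    then show "v (k - 1) < v k" by simp
  qed
  show ?thesis
  proof (cases "\<exists>m. k < m \<and> m < k + ?l \<and> v k \<le> v m")
    case False
    have "v j \<le> v k" for j
    proof -
      let ?m = "k + (j - k) mod ?l"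
      have "v ?m = v j"
      proof -
        have "v (k + ((j - k) mod ?l)) = v (k + (j - k))"
          using periodic_mod[of "\<lambda>i. v (k + i)" ?l "j - k"] per[of "k + _"] by (simp add: add.assoc[symmetric])
        then show ?thesis by simp
      qed
      moreover have "v ?m \<le> v k"
      proof (cases "(j - k) mod ?l = 0")
        case nz: False
        have "0 \<le> (j - k) mod ?l" "(j - k) mod ?l < ?l" using M by auto
        then have "k < ?m" "?m < k + ?l" using nz by auto
        then have "\<not> v k \<le> v ?m" using False by blast
        then show ?thesis by simp
      qed simp
      ultimately show ?thesis by simp
    qed
    then have "(\<forall>j. v j \<le> s) \<longleftrightarrow> v k \<le> s" for s using order_trans by blast
    then have "Max ((\<lambda>k. v (int k)) ` {..<2 * M}) \<le> s \<longleftrightarrow> v k \<le> s" for s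
      using unroll_le_all_iff[OF M2, of "\<lambda>k. v (int k)" s] unfolding up by simp
    then have "Max ((\<lambda>k. v (int k)) ` {..<2 * M}) = v k" by (rule real_eq_by_upper_bounds)
    then have "D1 = {#(v k, \<infinity>)#}" unfolding D1 using PH_eqI[OF diagram_of_hrank_1[OF M2, of "\<lambda>k. v (int k)"]] by simp
    then show ?thesis by simp
  next
    case True
    then obtain m where m: "k < m" "m < k + ?l" "v k \<le> v m" by blast
    have dg: "diagram_of (hrank 0 (2 * M) (\<lambda>k. v (int k))) D0" unfolding D0 by (rule diagram_of_PH[OF M2]) simp
    have "\<exists>p\<in>#D0. snd p = ereal (v k)"
    proof (rule ccontr)
      assume no: "\<not> ?thesis"
      have ninf: "y \<noteq> - \<infinity>" if "y \<in> snd ` set_mset D0" for y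
        using that dg unfolding diagram_of_def by (auto simp: less_ereal.simps)
      \<comment> \<open>Level \<open>t\<close> is below the peak, not below its two neighbours, and
        with no death strictly between \<open>t\<close> and the peak. If the peak itself were no
        death, the components present at \<open>t\<close> would keep their number up to the peak,
        although the two neighbours become linked there.\<close>
      obtain t where t: "max (v (k + 1)) (v (k - 1)) \<le> t" "ereal t < ereal (v k)"
        "\<And>y. y \<in> snd ` set_mset D0 \<Longrightarrow> y < ereal (v k) \<Longrightarrow> y \<le> ereal t"
        by (rule finite_ereal_gap_below[of "snd ` set_mset D0" "max (v (k + 1)) (v (k - 1))" "ereal (v k)"])
           (use low ninf in auto)
      have t': "t < v k" using t(2) by simp
      have "ereal t < snd p \<longleftrightarrow> ereal (v k) < snd p" if "p \<in># D0" for p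
      proof -
        have "snd p \<noteq> ereal (v k)" using no that by blast
        moreover have "snd p < ereal (v k) \<longrightarrow> snd p \<le> ereal t" using t(3) that by blast
        ultimately show ?thesis using t(2) by (meson less_trans linorder_neqE not_le)
      qed
      then have "filter_mset (\<lambda>p. fst p \<le> t \<and> ereal t < snd p) D0 = filter_mset (\<lambda>p. fst p \<le> t \<and> ereal (v k) < snd p) D0"
        by (intro filter_mset_cong refl) auto
      then have "hrank 0 (2 * M) (\<lambda>k. v (int k)) t t = hrank 0 (2 * M) (\<lambda>k. v (int k)) t (v k)"
        using dg t' unfolding diagram_of_def by simp
      then have "card (component ?l v t ` {i. v i \<le> t}) = card (component ?l v (v k) ` {i. v i \<le> t})"
        using hrank_0_eq_card_components[OF M2, of t t "\<lambda>k. v (int k)"]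
          hrank_0_eq_card_components[OF M2, of t "v k" "\<lambda>k. v (int k)"] t' unfolding up L by simp
      moreover have "card (component ?l v (v k) ` {i. v i \<le> t}) < card (component ?l v t ` {i. v i \<le> t})"
      proof (rule card_image_less_kernel)
        show "finite (component ?l v t ` {i. v i \<le> t})"
          using finite_components[OF M2, of "\<lambda>k. v (int k)" t] unfolding up L .
        show "component ?l v (v k) x = component ?l v (v k) y" if "component ?l v t x = component ?l v t y" for x y
          using that linked_mono t' unfolding component_eq_iff by (meson less_imp_le)
        show "k + 1 \<in> {i. v i \<le> t}" "k - 1 \<in> {i. v i \<le> t}" using t(1) by auto
        have "(k + 1, k) \<in> linked ?l v (v k)" "(k, k - 1) \<in> linked ?l v (v k)"
          by (rule linked_step; use low in simp)+
        then show "component ?l v (v k) (k + 1) = component ?l v (v k) (k - 1)"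
          unfolding component_eq_iff by (rule linked_trans)
        show "component ?l v t (k + 1) \<noteq> component ?l v t (k - 1)"
          unfolding component_eq_iff
          by (rule not_linked_across_peaks[OF m(1,2)]) (use t t' m(3) per M in auto)
      qed
      ultimately show False by simp
    qed
    then obtain p where "p \<in># D0" "snd p = ereal (v k)" by blast
    then have "v k = real_of_ereal (snd p)" "p \<in># D0" by auto
    then show ?thesis by blast
  qed
qed

section \<open>Every nonconstant vector is a zigzag vector\<close>

text \<open>\<open>up i\<close> says that the next change of \<open>W\<close> after \<open>i\<close> is an increase; the phase has integral part
  equal to the number of changes of \<open>up\<close>.\<close>

lemma zigzag_representation:
  fixes W :: "int \<Rightarrow> real"
  assumes n: "n > 0" and per: "\<And>i. W (i + n) = W i" and nonconst: "W p \<noteq> W q"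
  obtains M :: nat and v \<theta> where "M > 0" "alternating (2 * int M) v" "\<theta> \<in> phases n (2 * int M)"
    "\<And>i. W i = zigzag v (\<theta> i)"
proof -
  define up where "up i \<longleftrightarrow> (\<exists>j\<ge>i. (\<forall>m. i \<le> m \<longrightarrow> m \<le> j \<longrightarrow> W m = W i) \<and> W j < W (j + 1))" for i
  have upI: "up i" if "i \<le> j" "\<And>m. i \<le> m \<Longrightarrow> m \<le> j \<Longrightarrow> W m = W i" "W j < W (j + 1)" for i j
    unfolding up_def using that by blast
  have up1: "up i" if "W i < W (i + 1)" for i
    unfolding up_def using that by (intro exI[of _ i]) (auto dest: order_antisym)
  have up2: "\<not> up i" if "W (i + 1) < W i" for i
  proof
    assume "up i"
    then obtain j where j: "j \<ge> i" "\<forall>m. i \<le> m \<longrightarrow> m \<le> j \<longrightarrow> W m = W i" "W j < W (j + 1)" unfolding up_def by blast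
    show False
    proof (cases "j = i")
      case True then show ?thesis using j(3) that by simp
    next
      case False
      then have "W (i + 1) = W i" using j(1) by (intro j(2)[rule_format]) auto
      then show ?thesis using that by simp
    qed
  qed
  have up3: "up i \<longleftrightarrow> up (i + 1)" if eq: "W (i + 1) = W i" for i
  proof
    assume "up i"
    then obtain j where j: "j \<ge> i" "\<forall>m. i \<le> m \<longrightarrow> m \<le> j \<longrightarrow> W m = W i" "W j < W (j + 1)" unfolding up_def by blast
    have "j \<noteq> i" using j(3) eq by auto
    then have ij: "i + 1 \<le> j" using j(1) by simp
    have "W m = W (i + 1)" if "i + 1 \<le> m" "m \<le> j" for m
      using j(2)[rule_format, of m] eq that by simp
    then show "up (i + 1)" by (rule upI[OF ij _ j(3)])
  next
    assume "up (i + 1)"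
    then obtain j where j: "j \<ge> i + 1" "\<forall>m. i + 1 \<le> m \<longrightarrow> m \<le> j \<longrightarrow> W m = W (i + 1)" "W j < W (j + 1)" unfolding up_def by blast
    have "W m = W i" if "i \<le> m" "m \<le> j" for m
      using j(2)[rule_format, of m] eq that by (cases "m = i") auto
    moreover have "i \<le> j" using j(1) by simp
    ultimately show "up i" using j(3) by (intro upI[of i j])
  qed
  have up4: "up (i + n) \<longleftrightarrow> up i" for i
  proof
    assume "up (i + n)"
    then obtain j where j: "j \<ge> i + n" "\<forall>m. i + n \<le> m \<longrightarrow> m \<le> j \<longrightarrow> W m = W (i + n)" "W j < W (j + 1)" unfolding up_def by blast
    have "W m = W i" if "i \<le> m" "m \<le> j - n" for m
      using j(2)[rule_format, of "m + n"] per[of m] per[of i] that by simp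
    moreover have "W (j - n) < W (j - n + 1)" using j(3) per[of "j - n"] per[of "j - n + 1"] by simp
    moreover have "i \<le> j - n" using j(1) by simp
    ultimately show "up i" by (intro upI[of i "j - n"])
  next
    assume "up i"
    then obtain j where j: "j \<ge> i" "\<forall>m. i \<le> m \<longrightarrow> m \<le> j \<longrightarrow> W m = W i" "W j < W (j + 1)" unfolding up_def by blast
    have "W m = W (i + n)" if "i + n \<le> m" "m \<le> j + n" for m
    proof -
      have "W (m - n) = W i" using that by (intro j(2)[rule_format]) auto
      then show ?thesis using per[of "m - n"] per[of i] by simp
    qed
    moreover have "W (j + n) < W (j + n + 1)" using j(3) per[of j] per[of "j + 1"] by (simp add: ac_simps)
    moreover have "i + n \<le> j + n" using j(1) by simp
    ultimately show "up (i + n)" by (intro upI[of "i + n" "j + n"])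
  qed
  define \<delta> :: "int \<Rightarrow> int" where "\<delta> i = of_bool (up (i + 1) \<noteq> up i)" for i
  obtain \<kappa> where \<kappa>: "\<And>i. \<kappa> (i + 1) = \<kappa> i + \<delta> i" "\<kappa> 0 = of_bool (\<not> up 0)"
    using int_primitive[of \<delta> 0 "of_bool (\<not> up 0)"] by metis
  have \<delta>01: "\<delta> i = 0 \<or> \<delta> i = 1" for i by (auto simp: \<delta>_def)
  have parity: "even (\<kappa> i) \<longleftrightarrow> up i" for i
  proof (induction i rule: int_induct[where k=0])
    case base then show ?case using \<kappa>(2) by simp
  next
    case (step1 i) then show ?case using \<kappa>(1)[of i] by (auto simp: \<delta>_def)
  next
    case (step2 i) then show ?case using \<kappa>(1)[of "i - 1"] by (cases "up (i - 1)"; cases "up i") (auto simp: \<delta>_def)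
  qed
  have \<kappa>mono: "\<kappa> i \<le> \<kappa> (i + 1)" "\<kappa> (i + 1) \<le> \<kappa> i + 1" for i using \<kappa>(1)[of i] \<delta>01[of i] by auto
  define T where "T = \<kappa> n - \<kappa> 0"
  have \<kappa>per: "\<kappa> (i + n) = \<kappa> i + T" for i
  proof -
    have st: "\<delta> (i + n) = \<delta> i" for i using up4[of i] up4[of "i + 1"] by (simp add: \<delta>_def ac_simps)
    show ?thesis
    proof (induction i rule: int_induct[where k=0])
      case base then show ?case by (simp add: T_def)
    next
      case (step1 i)
      have "\<kappa> (i + 1 + n) = \<kappa> (i + n) + \<delta> (i + n)" using \<kappa>(1)[of "i + n"] by (simp add: ac_simps)
      then show ?case using step1 st[of i] \<kappa>(1)[of i] by simp
    next
      case (step2 i)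
      have "\<kappa> (i + n) = \<kappa> (i - 1 + n) + \<delta> (i - 1 + n)" using \<kappa>(1)[of "i - 1 + n"] by (simp add: algebra_simps)
      then show ?case using step2 st[of "i - 1"] \<kappa>(1)[of "i - 1"] by simp
    qed
  qed
  have evT: "even T" using parity[of 0] parity[of n] up4[of 0] by (simp add: T_def)
  have \<kappa>le: "\<kappa> i \<le> \<kappa> j" if "i \<le> j" for i j using int_step_mono[of \<kappa>, OF \<kappa>mono(1) that] .
  have dir: "if even (\<kappa> i) then W i \<le> W (i + 1) else W (i + 1) \<le> W i" for i
    using up1[of i] up2[of i] parity[of i] by (auto simp: not_less[symmetric])
  have strict: "W i \<noteq> W (i + 1)" if "\<kappa> (i + 1) \<noteq> \<kappa> i" for i
    using that \<kappa>(1)[of i] up3[of i] by (auto simp: \<delta>_def)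
  \<comment> \<open>If the direction never changed, \<open>W\<close> would be monotone and periodic,
    hence constant.\<close>
  have Tpos: "T > 0"
  proof (rule ccontr)
    assume "\<not> T > 0"
    then have "T = 0" using \<kappa>le[of 0 n] n by (simp add: T_def)
    then have perq: "\<kappa> (i + q * n) = \<kappa> i" "W (i + q * n) = W i" for i q
      using int_period_mult[of \<kappa> n 0 i q] int_period_mult[of W n 0 i q] \<kappa>per per by simp_all
    have const: "\<kappa> i = \<kappa> j" for i j
    proof -
      have le: "\<kappa> i \<le> \<kappa> j" for i j
      proof -
        have "\<bar>i\<bar> + \<bar>j\<bar> \<le> (\<bar>i\<bar> + \<bar>j\<bar>) * n" using n mult_left_mono[of 1 n "\<bar>i\<bar> + \<bar>j\<bar>"] by simp
        then have "i \<le> j + (\<bar>i\<bar> + \<bar>j\<bar>) * n" by linarith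
        then show ?thesis using \<kappa>le perq(1) by metis
      qed
      show ?thesis using le[of i j] le[of j i] by simp
    qed
    define s :: real where "s = (if even (\<kappa> 0) then 1 else - 1)"
    have "s * W i \<le> s * W (i + 1)" for i using dir[of i] const[of i 0] by (auto simp: s_def)
    then have mono: "s * W i \<le> s * W j" if "i \<le> j" for i j using int_step_mono[of "\<lambda>i. s * W i" i j] that by blast
    have "s * W i \<le> s * W j" for i j
    proof -
      have "\<bar>i\<bar> + \<bar>j\<bar> \<le> (\<bar>i\<bar> + \<bar>j\<bar>) * n" using n mult_left_mono[of 1 n "\<bar>i\<bar> + \<bar>j\<bar>"] by simp
      then have "i \<le> j + (\<bar>i\<bar> + \<bar>j\<bar>) * n" by linarith
      then show ?thesis using mono perq(2) by metis
    qed
    then have "s * W p = s * W q" by (meson order_antisym)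
    then show False using nonconst by (auto simp: s_def split: if_splits)
  qed
  have "\<exists>c. \<forall>i. k \<le> \<kappa> i \<longleftrightarrow> c \<le> i" for k
  proof -
    have q: "\<kappa> (0 + q * n) = \<kappa> 0 + q * T" for q using int_period_mult[of \<kappa> n T 0 q] \<kappa>per by simp
    obtain x where x: "0 \<le> x" "k - \<kappa> 0 \<le> x" "\<kappa> 0 - k \<le> x" by (rule that[of "\<bar>k - \<kappa> 0\<bar>"]) auto
    have xT: "x \<le> x * T" using mult_left_mono[of 1 T x] Tpos x(1) by simp
    have "k \<le> \<kappa> 0 + x * T" using xT x(2) by linarith
    then have a: "k \<le> \<kappa> (0 + x * n)" unfolding q .
    have "(- (x + 1)) * T = - (x * T) - T" by (simp add: algebra_simps)
    then have "\<kappa> 0 + (- (x + 1)) * T < k" using xT x(3) Tpos by linarith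
    then have b: "\<not> k \<le> \<kappa> (0 + (- (x + 1)) * n)" unfolding q by simp
    have st: "k \<le> \<kappa> (i + 1)" if "k \<le> \<kappa> i" for i using \<kappa>mono(1)[of i] that by linarith
    show ?thesis by (rule int_threshold[of "\<lambda>i. k \<le> \<kappa> i", OF a b st]) blast+
  qed
  then obtain a where a: "\<And>k i. k \<le> \<kappa> i \<longleftrightarrow> a k \<le> i" by metis
  have \<kappa>a: "\<kappa> (a k) = k" for k
    using a[of k "a k"] a[of k "a k - 1"] \<kappa>mono(2)[of "a k - 1"] by simp
  \<comment> \<open>\<open>up\<close> looks ahead past plateaus, so it flips at the first index of
    the plateau at an extremum. Thus \<open>a k\<close> is the left end of the \<open>k\<close>-th
    extremal plateau and \<open>v k\<close> its height.\<close>
  define v where "v k = W (a k)" for k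
  have aT: "a (k + T) = a k + n" for k
  proof -
    have "a (k + T) \<le> i \<longleftrightarrow> a k + n \<le> i" for i
      using a[of "k + T" i] a[of k "i - n"] \<kappa>per[of "i - n"] by auto
    then show ?thesis by (meson order_antisym order_refl)
  qed
  have range: "a (\<kappa> i) \<le> i" "i < a (\<kappa> i + 1)" for i using a[of "\<kappa> i" i] a[of "\<kappa> i + 1" i] by auto
  have \<kappa>eq: "\<kappa> i = k" if "a k \<le> i" "i < a (k + 1)" for i k using a[of k i] a[of "k + 1" i] that by linarith
  \<comment> \<open>This sign turns descending stretches into ascending ones, so both directions are
    treated at once.\<close>
  define s :: "int \<Rightarrow> real" where "s k = (if even k then 1 else - 1)" for k
  have ss: "s k * s k = 1" "s k \<noteq> 0" for k by (auto simp: s_def)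
  have sdir: "s k * W i \<le> s k * W (i + 1)" if "a k \<le> i" "i < a (k + 1)" for i k
    using dir[of i] \<kappa>eq[OF that] by (auto simp: s_def)
  have smono: "s k * W i \<le> s k * W j" if "a k \<le> i" "i \<le> j" "j \<le> a (k + 1)" for i j k
    using that(2,3)
  proof (induction j rule: int_ge_induct)
    case (step j)
    then show ?case using sdir[of k j] that(1) by force
  qed simp
  have alt: "a k < a (k + 1)" for k using range[of "a k"] \<kappa>a[of k] by simp
  have low: "s (\<kappa> i) * v (\<kappa> i) \<le> s (\<kappa> i) * W i" for i
    unfolding v_def by (rule smono) (use range[of i] in auto)
  have high: "s (\<kappa> i) * W i < s (\<kappa> i) * v (\<kappa> i + 1)" for i
  proof -
    let ?k = "\<kappa> i"
    let ?e = "a (?k + 1) - 1"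
    have "s ?k * W i \<le> s ?k * W ?e" by (rule smono) (use range[of i] in auto)
    moreover have ke: "\<kappa> ?e = ?k" by (rule \<kappa>eq) (use alt[of ?k] in auto)
    moreover have "s ?k * W ?e \<le> s ?k * W (?e + 1)" by (rule sdir) (use alt[of ?k] in auto)
    moreover have "W ?e \<noteq> W (?e + 1)" by (rule strict) (use ke \<kappa>a[of "?k + 1"] in simp)
    then have "s ?k * W ?e \<noteq> s ?k * W (?e + 1)" using ss(2) by simp
    ultimately have "s ?k * W i < s ?k * W (?e + 1)" by linarith
    then show ?thesis unfolding v_def by simp
  qed
  have vs: "s k * v k < s k * v (k + 1)" for k using low[of "a k"] high[of "a k"] \<kappa>a[of k] by simp
  have alt_v: "alternating T v"
  proof -
    have "v (k + T) = v k" for k unfolding v_def aT using per by simp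
    moreover have "if even k then v k < v (k + 1) else v (k + 1) < v k" for k using vs[of k] by (auto simp: s_def split: if_splits)
    ultimately show ?thesis by (simp add: alternating_def)
  qed
  \<comment> \<open>The fraction of the way from the last extremal value to the next one. It is 0 at
    the start of each stretch and stays below 1, because the next extremum already belongs to the
    next stretch.\<close>
  define \<rho> where "\<rho> i = (W i - v (\<kappa> i)) / (v (\<kappa> i + 1) - v (\<kappa> i))" for i
  have \<rho>s: "\<rho> i = (s (\<kappa> i) * W i - s (\<kappa> i) * v (\<kappa> i)) / (s (\<kappa> i) * v (\<kappa> i + 1) - s (\<kappa> i) * v (\<kappa> i))" for i
    unfolding \<rho>_def right_diff_distrib[symmetric] using ss(2)[of "\<kappa> i"] by simp
  have \<rho>: "0 \<le> \<rho> i" "\<rho> i < 1" for i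
    unfolding \<rho>s using low[of i] high[of i] vs[of "\<kappa> i"] by (auto simp: divide_less_eq)
  define \<theta> where "\<theta> i = of_int (\<kappa> i) + \<rho> i" for i
  have fl: "\<lfloor>\<theta> i\<rfloor> = \<kappa> i" for i unfolding \<theta>_def using \<rho>[of i] by linarith
  have zz: "W i = zigzag v (\<theta> i)" for i
  proof -
    have "v (\<kappa> i + 1) - v (\<kappa> i) \<noteq> 0" using vs[of "\<kappa> i"] by auto
    then have "\<rho> i * (v (\<kappa> i + 1) - v (\<kappa> i)) = W i - v (\<kappa> i)" by (simp add: \<rho>_def)
    then show ?thesis unfolding zigzag_def fl by (simp add: \<theta>_def)
  qed
  have step: "\<theta> i \<le> \<theta> (i + 1) \<and> \<theta> (i + 1) \<le> of_int \<lfloor>\<theta> i\<rfloor> + 1" for i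
  proof (cases "\<kappa> (i + 1) = \<kappa> i")
    case True
    let ?k = "\<kappa> i"
    have "s ?k * W i \<le> s ?k * W (i + 1)" by (rule sdir) (use range[of i] in auto)
    then have "\<rho> i \<le> \<rho> (i + 1)" unfolding \<rho>s True using vs[of ?k] by (intro divide_right_mono) auto
    then show ?thesis unfolding fl using \<rho>[of "i + 1"] True by (simp add: \<theta>_def)
  next
    case False
    then have k1: "\<kappa> (i + 1) = \<kappa> i + 1" using \<kappa>(1)[of i] \<delta>01[of i] by auto
    have "i + 1 = a (\<kappa> i + 1)" using range(1)[of "i + 1"] range(2)[of i] k1 by simp
    then have "W (i + 1) = v (\<kappa> (i + 1))" unfolding k1 v_def by simp
    then have "\<rho> (i + 1) = 0" by (simp add: \<rho>_def)
    then show ?thesis unfolding fl using \<rho>[of i] k1 by (simp add: \<theta>_def)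
  qed
  have "\<theta> (i + n) = \<theta> i + of_int T" for i
  proof -
    have "v (\<kappa> i + T) = v (\<kappa> i)" "v (\<kappa> i + T + 1) = v (\<kappa> i + 1)"
      using alt_v unfolding alternating_def by (metis, metis add.commute add.left_commute)
    then show ?thesis unfolding \<theta>_def \<rho>_def \<kappa>per per by simp
  qed
  then have ph: "\<theta> \<in> phases n T" using step by (simp add: phases_def quasi_periodic_def)
  have T: "T = 2 * int (nat (T div 2))" using evT Tpos by auto
  show ?thesis
  proof (rule that)
    show "nat (T div 2) > 0" using evT Tpos by auto
    show "alternating (2 * int (nat (T div 2))) v" using alt_v T by simp
    show "\<theta> \<in> phases n (2 * int (nat (T div 2)))" using ph T by simp
  qed (rule zz)
qed

section \<open>The connected component\<close>

lemma ex_minimal_even_period: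
  assumes "M > 0" "alternating (2 * int M) v"
  obtains r where "minimal_even_period r v"
proof -
  define per where "per m \<longleftrightarrow> (\<forall>k. v (k + m) = v k)" for m
  define r where "r = (LEAST r. r > 0 \<and> per (2 * int r))"
  have "M > 0 \<and> per (2 * int M)" using assms by (auto simp: per_def alternating_def)
  then have r: "r > 0 \<and> per (2 * int r)" unfolding r_def by (rule LeastI)
  have mult: "v (k + q * (2 * int r)) = v k" for k q
    using int_period_mult[of v "2 * int r" 0 k q] r by (simp add: per_def)
  have "per m \<longleftrightarrow> 2 * int r dvd m" if "even m" for m
  proof
    assume m: "per m"
    define e where "e = m mod (2 * int r)"
    have e: "0 \<le> e" "e < 2 * int r" "even e" using r \<open>even m\<close> by (auto simp: e_def dvd_mod_iff)
    have "v (k + e) = v k" for k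
    proof -
      have "k + e + (m div (2 * int r)) * (2 * int r) = k + m" unfolding e_def using mod_mult_div_eq[of m "2 * int r"] by (simp add: mult.commute)
      then have "v (k + m) = v (k + e)" using mult[of "k + e" "m div (2 * int r)"] by (simp only:)
      then show ?thesis using m by (simp add: per_def)
    qed
    then have "per e" by (simp add: per_def)
    obtain f where f: "e = 2 * f" using e(3) by (rule evenE)
    have "\<not> nat f < r"
      if "e \<noteq> 0"
    proof
      assume "nat f < r"
      then have "\<not> (nat f > 0 \<and> per (2 * int (nat f)))" unfolding r_def by (rule not_less_Least)
      then show False using \<open>per e\<close> f e(1) that by simp
    qed
    moreover have "nat f < r" using e f by linarith
    ultimately have "e = 0" by blast
    then show "2 * int r dvd m" by (simp add: e_def dvd_eq_mod_eq_0)
  next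
    assume "2 * int r dvd m"
    then obtain q where "m = 2 * int r * q" by (rule dvdE)
    then show "per m" using mult by (simp add: per_def mult.commute)
  qed
  then have "minimal_even_period r v" using r by (simp add: minimal_even_period_def per_def)
  then show ?thesis by (rule that)
qed

lemma finite_alternating:
  assumes "finite V" "l > 0"
  shows "finite {v. alternating l v \<and> range v \<subseteq> V}"
proof -
  let ?F = "{v. alternating l v \<and> range v \<subseteq> V}"
  have inj: "inj_on (\<lambda>v. restrict v {0..<l}) ?F"
  proof (rule inj_onI, rule ext)
    fix v v' k assume v: "v \<in> ?F" "v' \<in> ?F" "restrict v {0..<l} = restrict v' {0..<l}"
    have "v (k mod l) = v' (k mod l)" using fun_cong[OF v(3), of "k mod l"] assms(2) by simp
    moreover have "v (k mod l) = v k" "v' (k mod l) = v' k"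
      using periodic_mod[of v l k] periodic_mod[of v' l k] v(1,2) by (auto simp: alternating_def)
    ultimately show "v k = v' k" by simp
  qed
  have sub: "(\<lambda>v. restrict v {0..<l}) ` ?F \<subseteq> PiE {0..<l} (\<lambda>_. V)" by auto
  have fin: "finite (PiE {0..<l} (\<lambda>_. V))" using assms(1) by (intro finite_PiE) auto
  show ?thesis by (rule finite_imageD[OF finite_subset[OF sub fin] inj])
qed

text \<open>By rigidity one common vector makes \<open>v'\<close> an even shift of \<open>v\<close>,
  and shifting phases by an integer absorbs the difference for all vectors.\<close>

lemma zigzag_vectors_eq_or_disjoint:
  assumes "int N > 0" "l > 0" "alternating l v" "alternating l v'"
    and "zigzag_vectors N l v \<inter> zigzag_vectors N l v' \<noteq> {}"
  shows "zigzag_vectors N l v' \<subseteq> zigzag_vectors N l v"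
proof -
  obtain w \<theta> \<theta>' where \<theta>: "\<theta> \<in> phases (int N) l" "\<And>i. unroll N w i = zigzag v (\<theta> i)"
    and \<theta>': "\<theta>' \<in> phases (int N) l" "\<And>i. unroll N w i = zigzag v' (\<theta>' i)"
    using assms(5) unfolding zigzag_vectors_def by blast
  have eq: "zigzag v (\<theta> i) = zigzag v' (\<theta>' i)" for i using \<theta>(2)[of i] \<theta>'(2)[of i] by simp
  obtain m where m: "even m" "\<And>i. \<theta>' i = \<theta> i + of_int m" "\<And>k. v' (k + m) = v k"
    using zigzag_rigid[OF \<theta>(1) \<theta>'(1) assms(1,2,3,4) eq] by metis
  have zz: "zigzag v x = zigzag v' (x + of_int m)" for x
    using zigzag_shift[of v' m x] m(3) by simp
  show ?thesis
  proof
    fix u assume "u \<in> zigzag_vectors N l v'"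
    then obtain \<phi> where u: "u \<in> RN N" "\<phi> \<in> phases (int N) l" "\<And>i. unroll N u i = zigzag v' (\<phi> i)"
      by (auto simp: zigzag_vectors_def)
    have "(\<lambda>i. \<phi> i + of_int (- m)) \<in> phases (int N) l" by (rule phases_shift[OF u(2)])
    moreover have "unroll N u i = zigzag v (\<phi> i + of_int (- m))" for i using u(3)[of i] zz by simp
    ultimately show "u \<in> zigzag_vectors N l v"
      using u(1) unfolding zigzag_vectors_def by (intro CollectI conjI bexI[of _ "\<lambda>i. \<phi> i + of_int (- m)"]) auto
  qed
qed

text \<open>If \<open>m\<close> is a period of \<open>v\<close>, positions of phases 0 and
  \<open>m\<close> carry the same coordinate value. Distinct coordinates make these positions
  congruent modulo \<open>N\<close>, so \<open>m\<close> is a multiple of the phase gain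
  \<open>2 * int M\<close>.\<close>

lemma typical_minimal_even_period:
  assumes "N > 0" "M > 0" "typical N z" "\<theta> \<in> phases (int N) (2 * int M)" "alternating (2 * int M) v"
    and z: "\<And>i. unroll N z i = zigzag v (\<theta> i)"
  shows "minimal_even_period M v"
proof -
  have "2 * int M dvd m" if m: "\<forall>k. v (k + m) = v k" for m
  proof -
    have l: "2 * int M > 0" using assms(2) by simp
    obtain a where a: "\<theta> a = of_int 0" using phases_first_hit[OF assms(4) l, of 0] by metis
    obtain b where b: "\<theta> b = of_int m" using phases_first_hit[OF assms(4) l, of m] by metis
    have "unroll N z a = v 0" "unroll N z b = v m" unfolding z a b by (rule zigzag_of_int)+
    then have "z (nat (a mod int N)) = z (nat (b mod int N))" using m[rule_format, of 0] by (simp add: unroll_def)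
    then have "nat (a mod int N) = nat (b mod int N)"
      using assms(3) unroll_mod[OF assms(1)] unfolding typical_def inj_on_def by simp
    then have "a mod int N = b mod int N" using assms(1) by (simp add: eq_nat_nat_iff)
    then obtain q where "b = a + q * int N" by (metis mod_eqE mult.commute add.commute diff_add_cancel minus_diff_eq mod_eq_dvd_iff dvdE)
    then have "\<theta> b = \<theta> a + of_int (q * (2 * int M))"
      using quasi_periodicD(3)[OF phases_quasi_periodic[OF assms(4)], of a q] by simp
    then have "real_of_int m = real_of_int (q * (2 * int M))" using a b by simp
    then have "m = q * (2 * int M)" by (simp only: of_int_eq_iff)
    then show ?thesis by simp
  qed
  moreover have "\<forall>k. v (k + m) = v k" if dvd: "2 * int M dvd m" for m
  proof
    fix k
    obtain q where "m = 2 * int M * q" using dvd by (rule dvdE)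
    then show "v (k + m) = v k" using int_period_mult[of v "2 * int M" 0 k q] assms(5) by (simp add: alternating_def mult.commute)
  qed
  ultimately show ?thesis using assms(2) unfolding minimal_even_period_def by blast
qed

text \<open>Degree 1 determines the maximum. A constant vector has no vertices below its maximum, so
  its degree 0 rank vanishes there, whereas that of \<open>z\<close> does not.\<close>

lemma dataP_nonconstant:
  assumes N: "N > 0" and z: "unroll N z p \<noteq> unroll N z q" and w: "w \<in> dataP N z"
  shows "\<exists>i j. unroll N w i \<noteq> unroll N w j"
proof (rule ccontr)
  assume "\<not> ?thesis"
  then obtain c where c: "\<And>i. unroll N w i = c" by metis
  have eq: "hrank k N w s t = hrank k N z s t" if "k \<in> {0, 1}" "s \<le> t" for k s t
    using w PH_eq_iff[OF N N that(1), of w z] that by (auto simp: dataP_def)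
  have all: "(\<forall>i. unroll N z i \<le> s) \<longleftrightarrow> c \<le> s" for s
    using eq[of 1 s s] hrank_1_eq[OF N, of w s s] hrank_1_eq[OF N, of z s s] c
    by (cases "c \<le> s"; cases "\<forall>i. unroll N z i \<le> s") simp_all
  then have zc: "unroll N z i \<le> c" for i by blast
  have "unroll N z p < c \<or> unroll N z q < c" using z zc[of p] zc[of q] by linarith
  then obtain i where i: "unroll N z i < c" by blast
  let ?t = "unroll N z i"
  have "component (int N) (unroll N z) ?t ` {j. unroll N z j \<le> ?t} \<noteq> {}" by auto
  then have "hrank 0 N z ?t ?t \<noteq> 0"
    unfolding hrank_0_eq_card_components[OF N order_refl] using finite_components[OF N] by (simp add: card_eq_0_iff)
  moreover have "hrank 0 N w ?t ?t = 0"
    unfolding hrank_0_eq_card_components[OF N order_refl] using c i by simp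
  ultimately show False using eq[of 0 ?t ?t] by simp
qed

lemma zigzag_vectors_subset_dataP:
  assumes NM: "N > 0" "M > 0" and v: "alternating (2 * int M) v"
    and z: "z \<in> zigzag_vectors N (2 * int M) v"
  shows "zigzag_vectors N (2 * int M) v \<subseteq> dataP N z"
proof
  fix w assume w: "w \<in> zigzag_vectors N (2 * int M) v"
  have "PH k N u = PH k (2 * M) (\<lambda>k. v (int k))" if "u \<in> zigzag_vectors N (2 * int M) v" "k \<in> {0, 1}" for u k
    using that PH_zigzag[OF NM _ v] unfolding zigzag_vectors_def by blast
  then have "PH k N w = PH k N z" if "k \<in> {0, 1}" for k using w z that by metis
  then show "w \<in> dataP N z" using w by (simp add: dataP_def zigzag_vectors_def)
qed

lemma dataP_subset_zigzag_vectors: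
  assumes N: "N > 0" and nc: "unroll N z p \<noteq> unroll N z q" and M: "size (PH 0 N z) = M"
    and V: "V = fst ` set_mset (PH 0 N z) \<union> real_of_ereal ` snd ` set_mset (PH 0 N z) \<union> fst ` set_mset (PH 1 N z)"
    and w: "w \<in> dataP N z"
  shows "\<exists>v. alternating (2 * int M) v \<and> range v \<subseteq> V \<and> w \<in> zigzag_vectors N (2 * int M) v"
proof -
  have PH: "PH 0 N w = PH 0 N z" "PH 1 N w = PH 1 N z" "w \<in> RN N" using w by (auto simp: dataP_def)
  obtain i j where ij: "unroll N w i \<noteq> unroll N w j" using dataP_nonconstant[OF N nc w] by blast
  have iN: "int N > 0" using N by simp
  obtain M' v \<theta> where r: "M' > 0" "alternating (2 * int M') v" "\<theta> \<in> phases (int N) (2 * int M')"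
    "\<And>i. unroll N w i = zigzag v (\<theta> i)"
    using zigzag_representation[OF iN unroll_periodic ij] by metis
  have PHv: "PH k N w = PH k (2 * M') (\<lambda>k. v (int k))" if "k \<in> {0, 1}" for k
    by (rule PH_zigzag[OF N r(1,3,2,4) that])
  have "M' = M" using polygon_PH_0(1)[OF r(1,2)] PHv[of 0] PH(1) M by simp
  moreover have "v k \<in> V" for k
    unfolding V by (rule polygon_values[OF r(1,2)]) (use PHv[of 0] PHv[of 1] PH in auto)
  ultimately show ?thesis using r PH(3) unfolding zigzag_vectors_def by blast
qed

theorem theorem4p1:
  fixes N M :: nat and z :: "nat \<Rightarrow> real"
  assumes "N > 2 * M" and "2 * M \<ge> 2"
    and "z \<in> RN N" and "typical N z"
    and "size (PH 0 N z) = M"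
  shows "connected_component_set (dataP N z) z homeomorphic poset_realization (Str N M) str_less"
proof -
  have N: "N > 0" "int N > 0" and M: "M > 0" and NM: "int N > 2 * int M" "2 * int M > 0" using assms(1,2) by auto
  let ?Z = "zigzag_vectors N (2 * int M)"
  have z01: "unroll N z 0 \<noteq> unroll N z 1"
  proof -
    have "z 0 \<noteq> z 1" using inj_onD[OF assms(4)[unfolded typical_def], of 0 1] assms(1,2) by auto
    then show ?thesis using unroll_int[of 0 N z] unroll_int[of 1 N z] assms(1,2) by simp
  qed
  define V where "V = fst ` set_mset (PH 0 N z) \<union> real_of_ereal ` snd ` set_mset (PH 0 N z) \<union> fst ` set_mset (PH 1 N z)"
  have cover: "\<exists>v. alternating (2 * int M) v \<and> range v \<subseteq> V \<and> w \<in> ?Z v" if "w \<in> dataP N z" for w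
    by (rule dataP_subset_zigzag_vectors[OF N(1) z01 assms(5) V_def that])
  have zd: "z \<in> dataP N z" using assms(3) by (simp add: dataP_def)
  obtain v where v: "alternating (2 * int M) v" "z \<in> ?Z v" using cover[OF zd] by blast
  obtain \<theta> where \<theta>: "\<theta> \<in> phases (int N) (2 * int M)" "\<And>i. unroll N z i = zigzag v (\<theta> i)"
    using v(2) by (auto simp: zigzag_vectors_def)
  have minper: "minimal_even_period M v" by (rule typical_minimal_even_period[OF N(1) M assms(4) \<theta>(1) v(1) \<theta>(2)])
  \<comment> \<open>A competing \<open>v'\<close> may repeat values, so its minimal even period can
    be smaller than \<open>2 * M\<close>; any such period suffices for compactness.\<close>
  have closed: "closed (?Z v')" if v': "alternating (2 * int M) v'" for v'
  proof -
    obtain r where "minimal_even_period r v'" by (rule ex_minimal_even_period[OF M v'])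
    then have "compact (?Z v')" by (rule connected_compact_zigzag_vectors(1)[OF NM v'])
    then show ?thesis by (rule compact_imp_closed)
  qed
  \<comment> \<open>There are finitely many competitors because their values lie in
    \<open>V\<close>. Those in \<open>F\<close> have zigzag sets disjoint from \<open>?Z v\<close>,
    and their closed union together with \<open>?Z v\<close> covers the component, so connectedness
    leaves only \<open>?Z v\<close>.\<close>
  define F where "F = {v'. alternating (2 * int M) v' \<and> range v' \<subseteq> V \<and> ?Z v \<inter> ?Z v' = {}}"
  have "finite V" unfolding V_def by simp
  then have finF: "finite F"
    using finite_subset[OF _ finite_alternating[OF _ NM(2)], of F V] unfolding F_def by blast
  have "connected_component_set (dataP N z) z = ?Z v"
  proof
    let ?C = "connected_component_set (dataP N z) z"
    have "?C \<subseteq> ?Z v \<union> (\<Union>v'\<in>F. ?Z v')"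
    proof
      fix w assume "w \<in> ?C"
      then have "w \<in> dataP N z" using connected_component_subset by blast
      then obtain v' where v': "alternating (2 * int M) v'" "range v' \<subseteq> V" "w \<in> ?Z v'" using cover by blast
      show "w \<in> ?Z v \<union> (\<Union>v'\<in>F. ?Z v')"
      proof (cases "?Z v \<inter> ?Z v' = {}")
        case True
        then have "v' \<in> F" using v' by (simp add: F_def)
        then show ?thesis using v'(3) by blast
      next
        case False
        then have "?Z v' \<subseteq> ?Z v" by (rule zigzag_vectors_eq_or_disjoint[OF N(2) NM(2) v(1) v'(1)])
        then show ?thesis using v'(3) by blast
      qed
    qed
    moreover have "closed (\<Union>v'\<in>F. ?Z v')" using finF closed by (intro closed_UN) (auto simp: F_def)
    moreover have "?Z v \<inter> (\<Union>v'\<in>F. ?Z v') \<inter> ?C = {}" by (auto simp: F_def)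
    moreover have "connected ?C" by simp
    ultimately have "?Z v \<inter> ?C = {} \<or> (\<Union>v'\<in>F. ?Z v') \<inter> ?C = {}"
      using connected_closedD[of ?C "?Z v" "\<Union>v'\<in>F. ?Z v'"] closed[OF v(1)] by blast
    moreover have "z \<in> ?C" using zd by simp
    ultimately show "?C \<subseteq> ?Z v" using v(2) \<open>?C \<subseteq> ?Z v \<union> (\<Union>v'\<in>F. ?Z v')\<close> by blast
    show "?Z v \<subseteq> ?C"
      by (intro connected_component_maximal v(2) connected_compact_zigzag_vectors(2)[OF NM v(1) minper]
          zigzag_vectors_subset_dataP[OF N(1) M v(1) v(2)])
  qed
  \<comment> \<open>The two sides have minimal even periods \<open>2 * M\<close> and 2; this is
    where the comparison of different periods is used.\<close>
  also have "?Z v homeomorphic ?Z unit_zigzag"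
    by (rule zigzag_vectors_homeomorphic[OF NM v(1) minper alternating_unit_zigzag minimal_even_period_unit_zigzag])
  also have "?Z unit_zigzag homeomorphic poset_realization (Str N M) str_less"
    using Str_realization_homeomorphic[OF N(1) M] homeomorphic_sym by blast
  finally show ?thesis .
qed

end
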